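(* Let $p_0$ be an odd prime and $p$ a power of $p_0$. Let $R(x) = 2x^p + x \in \mathbb{F}_p[x]$ and let $\overline{C}_R$ be the smooth projective compactification over $\mathbb{F}_p$ of the affine curve $y^p - y = xR(x)$. Let $k \geq 1$ be an integer. (1) If $p \equiv 1 \pmod 4$ and $k \equiv 0 \pmod 6$, then $\overline{C}_R$ is $\mathbb{F}_{p^k}$-minimal. (2) If $p \equiv 3 \pmod 4$, then $\overline{C}_R$ is $\mathbb{F}_{p^k}$-maximal if and only if $k \equiv 0 \pmod 6$ and $k/6$ is odd.
   Context: $\overline{C}_R$ is a geometrically connected smooth projective curve over $\mathbb{F}_p$ of genus $g = p(p-1)/2$. For a power $Q$ of $p$, such a curve $C$ of genus $g$ is called $\mathbb{F}_Q$-maximal (resp. $\mathbb{F}_Q$-minimal) if $|C(\mathbb{F}_Q)| = Q + 1 + 2gQ^{1/2}$ (resp. $Q + 1 - 2gQ^{1/2}$). *)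

theory Defs
  imports
    "HOL-Algebra.Algebraic_Closure_Type"
    "HOL-Library.FuncSet"
    "HOL-Library.Cardinality"
    "HOL-Number_Theory.Cong"
    Complex_Main
begin

text \<open>
  The type \<open>'f\<close> is the finite base field; write \<open>p\<close> for its cardinality. For \<open>R\<close> over \<open>'f\<close> the
  affine curve \<open>C\<^sub>R\<close> is \<open>y ^ p - y = x * R x\<close>. Its function field is realised inside a fixed
  algebraic closure of the rational function field \<open>'f(x)\<close>.
\<close>

type_synonym 'f ratfun_closure = "'f poly fract alg_closure"

definition embed_poly :: "'f::{field,finite} poly \<Rightarrow> 'f ratfun_closure" where
  "embed_poly q = to_ac (to_fract q)"

definition embed_const :: "'f::{field,finite} \<Rightarrow> 'f ratfun_closure" where
  "embed_const c = embed_poly [:c:]"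

text \<open>
  The pair \<open>(embed_poly [:0, 1:], generic_y R)\<close> is a generic point of \<open>C\<^sub>R\<close>. The choice of the root
  is immaterial when \<open>Y ^ p - Y - x * R x\<close> is irreducible over \<open>'f(x)\<close>, i.e. when \<open>C\<^sub>R\<close> is an
  irreducible curve: different roots are then conjugate over \<open>'f(x)\<close>.
\<close>

definition generic_y :: "'f::{field,finite} poly \<Rightarrow> 'f ratfun_closure" where
  "generic_y R = (SOME y. y ^ CARD('f) - y = embed_poly ([:0, 1:] * R))"

definition coordinate_ring :: "'f::{field,finite} poly \<Rightarrow> 'f ratfun_closure set" where
  "coordinate_ring R = range (\<lambda>P :: 'f poly poly. poly (map_poly embed_poly P) (generic_y R))"

definition function_field :: "'f::{field,finite} poly \<Rightarrow> 'f ratfun_closure set" where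
  "function_field R = {a / b | a b. a \<in> coordinate_ring R \<and> b \<in> coordinate_ring R \<and> b \<noteq> 0}"

text \<open>
  The smooth projective compactification of \<open>C\<^sub>R\<close> is the complete regular (over the perfect field
  \<open>'f\<close>: smooth) curve with function field \<open>K = function_field R\<close>. Its closed points correspond to
  the valuation rings \<open>A\<close> with \<open>'f \<subseteq> A \<subset> K\<close> and fraction field \<open>K\<close>, the point being
  identified with its local ring; such an \<open>A\<close> is automatically a discrete valuation ring.
\<close>

definition compactification :: "'f::{field,finite} poly \<Rightarrow> 'f ratfun_closure set set" where
  "compactification R = {A.
     range embed_const \<subseteq> A \<and> A \<subset> function_field R \<and>
     (\<forall>a\<in>A. \<forall>b\<in>A. a - b \<in> A \<and> a * b \<in> A) \<and>
     (\<forall>z\<in>function_field R. z \<in> A \<or> inverse z \<in> A)}"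

text \<open>The subfield of degree \<open>k\<close> over \<open>'f\<close> in the algebraic closure of \<open>'f\<close> (for \<open>k \<ge> 1\<close>).\<close>

definition field_ext :: "nat \<Rightarrow> 'f::{field,finite} alg_closure set" where
  "field_ext k = {z. z ^ (CARD('f) ^ k) = z}"

text \<open>
  An \<open>F\<close>-rational point, \<open>F\<close> being the extension of degree \<open>k\<close> of \<open>'f\<close>, is a morphism of
  \<open>'f\<close>-schemes from the spectrum of \<open>F\<close>: a point of the curve with local ring \<open>A\<close>, together with a
  local \<open>'f\<close>-algebra homomorphism \<open>\<phi>\<close> from \<open>A\<close> to \<open>F\<close> (equivalently an embedding of the
  residue field into \<open>F\<close>). Only closed points occur, since the local ring \<open>K\<close> of the generic point
  is infinite. Extensionality makes \<open>\<phi>\<close> unique outside \<open>A\<close>.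
\<close>

definition rational_points ::
    "'f::{field,finite} poly \<Rightarrow> nat \<Rightarrow> ('f ratfun_closure set \<times> ('f ratfun_closure \<Rightarrow> 'f alg_closure)) set"
  where
  "rational_points R k = {(A, \<phi>).
     A \<in> compactification R \<and> \<phi> \<in> A \<rightarrow>\<^sub>E field_ext k \<and>
     (\<forall>c. \<phi> (embed_const c) = to_ac c) \<and>
     (\<forall>a\<in>A. \<forall>b\<in>A. \<phi> (a + b) = \<phi> a + \<phi> b \<and> \<phi> (a * b) = \<phi> a * \<phi> b) \<and>
     (\<forall>a\<in>A. \<phi> a = 0 \<longleftrightarrow> a = 0 \<or> inverse a \<notin> A)}"

text \<open>In the next two definitions \<open>g\<close> is the genus of the compactified curve.\<close>

definition maximal_over :: "nat \<Rightarrow> 'f::{field,finite} poly \<Rightarrow> nat \<Rightarrow> bool" where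
  "maximal_over g R k \<longleftrightarrow> (let Q = real (CARD('f) ^ k) in
     real (card (rational_points R k)) = Q + 1 + 2 * real g * sqrt Q)"

definition minimal_over :: "nat \<Rightarrow> 'f::{field,finite} poly \<Rightarrow> nat \<Rightarrow> bool" where
  "minimal_over g R k \<longleftrightarrow> (let Q = real (CARD('f) ^ k) in
     real (card (rational_points R k)) = Q + 1 - 2 * real g * sqrt Q)"

end

(*
  Write q = p^k and Q(x) = Tr(2 x^(p+1) + x^2) on F_q. By Hilbert 90 the curve has p #{x : Q(x) = 0}
  affine points. If 6 divides k, choose w with w^(p^2) + w^p + w = 0; then
  Q(w z) = - Tr(w^(p+1) (z^p - z)^2), so with v = z^p - z the zeros of Q are counted by those of the
  diagonal form Tr(v^2) on a hyperplane with isotropic normal vector. Over the subfield of index 2 the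
  form s^2 + s^(2 q^(1/2)) is a norm form or hyperbolic, according to q^(1/2) mod 4, and this decides
  the sign. If 3 does not divide k, the polar form of Q has a radical of order at most p, and the second
  moment of the value distribution of Q keeps the number of points away from the Hasse-Weil bound; if k
  is odd and p = 3 mod 4, then q is not a square.

  There is one point at infinity, and the other rational points are the affine ones. Around each
  rational point a chart (x, y) or (1/x, x/y) has a local parameter t such that every nonzero function
  is a power of t times a unit of the local ring, whence a unique valuation ring lies above the point.
  As t one may take x^q - x at finite points: modulo t all regular functions are fixed by a power of
  Frobenius, so those vanishing at the point are multiples of t in its local ring. At infinity t = x/y.
*)
theory Submission
  imports Defs
begin

section \<open>Counting affine points\<close>

text \<open>The equation for w comes from the polar form of Q, which is 2 Tr((t^(p^2) + t^p + t)
  s^p). Its radical in F_q is the set of roots of t^(p^2) + t^p + t there, and these lie in F_(p^3)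
  because X^3 - 1 = (X - 1)(X^2 + X + 1). As p is odd, Q vanishes on its radical, so Q(w z) does not
  change when an element of F_p is added to z: it must be a function of z^p - z. If 3 divides k, all
  p^2 roots are present, and this makes the deviation from q as large as p (p - 1) sqrt q = 2 g sqrt
  q when q is a square; if not, the deviation is smaller by a factor of at least sqrt p. The counts
  avoid characters and Gauss sums: everything is read off from fibres of additive maps and one
  application of Cauchy-Schwarz. Points are valuation rings of a field generated by an arbitrarily
  chosen root, so the equation must first be shown irreducible. The weights p and p + 1 used for
  this are the pole orders of x and y at infinity.\<close>

lemma card_fibre_additive:
  fixes T :: "'a::ab_group_add \<Rightarrow> 'b::ab_group_add"
  assumes diff: "\<And>x y. x \<in> G \<Longrightarrow> y \<in> G \<Longrightarrow> x - y \<in> G"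
    and add: "\<And>x y. x \<in> G \<Longrightarrow> y \<in> G \<Longrightarrow> x + y \<in> G"
    and T: "\<And>x y. x \<in> G \<Longrightarrow> y \<in> G \<Longrightarrow> T (x + y) = T x + T y"
    and c: "c \<in> T ` G"
  shows "card {x \<in> G. T x = c} = card {x \<in> G. T x = 0}"
proof -
  obtain a where a: "a \<in> G" "T a = c" using c by auto
  have Td: "T (x - y) = T x - T y" if "x \<in> G" "y \<in> G" for x y
    using T[OF diff[OF that] that(2)] by (simp add: algebra_simps)
  show ?thesis
    by (rule bij_betw_same_card[of "\<lambda>x. x - a"], rule bij_betwI[where g = "\<lambda>x. x + a"])
       (use a in \<open>auto simp: diff add T Td\<close>)
qed

lemma card_additive_image:
  fixes T :: "'a::ab_group_add \<Rightarrow> 'b::ab_group_add"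
  assumes diff: "\<And>x y. x \<in> G \<Longrightarrow> y \<in> G \<Longrightarrow> x - y \<in> G"
    and add: "\<And>x y. x \<in> G \<Longrightarrow> y \<in> G \<Longrightarrow> x + y \<in> G"
    and T: "\<And>x y. x \<in> G \<Longrightarrow> y \<in> G \<Longrightarrow> T (x + y) = T x + T y"
    and fin: "finite G"
  shows "card G = card (T ` G) * card {x \<in> G. T x = 0}"
proof -
  have "card G = (\<Sum>c\<in>T ` G. card {x \<in> G. T x = c})"
    using sum.image_gen[OF fin, of "\<lambda>_. 1 :: nat" T] by simp
  also have "\<dots> = (\<Sum>c\<in>T ` G. card {x \<in> G. T x = 0})"
    by (intro sum.cong refl card_fibre_additive assms)
  finally show ?thesis by simp
qed

lemma order_le_1:
  fixes f :: "'a::idom poly"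
  assumes "poly (pderiv f) a \<noteq> 0" shows "order a f \<le> 1"
proof (rule ccontr)
  assume "\<not> order a f \<le> 1"
  then have "[:-a, 1:] ^ 2 dvd f" by (simp add: order_divides)
  then obtain h where "f = [:-a, 1:] ^ 2 * h" by (rule dvdE)
  then have h: "f = [:-a, 1:] * ([:-a, 1:] * h)" by (simp only: power2_eq_square mult.assoc)
  have "poly (pderiv f) a = 0"
    unfolding h pderiv_mult poly_mult poly_add by simp
  then show False using assms by blast
qed

text \<open>All roots are simple, so the multiset of linear factors of \<open>f\<close> has no
  repetition and its size, the degree, counts the roots.\<close>

lemma card_roots_separable:
  fixes f :: "'a::alg_closed_field poly"
  assumes sep: "\<And>a. poly f a = 0 \<Longrightarrow> poly (pderiv f) a \<noteq> 0" and f: "f \<noteq> 0"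
  shows "card {x. poly f x = 0} = degree f"
proof -
  have rs: "order a f \<le> 1" for a
    using sep order_le_1[of f a] f by (cases "poly f a = 0") (auto simp: order_0I)
  obtain A where A: "size A = degree f" "f = smult (lead_coeff f) (\<Prod>x\<in>#A. [:-x, 1:])"
    using alg_closed_imp_factorization[OF f] by blast
  have lc: "lead_coeff f \<noteq> 0" using f by simp
  have pr: "proots (\<Prod>x\<in>#B. [:-x, 1:]) = B" for B :: "'a multiset"
  proof (induction B)
    case (add x B)
    have "(\<Prod>x\<in>#B. [:-x, 1:]) \<noteq> 0" by (auto simp: prod_mset_zero_iff)
    then show ?case using add proots_mult[of "[:-x, 1:]" "\<Prod>x\<in>#B. [:-x, 1:]"] by (simp del: mult_pCons_left)
  qed simp
  have "proots f = A" using A(2) lc pr[of A] proots_smult by metis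
  moreover have "count (proots f) x \<le> 1" for x
    using rs f by simp
  ultimately have "A = mset_set (set_mset A)"
    by (intro multiset_eqI) (metis count_greater_zero_iff count_mset_set(1) count_mset_set(3) finite_set_mset
        le_antisym less_one linorder_not_less not_in_iff)
  moreover have "set_mset A = {x. poly f x = 0}"
    using \<open>proots f = A\<close> f set_count_proots by blast
  ultimately show ?thesis using A(1) by (metis size_mset_set)
qed

text \<open>Interpreted twice: over the closure of the base field, which contains the coordinates of
  points, and over the closure of the rational function field, where the same Frobenius and trace
  identities are applied to functions. Here \<open>p\<close> is the order of the base field, hence a
  prime power.\<close>

locale frobenius_field =
  fixes p :: nat and ty :: "'a::alg_closed_field itself"
  assumes prime_CHAR: "prime CHAR('a)"
    and p_power_CHAR: "\<exists>n>0. p = CHAR('a) ^ n"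
    and odd_p: "odd p"
begin

lemma pow_CHAR: "\<exists>n. p ^ i = CHAR('a) ^ n"
  using p_power_CHAR by (metis power_mult)

lemma frob_add: "((x::'a) + y) ^ (p ^ i) = x ^ (p ^ i) + y ^ (p ^ i)"
  using pow_CHAR[of i] freshmans_dream'[OF prime_CHAR] by metis

lemma frob_add1: "((x::'a) + y) ^ p = x ^ p + y ^ p"
  using frob_add[of x y 1] by simp

lemma frob_sum: "(\<Sum>x\<in>A. (f x :: 'a)) ^ (p ^ i) = (\<Sum>x\<in>A. f x ^ (p ^ i))"
  using pow_CHAR[of i] freshmans_dream_sum'[OF prime_CHAR] by metis

lemma odd_pow: "odd (p ^ i)" using odd_p by simp

lemma frob_minus: "(- (x::'a)) ^ (p ^ i) = - (x ^ (p ^ i))"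
  using odd_pow by simp

lemma frob_diff: "((x::'a) - y) ^ (p ^ i) = x ^ (p ^ i) - y ^ (p ^ i)"
  using frob_add[of x "-y" i] frob_minus[of y i] by simp

lemma frob_diff1: "((x::'a) - y) ^ p = x ^ p - y ^ p"
  using frob_diff[of x y 1] by simp

lemma p_gt_2: "p > 2"
proof -
  obtain n where "n > 0" "p = CHAR('a) ^ n" using p_power_CHAR by blast
  then have "p \<ge> 2" using prime_CHAR
    by (metis less_or_eq_imp_le one_le_numeral power_increasing_iff prime_ge_2_nat order.trans self_le_power)
  then show ?thesis using odd_p by (cases "p = 2") auto
qed

lemma of_nat_p [simp]: "of_nat p = (0::'a)"
  using p_power_CHAR by auto

lemma pow_gt_1: "k > 0 \<Longrightarrow> p ^ k > 1"
  using p_gt_2 by (intro one_less_power) auto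

lemma two_nz: "(2::'a) \<noteq> 0"
proof
  assume "(2::'a) = 0"
  then have "of_nat 2 = (0::'a)" by simp
  then have "CHAR('a) dvd 2" using of_nat_eq_0_iff_char_dvd by blast
  then have "CHAR('a) = 2" using prime_CHAR primes_dvd_imp_eq two_is_prime_nat by blast
  then show False using p_power_CHAR odd_p by auto
qed

lemma half_sum_diff: "((x::'a) + y) / 2 + (x - y) / 2 = x" "(x + y) / 2 - (x - y) / 2 = y"
proof -
  have "(x + y) + (x - y) = 2 * x" "(x + y) - (x - y) = 2 * y" by simp_all
  then show "(x + y) / 2 + (x - y) / 2 = x" "(x + y) / 2 - (x - y) / 2 = y"
    using two_nz by (simp_all flip: add_divide_distrib diff_divide_distrib)
qed

section \<open>Finite subfields and the trace\<close>

definition fq :: "nat \<Rightarrow> 'a set" where "fq k = {z. z ^ (p ^ k) = z}"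

text \<open>On \<open>fq k\<close> this is the trace to \<open>fq 1\<close>. It makes sense on the
  whole field, and applied to a function of the curve it will express how iterated Frobenius moves
  \<open>y\<close>.\<close>

definition tr :: "nat \<Rightarrow> 'a \<Rightarrow> 'a" where "tr k z = (\<Sum>i<k. z ^ (p ^ i))"

lemma fq_add: "x \<in> fq k \<Longrightarrow> y \<in> fq k \<Longrightarrow> x + y \<in> fq k"
  and fq_diff: "x \<in> fq k \<Longrightarrow> y \<in> fq k \<Longrightarrow> x - y \<in> fq k"
  and fq_minus: "x \<in> fq k \<Longrightarrow> - x \<in> fq k"
  and fq_mult: "x \<in> fq k \<Longrightarrow> y \<in> fq k \<Longrightarrow> x * y \<in> fq k"
  and fq_inverse: "x \<in> fq k \<Longrightarrow> inverse x \<in> fq k"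
  and fq_divide: "x \<in> fq k \<Longrightarrow> y \<in> fq k \<Longrightarrow> x / y \<in> fq k"
  and fq_0: "0 \<in> fq k" and fq_1: "1 \<in> fq k"
  using p_gt_2
  by (auto simp: fq_def frob_add frob_diff frob_minus power_mult_distrib power_inverse power_divide power_0_left)

lemma fq_power: "x \<in> fq k \<Longrightarrow> x ^ n \<in> fq k"
  by (induction n) (auto simp: fq_1 fq_mult)

lemma fq_of_nat: "of_nat n \<in> fq k"
  by (induction n) (auto simp: fq_0 fq_1 fq_add)

lemma fq_numeral: "numeral n \<in> fq k"
  using fq_of_nat[of "numeral n"] by simp

lemmas fq_closed = fq_add fq_diff fq_minus fq_mult fq_power fq_inverse fq_divide fq_0 fq_1 fq_numeral

lemma fq_frob: "x \<in> fq k \<Longrightarrow> x ^ (p ^ k) = x"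
  by (simp add: fq_def)

lemma fq_mono: assumes "k dvd m" shows "fq k \<subseteq> fq m"
proof
  fix x assume x: "x \<in> fq k"
  obtain j where m: "m = k * j" using assms by blast
  have "x ^ (p ^ (k * j)) = x"
  proof (induction j)
    case (Suc j)
    have "x ^ (p ^ (k * Suc j)) = (x ^ (p ^ k)) ^ (p ^ (k * j))"
      by (simp add: power_add power_mult)
    then show ?case using Suc x by (simp add: fq_frob)
  qed simp
  then show "x \<in> fq m" using m by (simp add: fq_def)
qed

lemma fq_1_subset: "fq 1 \<subseteq> fq k" by (rule fq_mono) simp

lemma fq1_frob: "x \<in> fq 1 \<Longrightarrow> x ^ (p ^ i) = x"
  using fq_1_subset[of i] fq_frob by blast

lemma finite_card_fq: assumes "k > 0" shows "card (fq k) = p ^ k" "finite (fq k)"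
proof -
  let ?f = "monom 1 (p ^ k) - monom 1 1 :: 'a poly"
  have q: "p ^ k > 1" using pow_gt_1 assms by simp
  have deg: "degree ?f = p ^ k"
    using degree_add_eq_left[of "- monom 1 1" "monom 1 (p^k) :: 'a poly"] q
    by (simp add: degree_monom_eq)
  have nz: "?f \<noteq> 0" using deg q by (metis degree_0 not_one_less_zero)
  have "pderiv ?f = - 1"
    using assms by (simp add: pderiv_diff pderiv_monom monom_0 one_pCons power_0_left)
  then have "card {x. poly ?f x = 0} = p ^ k"
    using card_roots_separable[of ?f] nz deg by simp
  moreover have "{x. poly ?f x = 0} = fq k"
    by (auto simp: fq_def poly_monom)
  ultimately show "card (fq k) = p ^ k" by simp
  then show "finite (fq k)" using q by (metis card.infinite not_one_less_zero)
qed

lemmas card_fq = finite_card_fq(1) and finite_fq = finite_card_fq(2)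

lemma tr_add: "tr k (x + y) = tr k x + tr k y"
  by (simp add: tr_def frob_add sum.distrib)

lemma tr_diff: "tr k (x - y) = tr k x - tr k y"
  by (simp add: tr_def frob_diff sum_subtractf)

lemma tr_minus: "tr k (- x) = - tr k x"
  by (simp add: tr_def frob_minus sum_negf)

lemma tr_0 [simp]: "tr k 0 = 0"
  using p_gt_2 by (simp add: tr_def power_0_left)

lemma tr_scale: "c \<in> fq 1 \<Longrightarrow> tr k (c * x) = c * tr k x"
  by (simp add: tr_def power_mult_distrib fq1_frob sum_distrib_left)

text \<open>Both sides are the sum of the powers of \<open>x\<close> with exponents
  \<open>p ^ 0\<close> to \<open>p ^ k\<close>. As \<open>x\<close> is arbitrary, the identity also
  applies to functions.\<close>

lemma tr_frob_Suc: "tr k (x ^ p) + x = tr k x + x ^ (p ^ k)"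
proof (induction k)
  case (Suc k)
  have "tr (Suc k) (x ^ p) + x = (tr k (x ^ p) + x) + x ^ (p ^ Suc k)"
    by (simp add: tr_def flip: power_mult)
  then show ?case using Suc by (simp add: tr_def)
qed (simp add: tr_def)

lemma tr_frob: "x \<in> fq k \<Longrightarrow> tr k (x ^ p) = tr k x"
  using tr_frob_Suc[of k x] by (simp add: fq_frob)

lemma tr_power_p: "tr k x ^ p = tr k (x ^ p)"
  using frob_sum[of "\<lambda>i. x ^ (p ^ i)" "{..<k}" 1]
  by (simp add: tr_def mult.commute flip: power_mult)

lemma tr_in_fq1: "x \<in> fq k \<Longrightarrow> tr k x \<in> fq 1"
  using tr_power_p[of k x] tr_frob[of x k] by (simp add: fq_def)

lemma tr_roots:
  assumes "k > 0" shows "finite {x. tr k x = 0}" "card {x. tr k x = 0} \<le> p ^ (k - 1)"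
proof -
  let ?f = "\<Sum>i<k. monom 1 (p ^ i) :: 'a poly"
  have eq: "{x. poly ?f x = 0} = {x. tr k x = 0}" by (simp add: poly_sum poly_monom tr_def)
  have "coeff ?f (p ^ (k - 1)) = (\<Sum>i<k. if i = k - 1 then 1 else 0)"
    unfolding coeff_sum using p_gt_2 by (intro sum.cong) auto
  also have "\<dots> = 1" using assms by simp
  finally have nz: "?f \<noteq> 0" by auto
  have "degree ?f \<le> p ^ (k - 1)"
    using p_gt_2 by (intro degree_sum_le) (auto simp: degree_monom_eq intro!: power_increasing)
  then show "card {x. tr k x = 0} \<le> p ^ (k - 1)" "finite {x. tr k x = 0}"
    using card_poly_roots_bound[OF nz] poly_roots_finite[OF nz] unfolding eq by auto
qed

text \<open>The kernel has at most \<open>p ^ (k - 1)\<close> elements by the degree of the trace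
  polynomial, the image at most \<open>p\<close>. The product of the two sizes is
  \<open>p ^ k\<close>, so both bounds are attained.\<close>

lemma card_tr_kernel:
  assumes "k > 0"
  shows "card {x \<in> fq k. tr k x = 0} = p ^ (k - 1)" and "tr k ` fq k = fq 1"
proof -
  have fin: "finite (fq k)" and fin1: "finite (fq 1)" using finite_fq assms by auto
  have eq: "p ^ k = card (tr k ` fq k) * card {x \<in> fq k. tr k x = 0}"
    using card_additive_image[of "fq k" "tr k"] fin card_fq[OF assms] by (simp add: fq_closed tr_add)
  have "{x \<in> fq k. tr k x = 0} \<subseteq> {x. tr k x = 0}" by blast
  then have le1: "card {x \<in> fq k. tr k x = 0} \<le> p ^ (k - 1)"
    using card_mono[OF tr_roots(1)[OF assms]] tr_roots(2)[OF assms] by (meson order.trans)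
  have sub: "tr k ` fq k \<subseteq> fq 1" using tr_in_fq1 by auto
  then have le2: "card (tr k ` fq k) \<le> p" using card_mono[OF fin1] card_fq[of 1] by simp
  have pk: "p ^ k = p * p ^ (k - 1)" using assms by (cases k) auto
  have pos: "p ^ (k - 1) > 0" "p > 0" using p_gt_2 by auto
  show *: "card {x \<in> fq k. tr k x = 0} = p ^ (k - 1)"
  proof (rule antisym[OF le1], rule ccontr)
    assume "\<not> p ^ (k - 1) \<le> card {x \<in> fq k. tr k x = 0}"
    then have "card (tr k ` fq k) * card {x \<in> fq k. tr k x = 0} < p * p ^ (k - 1)"
      using le2 pos by (meson le_less_trans less_le_not_le mult_le_mono1 mult_less_mono2 not_le_imp_less)
    then show False using eq pk by simp
  qed
  have "card (tr k ` fq k) = p" using eq pk pos * by simp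
  then show "tr k ` fq k = fq 1" using sub fin1 card_fq[of 1] by (intro card_subset_eq) auto
qed

lemma card_tr_fibre:
  assumes "k > 0" "n \<in> fq k" "n \<noteq> 0" "c \<in> fq 1"
  shows "card {x \<in> fq k. tr k (n * x) = c} = p ^ (k - 1)"
proof -
  have "card {x \<in> fq k. tr k (n * x) = c} = card {x \<in> fq k. tr k x = c}"
    by (rule bij_betw_same_card[of "\<lambda>x. n * x"], rule bij_betwI[where g = "\<lambda>x. x / n"])
       (use assms in \<open>auto simp: fq_closed\<close>)
  also have "\<dots> = card {x \<in> fq k. tr k x = 0}"
    using card_tr_kernel(2)[OF assms(1)] assms
    by (intro card_fibre_additive) (auto simp: fq_closed tr_add)
  finally show ?thesis using card_tr_kernel(1)[OF assms(1)] by simp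
qed

text \<open>Additive Hilbert 90 by counting: the image is contained in the kernel of the trace, and
  both have \<open>p ^ (k - 1)\<close> elements.\<close>

lemma artin_schreier_image:
  assumes "k > 0"
  shows "(\<lambda>y. y ^ p - y) ` fq k = {x \<in> fq k. tr k x = 0}"
    and "card {y \<in> fq k. y ^ p - y = 0} = p"
proof -
  have "{y \<in> fq k. y ^ p - y = 0} = fq 1" using fq_1_subset by (auto simp: fq_def)
  then show *: "card {y \<in> fq k. y ^ p - y = 0} = p" using card_fq[of 1] by simp
  have "p ^ k = card ((\<lambda>y. y ^ p - y) ` fq k) * p"
    using card_additive_image[of "fq k" "\<lambda>y. y ^ p - y"] finite_fq[OF assms] card_fq[OF assms] *
    by (simp add: fq_closed frob_add1)
  moreover have "p ^ k = p ^ (k - 1) * p" using assms by (cases k) auto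
  ultimately have "card ((\<lambda>y. y ^ p - y) ` fq k) = p ^ (k - 1)" using p_gt_2 by simp
  then show "(\<lambda>y. y ^ p - y) ` fq k = {x \<in> fq k. tr k x = 0}"
    using card_tr_kernel(1)[OF assms] finite_fq[OF assms]
    by (intro card_subset_eq) (auto simp: fq_closed tr_diff tr_frob)
qed

lemma card_artin_schreier:
  assumes "k > 0" "\<And>x. x \<in> fq k \<Longrightarrow> f x \<in> fq k"
  shows "card {(x, y). x \<in> fq k \<and> y \<in> fq k \<and> y ^ p - y = f x} = p * card {x \<in> fq k. tr k (f x) = 0}"
proof -
  note fin = finite_fq[OF assms(1)]
  have "{(x, y). x \<in> fq k \<and> y \<in> fq k \<and> y ^ p - y = f x} = (SIGMA x : fq k. {y \<in> fq k. y ^ p - y = f x})"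
    by auto
  then have "card {(x, y). x \<in> fq k \<and> y \<in> fq k \<and> y ^ p - y = f x}
      = (\<Sum>x\<in>fq k. card {y \<in> fq k. y ^ p - y = f x})"
    using fin by (simp add: card_SigmaI)
  also have "\<dots> = (\<Sum>x\<in>fq k. if tr k (f x) = 0 then p else 0)"
  proof (intro sum.cong refl)
    fix x assume x: "x \<in> fq k"
    show "card {y \<in> fq k. y ^ p - y = f x} = (if tr k (f x) = 0 then p else 0)"
    proof (cases "tr k (f x) = 0")
      case True
      then have "f x \<in> (\<lambda>y. y ^ p - y) ` fq k" using artin_schreier_image[OF assms(1)] assms(2)[OF x] by simp
      then have "card {y \<in> fq k. y ^ p - y = f x} = card {y \<in> fq k. y ^ p - y = 0}"
        by (intro card_fibre_additive) (auto simp: fq_closed frob_add1)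
      then show ?thesis using True artin_schreier_image(2)[OF assms(1)] by simp
    next
      case False
      then have "f x \<notin> (\<lambda>y. y ^ p - y) ` fq k" using artin_schreier_image[OF assms(1)] by simp
      then have "y ^ p - y \<noteq> f x" if "y \<in> fq k" for y
        using imageI[OF that, of "\<lambda>y. y ^ p - y"] by metis
      then have "{y \<in> fq k. y ^ p - y = f x} = {}" by blast
      then show ?thesis using False by (metis card.empty)
    qed
  qed
  also have "\<dots> = p * card {x \<in> fq k. tr k (f x) = 0}"
    using fin by (simp add: sum.If_cases Int_def)
  finally show ?thesis .
qed

section \<open>The diagonal form and its isotropic hyperplanes\<close>

lemma tr_square_add_scale:
  assumes "c \<in> fq 1"
  shows "tr k ((s + c * n) ^ 2) = tr k (s ^ 2) + 2 * c * tr k (n * s) + c ^ 2 * tr k (n ^ 2)"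
proof -
  have "tr k ((s + c * n) ^ 2) = tr k (s ^ 2 + (2 * c) * (n * s) + c ^ 2 * n ^ 2)"
    by (simp add: algebra_simps power2_eq_square)
  then show ?thesis using assms by (simp only: tr_add) (simp add: tr_scale fq_closed del: mult.assoc)
qed

text \<open>Moving \<open>s\<close> to \<open>s + c * n\<close> keeps \<open>tr k (n * s)\<close>
  and adds \<open>2 * c * tr k (n * s)\<close> to \<open>tr k (s ^ 2)\<close>, because
  \<open>n\<close> is isotropic. Off the hyperplane orthogonal to \<open>n\<close>, each line in
  direction \<open>n\<close> over \<open>fq 1\<close> therefore contains exactly one zero of the
  form, so the zeros there are one \<open>p\<close>-th of all elements.\<close>

lemma card_translation:
  assumes k: "k > 0" and n: "n \<in> fq k" "n \<noteq> 0" and iso: "tr k (n ^ 2) = 0"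
  shows "p * card {s \<in> fq k. tr k (n * s) = 0 \<and> tr k (s ^ 2) = 0} + (p ^ k - p ^ (k - 1))
    = p * card {s \<in> fq k. tr k (s ^ 2) = 0}"
proof -
  let ?M = "{s \<in> fq k. tr k (n * s) = 0 \<and> tr k (s ^ 2) = 0}"
  let ?Z = "{s \<in> fq k. tr k (n * s) \<noteq> 0}"
  let ?W = "{s \<in> fq k. tr k (n * s) \<noteq> 0 \<and> tr k (s ^ 2) = 0}"
  note fin = finite_fq[OF k]
  have fqn: "c * n \<in> fq k" if "c \<in> fq 1" for c
    using that n fq_1_subset[of k] by (auto intro: fq_closed)
  have trn: "tr k (n * (s + c * n)) = tr k (n * s)" if "c \<in> fq 1" for c s
  proof -
    have "tr k (n * (s + c * n)) = tr k (n * s) + tr k (c * n ^ 2)"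
      by (simp add: algebra_simps power2_eq_square flip: tr_add)
    then show ?thesis using that iso by (simp add: tr_scale)
  qed
  have trs: "tr k ((s + c * n) ^ 2) = tr k (s ^ 2) + 2 * c * tr k (n * s)" if "c \<in> fq 1" for c s
    using tr_square_add_scale[OF that, of k s n] iso by simp
  \<comment> \<open>The unique scalar for which \<open>t - C t * n\<close> is a zero of the form,
    for \<open>t\<close> off the hyperplane.\<close>
  define C where "C t = tr k (t ^ 2) / (2 * tr k (n * t))" for t
  have C: "C t \<in> fq 1" if "t \<in> fq k" for t
    unfolding C_def using that n by (intro fq_closed tr_in_fq1)
  have "bij_betw (\<lambda>(s, c). s + c * n) (?W \<times> fq 1) ?Z"
  proof (rule bij_betwI[where g = "\<lambda>t. (t + (- C t) * n, C t)"])
    show "(\<lambda>(s, c). s + c * n) \<in> ?W \<times> fq 1 \<rightarrow> ?Z"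
    proof
      fix x assume "x \<in> ?W \<times> fq 1"
      then obtain s c where "x = (s, c)" "s \<in> ?W" "c \<in> fq 1" by auto
      then show "(case x of (s, c) \<Rightarrow> s + c * n) \<in> ?Z"
        using fqn[of c] trn[of c s] by (simp add: fq_add)
    qed
    show "(\<lambda>t. (t + (- C t) * n, C t)) \<in> ?Z \<rightarrow> ?W \<times> fq 1"
    proof
      fix t assume t: "t \<in> ?Z"
      have c: "- C t \<in> fq 1" using C t by (auto intro: fq_closed)
      have "tr k (n * (t + (- C t) * n)) \<noteq> 0" using trn[OF c, of t] t by simp
      moreover have "tr k ((t + (- C t) * n) ^ 2) = 0"
        using t two_nz by (simp only: trs[OF c]) (simp add: C_def)
      ultimately show "(t + (- C t) * n, C t) \<in> ?W \<times> fq 1"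
        using fq_add[OF _ fqn[OF c], of t] C t by simp
    qed
    show "(\<lambda>t. (t + (- C t) * n, C t)) ((\<lambda>(s, c). s + c * n) x) = x" if x: "x \<in> ?W \<times> fq 1" for x
    proof -
      obtain s c where sc: "x = (s, c)" "s \<in> ?W" "c \<in> fq 1" using x by auto
      have "C (s + c * n) = c"
        unfolding C_def trn[OF sc(3)] trs[OF sc(3)] using sc two_nz by simp
      then show ?thesis using sc by simp
    qed
  qed auto
  then have "card (?W \<times> fq 1) = card ?Z" by (rule bij_betw_same_card)
  then have Z0: "card ?Z = p * card ?W"
    using card_fq[of 1] by (simp add: card_cartesian_product mult.commute)
  have "card (fq k) = card ({s \<in> fq k. tr k (n * s) = 0} \<union> ?Z)" by (rule arg_cong[where f = card]) auto
  also have "\<dots> = card {s \<in> fq k. tr k (n * s) = 0} + card ?Z"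
    using fin by (intro card_Un_disjoint) auto
  finally have "card ?Z = p ^ k - p ^ (k - 1)"
    using card_tr_fibre[OF k n fq_0] card_fq[OF k] by simp
  moreover have "card {s \<in> fq k. tr k (s ^ 2) = 0} = card (?M \<union> ?W)" by (rule arg_cong[where f = card]) auto
  moreover have "card (?M \<union> ?W) = card ?M + card ?W"
    using fin by (intro card_Un_disjoint) auto
  ultimately show ?thesis using Z0 by (simp add: algebra_simps)
qed

text \<open>The map \<open>y ^ p - y\<close> sends \<open>fq k\<close> onto the hyperplane of trace
  zero, with all fibres of size \<open>p\<close>.\<close>

lemma card_artin_schreier_pullback:
  assumes k: "k > 0"
  shows "card {y \<in> fq k. P (y ^ p - y)} = p * card {v \<in> fq k. tr k v = 0 \<and> P v}"
proof -
  let ?g = "\<lambda>y::'a. y ^ p - y"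
  let ?A = "{y \<in> fq k. P (?g y)}"
  let ?B = "{v \<in> fq k. tr k v = 0 \<and> P v}"
  have fin: "finite ?A" using finite_fq[OF k] by simp
  have im: "?g ` ?A = ?B"
  proof -
    have "?g ` ?A = {v \<in> ?g ` fq k. P v}" by auto
    also have "\<dots> = ?B" unfolding artin_schreier_image[OF k] by auto
    finally show ?thesis .
  qed
  have "card {y \<in> ?A. ?g y = v} = p" if v: "v \<in> ?B" for v
  proof -
    have "{y \<in> ?A. ?g y = v} = {y \<in> fq k. ?g y = v}" using v by auto
    moreover have "v \<in> ?g ` fq k" using v unfolding artin_schreier_image[OF k] by auto
    then have "card {y \<in> fq k. ?g y = v} = card {y \<in> fq k. ?g y = 0}"
      by (intro card_fibre_additive) (auto simp: fq_closed frob_add1)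
    ultimately show ?thesis using artin_schreier_image(2)[OF k] by (metis (no_types, lifting))
  qed
  then have "(\<Sum>v\<in>?g ` ?A. card {y \<in> ?A. ?g y = v}) = card ?B * p" unfolding im by simp
  then show ?thesis using sum.image_gen[OF fin, of "\<lambda>_. 1 :: nat" ?g] by simp
qed

lemma tr_mult_fq: "x \<in> fq a \<Longrightarrow> tr (a * j) x = of_nat j * tr a x"
proof (induction j)
  case (Suc j)
  have "x \<in> fq (a * j)" using fq_mono[of a "a * j"] Suc.prems by auto
  then have "(\<Sum>i<a. x ^ (p ^ (a * j + i))) = (\<Sum>i<a. x ^ (p ^ i))"
    by (intro sum.cong refl) (simp only: power_add power_mult[of x "p ^ (a * j)"] fq_frob)
  moreover have "tr (a * j + a) x = tr (a * j) x + (\<Sum>i<a. x ^ (p ^ (a * j + i)))"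
  proof -
    have "tr (b + c) x = tr b x + (\<Sum>i<c. x ^ (p ^ (b + i)))" for b c
      unfolding tr_def by (induction c) (simp_all add: add.assoc)
    then show ?thesis .
  qed
  ultimately show ?case using Suc by (simp add: algebra_simps) (simp add: tr_def)
qed (simp add: tr_def)

lemma tr_double: "tr (h + h) x = tr h (x + x ^ (p ^ h))"
proof -
  have "tr (h + j) x = tr h x + tr j (x ^ (p ^ h))" for j
    by (induction j) (simp_all add: tr_def add.assoc power_add power_mult)
  then show ?thesis by (simp add: tr_add)
qed

section \<open>The quadratic form of the curve and its twist by \<open>w\<close>\<close>

definition qform :: "'a \<Rightarrow> 'a" where "qform x = 2 * x ^ (p + 1) + x ^ 2"

lemma fq_qform: "x \<in> fq k \<Longrightarrow> qform x \<in> fq k"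
  unfolding qform_def by (intro fq_closed)

text \<open>Applying Frobenius once more to the equation and subtracting is the identity
  \<open>(X - 1) (X^2 + X + 1) = X^3 - 1\<close> with Frobenius for \<open>X\<close>.\<close>

lemma root_in_fq3: assumes "w ^ (p ^ 2) + w ^ p + w = (0::'a)" shows "w ^ (p ^ 3) = w"
proof -
  have 1: "w ^ (p ^ 2) = - (w ^ p) - w" using assms by (simp add: algebra_simps eq_neg_iff_add_eq_0)
  have "w ^ (p ^ 3) = (w ^ (p ^ 2)) ^ p" by (simp add: power_mult[symmetric] power3_eq_cube power2_eq_square)
  also have "\<dots> = (- (w ^ p) - w) ^ p" unfolding 1 ..
  also have "\<dots> = - (w ^ (p ^ 2)) - w ^ p"
    by (simp add: frob_diff1 odd_p power2_eq_square flip: power_mult)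
  also have "\<dots> = w" unfolding 1 by simp
  finally show ?thesis .
qed

text \<open>Expand the square on the right. Under the trace, the term
  \<open>w ^ (p + 1) * z ^ 2\<close> may be replaced by its \<open>p\<close>-th power, and joined
  with \<open>w ^ (p + 1) * (z ^ p) ^ 2\<close> it gives
  \<open>w ^ p * (w ^ (p * p) + w) * (z ^ p) ^ 2\<close>. The equation of \<open>w\<close> turns
  this into \<open>- ((w * z) ^ 2) ^ p\<close>.\<close>

lemma tr_qform_twist:
  assumes w: "w ^ (p ^ 2) + w ^ p + w = 0" "w \<in> fq k" and z: "z \<in> fq k"
  shows "tr k (qform (w * z)) = - tr k (w ^ (p + 1) * (z ^ p - z) ^ 2)"
proof -
  have w2: "w ^ (p * p) = - (w ^ p) - w" using w by (simp add: power2_eq_square algebra_simps eq_neg_iff_add_eq_0)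
  have e: "(w ^ (p + 1) * z ^ 2) ^ p = w ^ (p * p) * w ^ p * (z ^ p) ^ 2"
    by (simp add: power_mult_distrib power_add mult.commute flip: power_mult)
  have e2: "(w ^ 2 * z ^ 2) ^ p = (w ^ p) ^ 2 * (z ^ p) ^ 2"
    by (simp add: power_mult_distrib mult.commute flip: power_mult)
  have t1: "tr k (w ^ (p + 1) * z ^ 2) = tr k (w ^ (p * p) * w ^ p * (z ^ p) ^ 2)"
    using tr_frob[of "w ^ (p + 1) * z ^ 2" k] w z unfolding e by (simp add: fq_closed)
  have t2: "tr k (w ^ 2 * z ^ 2) = tr k ((w ^ p) ^ 2 * (z ^ p) ^ 2)"
    using tr_frob[of "w ^ 2 * z ^ 2" k] w z unfolding e2 by (simp add: fq_closed)
  have "tr k (w ^ (p + 1) * (z ^ p - z) ^ 2)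
      = tr k (w ^ (p + 1) * (z ^ p) ^ 2 - 2 * (w * z) ^ (p + 1) + w ^ (p + 1) * z ^ 2)"
    by (rule arg_cong[where f = "tr k"]) (simp add: algebra_simps power2_eq_square power_mult_distrib)
  also have "\<dots> = tr k (w ^ (p + 1) * (z ^ p) ^ 2) - tr k (2 * (w * z) ^ (p + 1))
       + tr k (w ^ (p * p) * w ^ p * (z ^ p) ^ 2)"
    by (simp only: tr_add tr_diff t1)
  also have "\<dots> = tr k (w ^ (p + 1) * (z ^ p) ^ 2 + w ^ (p * p) * w ^ p * (z ^ p) ^ 2) - tr k (2 * (w * z) ^ (p + 1))"
    by (simp only: tr_add) (simp add: algebra_simps)
  also have "w ^ (p + 1) * (z ^ p) ^ 2 + w ^ (p * p) * w ^ p * (z ^ p) ^ 2 = - ((w ^ p) ^ 2 * (z ^ p) ^ 2)"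
    unfolding w2 by (simp add: algebra_simps power2_eq_square)
  also have "tr k (- ((w ^ p) ^ 2 * (z ^ p) ^ 2)) = - tr k ((w * z) ^ 2)"
    by (simp only: tr_minus flip: t2) (simp add: power_mult_distrib)
  finally show ?thesis unfolding qform_def by (simp add: tr_add)
qed

lemma card_qform_reduction:
  assumes k: "k > 0" "3 dvd k" and w: "w ^ (p ^ 2) + w ^ p + w = (0::'a)" "w \<noteq> 0"
  shows "card {x \<in> fq k. tr k (qform x) = 0} + (p ^ k - p ^ (k - 1)) = p * card {s \<in> fq k. tr k (s ^ 2) = 0}"
proof -
  have w3: "w \<in> fq 3" using root_in_fq3[OF w(1)] by (simp add: fq_def)
  then have wk: "w \<in> fq k" using fq_mono[OF k(2)] by auto
  \<comment> \<open>As \<open>p + 1\<close> is even, \<open>m\<close> is a square root of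
    \<open>w ^ (p + 1)\<close> inside \<open>fq k\<close>. With \<open>s = m * v\<close> the form
    becomes \<open>tr k (s ^ 2)\<close> and the hyperplane \<open>tr k v = 0\<close> becomes
    \<open>tr k (n * s) = 0\<close>.\<close>
  define m where "m = w ^ ((p + 1) div 2)"
  define n where "n = inverse m"
  have "(p + 1) div 2 * 2 = p + 1" using odd_p by presburger
  then have m2: "m ^ 2 = w ^ (p + 1)" unfolding m_def by (simp only: flip: power_mult)
  have m: "m \<noteq> 0" "m \<in> fq k" "m \<in> fq 3" using w wk w3 by (auto simp: m_def intro: fq_closed)
  have n: "n \<noteq> 0" "n \<in> fq k" "n \<in> fq 3" using m by (auto simp: n_def intro: fq_closed)
  \<comment> \<open>The Frobenius conjugates of \<open>n ^ 2\<close> are the inverses of the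
    products of two among \<open>w\<close>, \<open>w ^ p\<close>, \<open>w ^ (p * p)\<close>. Their
    sum has numerator \<open>w + w ^ p + w ^ (p * p)\<close>, which is 0; the trace from
    \<open>fq k\<close> is a multiple of this sum.\<close>
  have iso: "tr k (n ^ 2) = 0"
  proof -
    let ?a = "w ^ p" and ?b = "w ^ (p * p)"
    have a: "?a \<noteq> 0" "?b \<noteq> 0" using w by auto
    have e0: "n ^ 2 = 1 / (w * ?a)" unfolding n_def power_inverse m2 by (simp add: field_simps)
    have e1: "(n ^ 2) ^ p = 1 / (?a * ?b)"
      unfolding e0 by (simp add: power_divide power_mult_distrib flip: power_mult)
    have e2: "(n ^ 2) ^ (p * p) = 1 / (?b * w)"
      using root_in_fq3[OF w(1)] unfolding power_mult[of "n^2"] e1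
      by (simp add: power_divide power_mult_distrib power3_eq_cube mult.assoc flip: power_mult)
    have "tr 3 (n ^ 2) = n ^ 2 + (n ^ 2) ^ p + (n ^ 2) ^ (p * p)"
      by (simp add: tr_def numeral_3_eq_3 power2_eq_square)
    also have "\<dots> = (?b + w + ?a) / (w * ?a * ?b)"
    proof -
      have "1 / (w * x) + 1 / (x * y) + 1 / (y * w) = (y + w + x) / (w * x * y)"
        if "x \<noteq> 0" "y \<noteq> 0" for x y using that w by (simp add: field_simps)
      then show ?thesis unfolding e1 e2 unfolding e0 using a .
    qed
    also have "?b + w + ?a = 0" using w(1) by (simp add: power2_eq_square algebra_simps)
    finally have "tr 3 (n ^ 2) = 0" by simp
    moreover obtain j where "k = 3 * j" using k by blast
    ultimately show ?thesis using tr_mult_fq[of "n ^ 2" 3 j] n by (simp add: fq_closed)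
  qed
  have "card {x \<in> fq k. tr k (qform x) = 0} = card {z \<in> fq k. tr k (w ^ (p + 1) * (z ^ p - z) ^ 2) = 0}"
    by (rule bij_betw_same_card[of "\<lambda>x. x / w"], rule bij_betwI[where g = "\<lambda>z. w * z"])
       (use w wk tr_qform_twist[OF w(1) wk] in \<open>auto simp: fq_closed\<close>, use wk w tr_qform_twist[OF w(1) wk, of "x / w" for x] in \<open>auto simp: fq_closed\<close>)
  also have "\<dots> = p * card {v \<in> fq k. tr k v = 0 \<and> tr k (w ^ (p + 1) * v ^ 2) = 0}"
    by (rule card_artin_schreier_pullback[OF k(1)])
  also have "card {v \<in> fq k. tr k v = 0 \<and> tr k (w ^ (p + 1) * v ^ 2) = 0}
     = card {s \<in> fq k. tr k (n * s) = 0 \<and> tr k (s ^ 2) = 0}"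
  proof -
    have e: "w ^ (p + 1) * v ^ 2 = (m * v) ^ 2" and nm: "n * (m * v) = v" "m * (n * v) = v" for v
      using m by (simp_all add: power_mult_distrib m2 n_def)
    show ?thesis unfolding e
      by (rule bij_betw_same_card[of "\<lambda>v. m * v"], rule bij_betwI[where g = "\<lambda>s. n * s"])
         (use m n in \<open>auto simp: fq_mult nm\<close>)
  qed
  finally show ?thesis using card_translation[OF k(1) n(2,1) iso] by simp
qed

section \<open>Zeros of the diagonal form over an extension of even degree\<close>

lemma power_of_sqrt_minus_one:
  assumes i: "i ^ 2 = (-1 :: 'a)"
  shows "N mod 4 = 1 \<Longrightarrow> i ^ N = i" "N mod 4 = 3 \<Longrightarrow> i ^ N = - i"
proof -
  have i4: "i ^ 4 = 1"
  proof -
    have "i ^ 4 = (i ^ 2) ^ 2" by (simp flip: power_mult)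
    then show ?thesis using i by simp
  qed
  have "i ^ N = (i ^ 4) ^ (N div 4) * i ^ (N mod 4)" by (simp flip: power_mult power_add)
  then have "i ^ N = i ^ (N mod 4)" using i4 by simp
  then show "N mod 4 = 1 \<Longrightarrow> i ^ N = i" "N mod 4 = 3 \<Longrightarrow> i ^ N = - i"
    using i by (auto simp: numeral_3_eq_3 power2_eq_square)
qed

lemma fq_double_conj: "s \<in> fq (h + h) \<Longrightarrow> (s ^ (p ^ h)) ^ (p ^ h) = s"
  by (simp add: fq_def power_add flip: power_mult)

lemma fq_double_iff: "x \<in> fq h \<Longrightarrow> x \<in> fq (h + h)"
  using fq_mono[of h "h + h"] by auto

text \<open>Here -1 is not a square in \<open>fq h\<close>, and conjugation sends \<open>i\<close>
  to \<open>-i\<close>. For \<open>s = a + i * b\<close> with \<open>a\<close>, \<open>b\<close> in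
  \<open>fq h\<close>, the sum of \<open>s ^ 2\<close> and its conjugate is
  \<open>2 * (a ^ 2 - b ^ 2)\<close>, a hyperbolic plane. The coordinates \<open>a = c + d\<close>,
  \<open>b = c - d\<close> make it \<open>8 * c * d\<close>, and for each \<open>c\<close> the
  condition on \<open>d\<close> is linear over \<open>fq 1\<close>, empty only for
  \<open>c = 0\<close>.\<close>

lemma card_tr_square_3:
  assumes h: "h > 0" and mod: "p ^ h mod 4 = 3"
  shows "card {s \<in> fq (h + h). tr (h + h) (s ^ 2) = 0} = p ^ h + (p ^ h - 1) * p ^ (h - 1)"
proof -
  let ?K = "fq h" let ?F = "fq (h + h)"
  obtain i :: 'a where i: "i ^ 2 = -1" using nth_root_exists[of 2 "-1"] by auto
  have i0: "i \<noteq> 0" using i by auto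
  have ih: "i ^ (p ^ h) = - i" by (rule power_of_sqrt_minus_one(2)[OF i mod])
  have ihh: "i \<in> ?F" unfolding fq_def using ih odd_pow[of h] by (simp add: power_add power_mult)
  have ii: "i * i = -1" using i by (simp add: power2_eq_square)
  have ii': "i * (i * x) = - x" for x using ii by (simp flip: mult.assoc)
  define g where "g c d = (c + d) + i * (c - d)" for c d
  define c where "c s = ((s + s ^ (p ^ h)) / 2 + (s - s ^ (p ^ h)) / (2 * i)) / 2" for s
  define d where "d s = ((s + s ^ (p ^ h)) / 2 - (s - s ^ (p ^ h)) / (2 * i)) / 2" for s
  have two: "2 ^ (p ^ h) = (2::'a)" using fq_numeral fq_frob by blast
  have cc: "((s - s ^ (p ^ h)) / (2 * i)) ^ (p ^ h) = (s - s ^ (p ^ h)) / (2 * i)"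
    and cc2: "((s + s ^ (p ^ h)) / 2) ^ (p ^ h) = (s + s ^ (p ^ h)) / 2" if "s \<in> ?F" for s
    using fq_double_conj[OF that]
    by (simp_all add: power_divide power_mult_distrib frob_diff frob_add ih two minus_divide_left[symmetric] add.commute)
       (simp add: diff_divide_distrib)
  have halves: "(s - s ^ (p ^ h)) / (2 * i) \<in> ?K" "(s + s ^ (p ^ h)) / 2 \<in> ?K" if "s \<in> ?F" for s
    unfolding fq_def mem_Collect_eq using cc[OF that] cc2[OF that] by blast+
  have cd: "c s \<in> ?K" "d s \<in> ?K" if "s \<in> ?F" for s
    unfolding c_def d_def using fq_add[OF halves(2,1)] fq_diff[OF halves(2,1)] fq_divide fq_numeral that by blast+
  have gF: "g c d \<in> ?F" if "c \<in> ?K" "d \<in> ?K" for c d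
    unfolding g_def using that by (intro fq_add fq_mult ihh fq_diff fq_double_iff)
  have conj: "(g c d) ^ (p ^ h) = (c + d) - i * (c - d)" if "c \<in> ?K" "d \<in> ?K" for c d
    using that by (simp add: g_def frob_add frob_diff power_mult_distrib ih fq_frob)
  have gs: "g (c s) (d s) = s" for s
  proof -
    have "(s + t) / 2 + i * ((s - t) / (2 * i)) = s" for t
      using i0 half_sum_diff(1)[of s t] by simp
    then show ?thesis unfolding g_def c_def d_def half_sum_diff .
  qed
  have A: "(g c d + (g c d) ^ (p ^ h)) / 2 = c + d" "(g c d - (g c d) ^ (p ^ h)) / (2 * i) = c - d" if "c \<in> ?K" "d \<in> ?K" for c d
  proof -
    have "g c d + (g c d) ^ (p ^ h) = 2 * (c + d)" "g c d - (g c d) ^ (p ^ h) = 2 * i * (c - d)"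
      unfolding conj[OF that] unfolding g_def by (simp_all add: algebra_simps)
    then show "(g c d + (g c d) ^ (p ^ h)) / 2 = c + d" "(g c d - (g c d) ^ (p ^ h)) / (2 * i) = c - d"
      using two_nz i0 by simp_all
  qed
  have sg: "c (g x y) = x" "d (g x y) = y" if "x \<in> ?K" "y \<in> ?K" for x y
    unfolding c_def d_def A[OF that] using two_nz by simp_all
  have bij: "bij_betw (\<lambda>(c, d). g c d) (?K \<times> ?K) ?F"
    by (rule bij_betwI[where g = "\<lambda>s. (c s, d s)"]) (auto simp: gs sg gF cd)
  have T: "tr (h + h) ((g c d) ^ 2) = tr h ((8 * c) * d)" if "c \<in> ?K" "d \<in> ?K" for c d
  proof -
    have "(g c d) ^ 2 + ((g c d) ^ 2) ^ (p ^ h) = (g c d) ^ 2 + ((g c d) ^ (p ^ h)) ^ 2"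
      by (simp add: mult.commute flip: power_mult)
    also have "\<dots> = (8 * c) * d"
      unfolding conj[OF that] unfolding g_def
      by (simp add: power2_eq_square algebra_simps ii')
    finally show ?thesis by (simp add: tr_double)
  qed
  have "card {s \<in> ?F. tr (h + h) (s ^ 2) = 0} = card {cd \<in> ?K \<times> ?K. tr h ((8 * fst cd) * snd cd) = 0}"
  proof (rule sym, rule bij_betw_same_card[of "\<lambda>(c, d). g c d"], rule bij_betw_imageI)
    show "inj_on (\<lambda>(c, d). g c d) {cd \<in> ?K \<times> ?K. tr h ((8 * fst cd) * snd cd) = 0}"
      using bij by (auto simp: bij_betw_def intro: inj_on_subset)
    have "?F = (\<lambda>(c, d). g c d) ` (?K \<times> ?K)" using bij by (simp add: bij_betw_def)
    then show "(\<lambda>(c, d). g c d) ` {cd \<in> ?K \<times> ?K. tr h ((8 * fst cd) * snd cd) = 0} = {s \<in> ?F. tr (h + h) (s ^ 2) = 0}"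
      by (auto simp: T)
  qed
  also have "{cd \<in> ?K \<times> ?K. tr h ((8 * fst cd) * snd cd) = 0} = (SIGMA c : ?K. {d \<in> ?K. tr h ((8 * c) * d) = 0})"
    by auto
  also have "card \<dots> = (\<Sum>c\<in>?K. card {d \<in> ?K. tr h ((8 * c) * d) = 0})"
    using finite_fq[OF h] by simp
  also have "\<dots> = (\<Sum>c\<in>?K. if c = 0 then p ^ h else p ^ (h - 1))"
  proof (intro sum.cong refl)
    fix c assume c: "c \<in> ?K"
    show "card {d \<in> ?K. tr h ((8 * c) * d) = 0} = (if c = 0 then p ^ h else p ^ (h - 1))"
    proof (cases "c = 0")
      case False
      have "8 = (2::'a) ^ 3" by simp
      then have "(8::'a) \<noteq> 0" using two_nz by (metis power_not_zero)
      then show ?thesis using False card_tr_fibre[OF h, of "8 * c" 0] c by (simp add: fq_closed)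
    qed (use card_fq[OF h] in simp)
  qed
  also have "\<dots> = p ^ h + (\<Sum>c\<in>?K - {0}. if c = 0 then p ^ h else p ^ (h - 1))"
    using finite_fq[OF h] fq_0 by (subst sum.remove[of _ 0]) auto
  also have "(\<Sum>c\<in>?K - {0}. if c = 0 then p ^ h else p ^ (h - 1)) = (p ^ h - 1) * p ^ (h - 1)"
    using finite_fq[OF h] fq_0 card_fq[OF h] by simp
  finally show ?thesis .
qed

text \<open>In the field, \<open>p ^ h + 1\<close> equals 1, so the polynomial of the fibre is
  separable and has \<open>p ^ h + 1\<close> roots in the closure. Since \<open>c\<close> is fixed
  by the \<open>p ^ h\<close>-th power map, every root lies in \<open>fq (h + h)\<close>.\<close>

lemma card_norm_fibre:
  assumes h: "h > 0" and c: "c \<in> fq h" "c \<noteq> 0"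
  shows "card {g \<in> fq (h + h). g ^ (p ^ h + 1) = c} = p ^ h + 1"
proof -
  let ?N = "p ^ h + 1"
  let ?f = "monom 1 ?N - [:c:] :: 'a poly"
  have dc: "degree ?f = ?N"
    using degree_add_eq_left[of "- [:c:]" "monom 1 ?N"]
    by (simp add: degree_monom_eq del: minus_pCons)
  have pd: "pderiv ?f = monom (of_nat ?N) (p ^ h)" by (simp add: pderiv_diff pderiv_monom pderiv_pCons)
  have N1: "of_nat ?N = (1::'a)" using h by (simp add: power_0_left)
  have "card {x. poly ?f x = 0} = degree ?f"
  proof (rule card_roots_separable)
    show "?f \<noteq> 0" using dc by (metis Suc_eq_plus1 degree_0 nat.distinct(1))
    fix a assume "poly ?f a = 0"
    then have "a \<noteq> 0" using c by (auto simp: poly_monom)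
    then show "poly (pderiv ?f) a \<noteq> 0" unfolding pd N1 by (simp add: poly_monom)
  qed
  moreover have "{x. poly ?f x = 0} = {g \<in> fq (h + h). g ^ ?N = c}"
  proof -
    have "g \<in> fq (h + h)" if "g ^ ?N = c" for g
    proof -
      have g0: "g \<noteq> 0" using that c by auto
      have "(g ^ (p ^ h)) ^ (p ^ h) * g ^ (p ^ h) = g ^ (p ^ h) * g"
        using fq_frob[OF c(1)] unfolding that[symmetric] by (simp add: power_add power_mult_distrib mult.commute flip: power_mult)
      then have "(g ^ (p ^ h)) ^ (p ^ h) = g" using g0 by simp
      then show ?thesis by (simp add: fq_def power_add flip: power_mult)
    qed
    then show ?thesis by (auto simp: poly_monom)
  qed
  ultimately show ?thesis using dc by simp
qed

text \<open>Now \<open>i\<close> is in \<open>fq h\<close>. Writing \<open>s'\<close> for the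
  conjugate of \<open>s\<close> and \<open>g = s + i * s'\<close>, one has
  \<open>s ^ 2 + s' ^ 2 = (s + i * s') * (s - i * s')\<close>, which is \<open>- i\<close> times the
  norm of \<open>g\<close>. So the form is anisotropic over \<open>fq h\<close>: besides 0, every
  nonzero \<open>c\<close> with \<open>tr h (- i * c) = 0\<close> contributes a full norm
  fibre.\<close>

lemma card_tr_square_1:
  assumes h: "h > 0" and mod: "p ^ h mod 4 = 1"
  shows "card {s \<in> fq (h + h). tr (h + h) (s ^ 2) = 0} = 1 + (p ^ h + 1) * (p ^ (h - 1) - 1)"
proof -
  let ?K = "fq h" let ?F = "fq (h + h)"
  obtain i :: 'a where i: "i ^ 2 = -1" using nth_root_exists[of 2 "-1"] by auto
  have i0: "i \<noteq> 0" using i by auto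
  have ih: "i ^ (p ^ h) = i" by (rule power_of_sqrt_minus_one(1)[OF i mod])
  then have iK: "i \<in> ?K" by (simp add: fq_def)
  then have iF: "i \<in> ?F" by (rule fq_double_iff)
  have ii: "i * i = -1" using i by (simp add: power2_eq_square)
  have ii': "i * (i * x) = - x" for x using ii by (simp flip: mult.assoc)
  define g where "g s = s + i * s ^ (p ^ h)" for s
  define g' where "g' t = (t - i * t ^ (p ^ h)) / 2" for t
  have gF: "g s \<in> ?F" "g' s \<in> ?F" if "s \<in> ?F" for s
    unfolding g_def g'_def using that iF by (auto intro!: fq_closed)
  have two: "2 ^ (p ^ h) = (2::'a)" using fq_numeral fq_frob by blast
  have gg: "g (g' s) = s" "g' (g s) = s" if "s \<in> ?F" for s
    unfolding g_def g'_def
    using two_nz by (simp_all add: frob_diff frob_add power_mult_distrib power_divide ih two fq_double_conj[OF that] field_simps ii')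
  have T: "tr (h + h) (s ^ 2) = tr h ((- i) * g s ^ (p ^ h + 1))" if "s \<in> ?F" for s
  proof -
    have "s ^ 2 + (s ^ 2) ^ (p ^ h) = s ^ 2 + (s ^ (p ^ h)) ^ 2"
      by (simp add: mult.commute flip: power_mult)
    also have "\<dots> = (- i) * ((s ^ (p ^ h) + i * s) * (s + i * s ^ (p ^ h)))"
      by (simp add: power2_eq_square algebra_simps ii')
    also have "s ^ (p ^ h) + i * s = g s ^ (p ^ h)"
      unfolding g_def by (simp add: frob_add power_mult_distrib ih fq_double_conj[OF that])
    also have "s + i * s ^ (p ^ h) = g s" by (simp add: g_def)
    finally show ?thesis by (simp add: tr_double power_add mult.commute)
  qed
  let ?B = "{t \<in> ?F. t \<noteq> 0 \<and> tr h ((- i) * t ^ (p ^ h + 1)) = 0}"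
  let ?C = "{c \<in> ?K. c \<noteq> 0 \<and> tr h ((- i) * c) = 0}"
  have fin: "finite ?F" "finite ?K" using finite_fq[of "h + h"] finite_fq[OF h] h by auto
  have "card {s \<in> ?F. tr (h + h) (s ^ 2) = 0} = card {t \<in> ?F. tr h ((- i) * t ^ (p ^ h + 1)) = 0}"
    by (rule bij_betw_same_card[of g], rule bij_betwI[where g = g'])
       (use gF gg T in \<open>auto simp del: power_add power_Suc\<close>)
  also have "{t \<in> ?F. tr h ((- i) * t ^ (p ^ h + 1)) = 0} = insert 0 ?B"
    using fq_0 by auto
  also have "card (insert 0 ?B) = 1 + card ?B" using fin by simp
  also have "card ?B = (p ^ h + 1) * card ?C"
  proof -
    have nF: "t ^ (p ^ h + 1) \<in> ?K" if "t \<in> ?F" for t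
      unfolding fq_def using fq_double_conj[OF that]
      by (simp add: power_mult_distrib mult.commute)
    have fib: "{t \<in> ?B. t ^ (p ^ h + 1) = c} = {t \<in> ?F. t ^ (p ^ h + 1) = c}" if "c \<in> ?C" for c
      using that by auto
    have im: "(\<lambda>t. t ^ (p ^ h + 1)) ` ?B = ?C"
    proof
      show "(\<lambda>t. t ^ (p ^ h + 1)) ` ?B \<subseteq> ?C" using nF by auto
      show "?C \<subseteq> (\<lambda>t. t ^ (p ^ h + 1)) ` ?B"
      proof
        fix c assume c: "c \<in> ?C"
        then have "{t \<in> ?B. t ^ (p ^ h + 1) = c} \<noteq> {}"
          using fib[OF c] card_norm_fibre[OF h, of c] by (metis (mono_tags, lifting) Suc_eq_plus1 card.empty mem_Collect_eq nat.distinct(1))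
        then show "c \<in> (\<lambda>t. t ^ (p ^ h + 1)) ` ?B" by blast
      qed
    qed
    have "(\<Sum>c\<in>?C. card {t \<in> ?B. t ^ (p ^ h + 1) = c}) = (\<Sum>c\<in>?C. p ^ h + 1)"
    proof (intro sum.cong refl)
      fix c assume c: "c \<in> ?C"
      then show "card {t \<in> ?B. t ^ (p ^ h + 1) = c} = p ^ h + 1"
        unfolding fib[OF c] using card_norm_fibre[OF h, of c] by blast
    qed
    moreover have "card ?B = (\<Sum>c\<in>?C. card {t \<in> ?B. t ^ (p ^ h + 1) = c})"
      using sum.image_gen[of ?B "\<lambda>_. 1 :: nat" "\<lambda>t. t ^ (p ^ h + 1)"] fin unfolding im by simp
    ultimately show ?thesis by simp
  qed
  also have "card ?C = p ^ (h - 1) - 1"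
  proof -
    have "?C = {c \<in> ?K. tr h ((- i) * c) = 0} - {0}" by auto
    moreover have "card {c \<in> ?K. tr h ((- i) * c) = 0} = p ^ (h - 1)"
      using i0 iK by (intro card_tr_fibre[OF h]) (auto simp: fq_closed)
    ultimately show ?thesis using fq_0 by (subst \<open>?C = _\<close>, subst card_Diff_singleton) auto
  qed
  finally show ?thesis .
qed

section \<open>Affine points when 6 divides \<open>k\<close>\<close>

definition affine_points :: "nat \<Rightarrow> ('a \<times> 'a) set" where
  "affine_points k = {(x, y). x \<in> fq k \<and> y \<in> fq k \<and> y ^ p - y = qform x}"

lemma card_affine_points: "k > 0 \<Longrightarrow> card (affine_points k) = p * card {x \<in> fq k. tr k (qform x) = 0}"
  unfolding affine_points_def by (rule card_artin_schreier) (auto intro: fq_qform)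

lemma finite_affine_points: "k > 0 \<Longrightarrow> finite (affine_points k)"
  by (rule finite_subset[of _ "fq k \<times> fq k"]) (auto simp: affine_points_def finite_fq)

text \<open>After division by \<open>w\<close> the equation has constant term 1, so any root of the
  quotient is nonzero.\<close>

lemma exists_twist: "\<exists>w::'a. w \<noteq> 0 \<and> w ^ (p ^ 2) + w ^ p + w = 0"
proof -
  have p: "p > 2" "p ^ 2 > p" using p_gt_2 by (auto simp: power2_eq_square)
  let ?f = "monom 1 (p ^ 2 - 1) + (monom 1 (p - 1) + 1) :: 'a poly"
  have "degree (monom 1 (p - 1) + 1 :: 'a poly) \<le> p - 1"
    by (rule degree_add_le) (auto simp: degree_monom_eq)
  then have "degree ?f = p ^ 2 - 1"
    using p by (subst degree_add_eq_left) (auto simp: degree_monom_eq)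
  then obtain w where w: "poly ?f w = 0"
    using alg_closed_imp_poly_has_root[of ?f] p by auto
  then have "w \<noteq> 0" using p by (auto simp: poly_monom power_0_left)
  moreover have "w ^ (p ^ 2) = w * w ^ (p ^ 2 - 1)" "w ^ p = w * w ^ (p - 1)"
    using p by (simp_all flip: power_Suc)
  then have "w ^ (p ^ 2) + w ^ p + w = w * poly ?f w" by (simp add: poly_monom algebra_simps)
  ultimately show ?thesis using w by auto
qed

lemma card_affine_points_6:
  assumes h: "h > 0" "3 dvd h"
  shows "p ^ h mod 4 = 1 \<Longrightarrow>
      real (card (affine_points (2 * h))) = real p ^ (2 * h) - real p * (real p - 1) * real p ^ h"
    and "p ^ h mod 4 = 3 \<Longrightarrow>
      real (card (affine_points (2 * h))) = real p ^ (2 * h) + real p * (real p - 1) * real p ^ h"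
proof -
  \<comment> \<open>With this \<open>a\<close> the field has \<open>(p * a) ^ 2\<close> elements and
    all counts become polynomials in \<open>p\<close> and \<open>a\<close>, free of truncated
    subtraction.\<close>
  define a where "a = real p ^ (h - 1)"
  define N where "N = card {x \<in> fq (h + h). tr (h + h) (qform x) = 0}"
  define N1 where "N1 = card {s \<in> fq (h + h). tr (h + h) (s ^ 2) = 0}"
  have pa: "real p ^ h = real p * a" using h by (cases h) (auto simp: a_def)
  have p0: "p > 0" using p_gt_2 by simp
  have a0: "real (p ^ (h - 1) - 1) = a - 1" "real (p ^ h - 1) = real p * a - 1"
    using p0 pa by (auto simp: a_def of_nat_diff)
  have pk: "real (p ^ (h + h)) = (real p * a) ^ 2" by (simp add: power_add pa power2_eq_square)
  have "p ^ (h + h - 1) = p ^ h * p ^ (h - 1)" using h by (cases h) (auto simp: power_add)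
  then have pk1: "real (p ^ (h + h - 1)) = real p * a * a" by (simp add: pa a_def)
  have le: "p ^ (h + h - 1) \<le> p ^ (h + h)" using p0 by (intro power_increasing) auto
  obtain w :: 'a where w: "w \<noteq> 0" "w ^ (p ^ 2) + w ^ p + w = 0" using exists_twist by blast
  have "real (N + (p ^ (h + h) - p ^ (h + h - 1))) = real (p * N1)"
    using card_qform_reduction[of "h + h", OF _ _ w(2,1)] h by (auto simp: N_def N1_def)
  then have "N + ((real p * a) ^ 2 - real p * a * a) = p * N1"
    using le by (simp only: of_nat_add of_nat_diff of_nat_mult pk pk1)
  then have N: "real N = p * N1 - (real p * a) ^ 2 + real p * a * a" by simp
  have A: "real (card (affine_points (2 * h))) = p * real N"
    using card_affine_points[of "2 * h"] h by (simp add: mult_2 N_def)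
  have pk': "real p ^ (2 * h) = (real p * a) ^ 2" using pk by (simp add: mult_2)
  show "real (card (affine_points (2 * h))) = real p ^ (2 * h) - real p * (real p - 1) * real p ^ h"
    if "p ^ h mod 4 = 1"
  proof -
    have N1: "real N1 = 1 + (real p * a + 1) * (a - 1)"
      unfolding N1_def card_tr_square_1[OF h(1) that] of_nat_add of_nat_mult a0 by (simp add: pa)
    show ?thesis unfolding A N of_nat_mult N1 pk' pa by (simp add: algebra_simps power2_eq_square)
  qed
  show "real (card (affine_points (2 * h))) = real p ^ (2 * h) + real p * (real p - 1) * real p ^ h"
    if "p ^ h mod 4 = 3"
  proof -
    have N1: "real N1 = real p * a + (real p * a - 1) * a"
      unfolding N1_def card_tr_square_3[OF h(1) that] of_nat_add of_nat_mult a0 by (simp add: pa a_def)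
    show ?thesis unfolding A N of_nat_mult N1 pk' pa by (simp add: algebra_simps power2_eq_square)
  qed
qed

section \<open>Deviation bound when 3 does not divide \<open>k\<close>\<close>

lemma fq3_inter: assumes "\<not> 3 dvd k" "x \<in> fq 3" "x \<in> fq k" shows "x \<in> fq 1"
proof -
  have "x \<in> fq (3 * (k div 3))" using fq_mono[of 3 "3 * (k div 3)"] assms by auto
  then have "x ^ (p ^ (3 * (k div 3) + k mod 3)) = x ^ (p ^ (k mod 3))"
    by (simp only: power_add power_mult[of x "p ^ (3 * (k div 3))"] fq_frob)
  then have k: "x ^ (p ^ (k mod 3)) = x" using fq_frob[OF assms(3)] by simp
  have "k mod 3 = 1 \<or> k mod 3 = 2" using assms(1) by presburger
  then show ?thesis
  proof
    assume "k mod 3 = 2"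
    then have "x ^ (p ^ 2) = x" using k by simp
    moreover have "x = (x ^ (p ^ 2)) ^ p" using fq_frob[OF assms(2)]
      by (simp add: power2_eq_square power3_eq_cube flip: power_mult)
    ultimately show ?thesis by (simp add: fq_def)
  qed (use k in \<open>simp add: fq_def\<close>)
qed

text \<open>The left side is twice the polar form. Replacing \<open>t ^ p * s\<close> and
  \<open>t * s\<close> by their \<open>p\<close>-th powers under the trace collects everything in
  front of \<open>s ^ p\<close>, and the radical becomes visible as the zeros of
  \<open>t ^ (p ^ 2) + t ^ p + t\<close>.\<close>

lemma tr_qform_polar:
  assumes t: "t \<in> fq k" and s: "s \<in> fq k"
  shows "tr k (qform (t + s)) - tr k (qform (t - s)) = 4 * tr k ((t ^ (p ^ 2) + t ^ p + t) * s ^ p)"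
proof -
  have four: "4 \<in> fq 1" by (rule fq_numeral)
  have "qform (t + s) - qform (t - s) = 4 * (t ^ p * s + t * s ^ p + t * s)"
    by (simp add: qform_def frob_add1 frob_diff1 algebra_simps power2_eq_square)
  then have "tr k (qform (t + s)) - tr k (qform (t - s)) = 4 * tr k (t ^ p * s + t * s ^ p + t * s)"
    by (simp only: tr_scale[OF four] flip: tr_diff)
  also have "tr k (t ^ p * s + t * s ^ p + t * s) = tr k ((t ^ p * s) ^ p) + tr k (t * s ^ p) + tr k ((t * s) ^ p)"
    using t s by (simp add: tr_add tr_frob fq_closed fq_power)
  also have "\<dots> = tr k ((t ^ (p ^ 2) + t ^ p + t) * s ^ p)"
    by (simp add: power_mult_distrib power2_eq_square algebra_simps flip: tr_add power_mult)
  finally show ?thesis .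
qed

lemma card_tr_frob_fibre:
  assumes "k > 0" "n \<in> fq k" "n \<noteq> 0"
  shows "card {x \<in> fq k. tr k (n * x ^ p) = 0} = p ^ (k - 1)"
proof -
  have e: "(x ^ p) ^ (p ^ (k - 1)) = x" "(x ^ (p ^ (k - 1))) ^ p = x" if "x \<in> fq k" for x
    using fq_frob[OF that] assms(1) by (cases k; simp add: mult.commute flip: power_mult)+
  have "card {x \<in> fq k. tr k (n * x ^ p) = 0} = card {x \<in> fq k. tr k (n * x) = 0}"
    by (rule bij_betw_same_card[of "\<lambda>x. x ^ p"], rule bij_betwI[where g = "\<lambda>x. x ^ (p ^ (k - 1))"])
       (auto simp: e fq_power simp del: One_nat_def)
  then show ?thesis using card_tr_fibre[OF assms fq_0] by simp
qed

text \<open>The sum counts pairs with equal values of the form. In the coordinates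
  \<open>x = t + s\<close>, \<open>y = t - s\<close> equality is an additive condition on
  \<open>s\<close> for each fixed \<open>t\<close>: it holds for every \<open>s\<close> if
  \<open>t\<close> is in the radical, and otherwise for one \<open>p\<close>-th of them.\<close>

lemma second_moment:
  assumes k: "k > 0"
  defines "n \<equiv> \<lambda>c. card {x \<in> fq k. tr k (qform x) = c}"
    and "r \<equiv> card {t \<in> fq k. t ^ (p ^ 2) + t ^ p + t = 0}"
  shows "(\<Sum>c\<in>fq 1. n c * n c) = r * p ^ k + (p ^ k - r) * p ^ (k - 1)"
proof -
  let ?D = "\<lambda>t::'a. t ^ (p ^ 2) + t ^ p + t"
  note fin = finite_fq[OF k]
  have "(\<Sum>c\<in>fq 1. n c * n c) = card (SIGMA c : fq 1. {x \<in> fq k. tr k (qform x) = c} \<times> {x \<in> fq k. tr k (qform x) = c})"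
    using fin finite_fq[of 1] by (simp add: n_def card_cartesian_product)
  also have "\<dots> = card {(x, y). x \<in> fq k \<and> y \<in> fq k \<and> tr k (qform x) = tr k (qform y)}"
    by (rule bij_betw_same_card[of snd], rule bij_betwI[where g = "\<lambda>xy. (tr k (qform (fst xy)), xy)"])
       (auto intro!: tr_in_fq1 fq_qform simp del: One_nat_def)
  also have "\<dots> = card {(t, s). t \<in> fq k \<and> s \<in> fq k \<and> tr k (?D t * s ^ p) = 0}"
  proof (rule sym, rule bij_betw_same_card[of "\<lambda>(t, s). (t + s, t - s)"], rule bij_betwI[where g = "\<lambda>(x, y). ((x + y) / 2, (x - y) / 2)"])
    have four: "(4::'a) \<noteq> 0" using two_nz by (metis mult_2 mult_eq_0_iff numeral_Bit0)
    show "(\<lambda>(t, s). (t + s, t - s)) \<in> {(t, s). t \<in> fq k \<and> s \<in> fq k \<and> tr k (?D t * s ^ p) = 0}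
        \<rightarrow> {(x, y). x \<in> fq k \<and> y \<in> fq k \<and> tr k (qform x) = tr k (qform y)}"
      using tr_qform_polar by (auto simp: fq_closed) (metis eq_iff_diff_eq_0 mult_zero_right)
    show "(\<lambda>(x, y). ((x + y) / 2, (x - y) / 2)) \<in> {(x, y). x \<in> fq k \<and> y \<in> fq k \<and> tr k (qform x) = tr k (qform y)}
        \<rightarrow> {(t, s). t \<in> fq k \<and> s \<in> fq k \<and> tr k (?D t * s ^ p) = 0}"
    proof clarify
      fix x y assume xy: "x \<in> fq k" "y \<in> fq k" "tr k (qform x) = tr k (qform y)"
      have m: "(x + y) / 2 \<in> fq k" "(x - y) / 2 \<in> fq k" using xy by (auto intro!: fq_divide fq_add fq_diff fq_numeral)
      then show "(x + y) / 2 \<in> fq k \<and> (x - y) / 2 \<in> fq k \<and> tr k (?D ((x + y) / 2) * ((x - y) / 2) ^ p) = 0"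
        using tr_qform_polar[OF m] xy(3) four unfolding half_sum_diff by simp
    qed
    show "(\<lambda>(x, y). ((x + y) / 2, (x - y) / 2)) ((\<lambda>(t, s). (t + s, t - s)) z) = z" for z :: "'a \<times> 'a"
      using two_nz by (cases z) (simp flip: mult_2)
    show "(\<lambda>(t, s). (t + s, t - s)) ((\<lambda>(x, y). ((x + y) / 2, (x - y) / 2)) z) = z" for z :: "'a \<times> 'a"
      by (cases z) (simp add: half_sum_diff)
  qed
  also have "{(t, s). t \<in> fq k \<and> s \<in> fq k \<and> tr k (?D t * s ^ p) = 0} = (SIGMA t : fq k. {s \<in> fq k. tr k (?D t * s ^ p) = 0})"
    by auto
  also have "card \<dots> = (\<Sum>t\<in>fq k. card {s \<in> fq k. tr k (?D t * s ^ p) = 0})"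
    using fin by simp
  also have "\<dots> = (\<Sum>t\<in>fq k. if ?D t = 0 then p ^ k else p ^ (k - 1))"
  proof (intro sum.cong refl)
    fix t assume t: "t \<in> fq k"
    show "card {s \<in> fq k. tr k (?D t * s ^ p) = 0} = (if ?D t = 0 then p ^ k else p ^ (k - 1))"
    proof (cases "?D t = 0")
      case True
      then show ?thesis using card_fq[OF k] by (simp only: True) simp
    next
      case False
      moreover have "?D t \<in> fq k" using t by (intro fq_add fq_power)
      ultimately show ?thesis using card_tr_frob_fibre[OF k, of "?D t"] by simp
    qed
  qed
  also have "\<dots> = r * p ^ k + card (fq k - {t \<in> fq k. ?D t = 0}) * p ^ (k - 1)"
  proof -
    have "fq k \<inter> {t. ?D t = 0} = {t \<in> fq k. ?D t = 0}"
      "fq k \<inter> - {t. ?D t = 0} = fq k - {t \<in> fq k. ?D t = 0}" by auto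
    then show ?thesis unfolding sum.If_cases[OF fin] r_def by simp
  qed
  also have "card (fq k - {t \<in> fq k. ?D t = 0}) = p ^ k - r"
    unfolding r_def using fin card_fq[OF k] by (subst card_Diff_subset) auto
  finally show ?thesis .
qed

lemma square_sum_le:
  fixes f :: "'b \<Rightarrow> real"
  shows "(\<Sum>x\<in>A. f x) ^ 2 \<le> card A * (\<Sum>x\<in>A. f x ^ 2)"
proof (cases "card A = 0")
  case False
  let ?S = "\<Sum>x\<in>A. f x" let ?N = "real (card A)"
  have N: "?N > 0" using False by simp
  have "0 \<le> (\<Sum>x\<in>A. (?N * f x - ?S) ^ 2)" by (intro sum_nonneg) simp
  also have "\<dots> = (\<Sum>x\<in>A. ?N ^ 2 * f x ^ 2 - 2 * ?N * ?S * f x + ?S ^ 2)"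
    by (intro sum.cong refl) (simp add: power2_eq_square algebra_simps)
  also have "\<dots> = ?N * (?N * (\<Sum>x\<in>A. f x ^ 2) - ?S ^ 2)"
    by (simp add: sum.distrib sum_subtractf flip: sum_distrib_left) (simp add: power2_eq_square algebra_simps)
  finally show ?thesis using N by (simp add: zero_le_mult_iff)
qed (auto simp: card_eq_0_iff)

text \<open>Cauchy-Schwarz is applied to the sizes \<open>n c\<close> of the value classes with
  \<open>c\<close> nonzero. Their sum is \<open>q - n 0\<close>, their sum of squares comes from
  \<open>second_moment\<close>, and the outcome is
  \<open>(p * n 0 - q) ^ 2 \<le> r * q * (p - 1) ^ 2\<close> for a radical of order
  \<open>r\<close>. Hasse-Weil would correspond to \<open>r = p ^ 2\<close>; here \<open>r\<close>
  is at most \<open>p\<close>.\<close>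

lemma card_affine_points_deviation:
  assumes k: "k > 0" "\<not> 3 dvd k"
  shows "(real (card (affine_points k)) - real p ^ k) ^ 2 \<le> real p * (real p - 1) ^ 2 * real p ^ k"
proof -
  define n where "n c = card {x \<in> fq k. tr k (qform x) = c}" for c
  define R where "R = {t \<in> fq k. t ^ (p ^ 2) + t ^ p + t = (0::'a)}"
  define q where "q = real p ^ k"
  define a where "a = real p ^ (k - 1)"
  have p: "p > 2" by (rule p_gt_2)
  have qa: "q = p * a" unfolding q_def a_def using k by (cases k) auto
  have fin: "finite (fq k)" "finite (fq 1)" using finite_fq k by auto
  \<comment> \<open>On \<open>fq 1\<close> the equation reads \<open>3 * t = 0\<close>; the bound
    \<open>p\<close> on the radical covers characteristic 3, where all of \<open>fq 1\<close> solves
    it.\<close>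
  have "R \<subseteq> fq 1"
    unfolding R_def using fq3_inter[OF k(2)] root_in_fq3 by (auto simp: fq_def)
  then have r: "card R \<le> p" using card_mono[OF fin(2)] card_fq[of 1] by simp
  have "R \<subseteq> fq k" by (auto simp: R_def)
  then have rq: "card R \<le> p ^ k" using card_mono[OF fin(1)] card_fq[OF k(1)] by metis
  have "real (\<Sum>c\<in>fq 1. n c * n c) = real (card R * p ^ k + (p ^ k - card R) * p ^ (k - 1))"
    using second_moment[OF k(1)] by (simp add: n_def R_def)
  then have m2: "(\<Sum>c\<in>fq 1. real (n c) ^ 2) = card R * q + (q - card R) * a"
    using rq by (simp add: q_def a_def of_nat_diff power2_eq_square)
  have "p ^ k = (\<Sum>c\<in>(\<lambda>x. tr k (qform x)) ` fq k. n c)"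
    using sum.image_gen[OF fin(1), of "\<lambda>_. 1 :: nat" "\<lambda>x. tr k (qform x)"] card_fq[OF k(1)] by (simp add: n_def)
  also have "\<dots> = (\<Sum>c\<in>fq 1. n c)"
    using fin(2) by (intro sum.mono_neutral_left) (auto simp: n_def tr_in_fq1 fq_qform card_eq_0_iff simp del: One_nat_def)
  finally have m1: "(\<Sum>c\<in>fq 1. real (n c)) = q" unfolding q_def by (metis of_nat_power of_nat_sum)
  have s1: "(\<Sum>c\<in>fq 1 - {0}. real (n c)) = q - n 0"
    using m1 fin(2) fq_0[of 1] by (simp add: sum_diff1)
  have s2: "(\<Sum>c\<in>fq 1 - {0}. real (n c) ^ 2) = card R * q + (q - card R) * a - real (n 0) ^ 2"
    using m2 fin(2) fq_0[of 1] by (simp add: sum_diff1)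
  have cp: "real (card (fq 1 - {0})) = real p - 1"
    using card_fq[of 1] fin(2) fq_0[of 1] p by (simp add: card_Diff_singleton)
  have "(q - n 0) ^ 2 \<le> (real p - 1) * (card R * q + (q - card R) * a - real (n 0) ^ 2)"
    using square_sum_le[of "\<lambda>c. real (n c)" "fq 1 - {0}"] unfolding s1 s2 cp .
  then have "p * (q - n 0) ^ 2 \<le> p * ((real p - 1) * (card R * q + (q - card R) * a - real (n 0) ^ 2))"
    using p by (intro mult_left_mono) auto
  also have "\<dots> = (real p - 1) * (p * card R * q + (q - card R) * q - p * real (n 0) ^ 2)"
    unfolding qa by (simp add: algebra_simps)
  finally have "(p * real (n 0) - q) ^ 2 \<le> card R * q * (real p - 1) ^ 2"
    by (simp add: algebra_simps power2_eq_square)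
  also have "\<dots> \<le> p * q * (real p - 1) ^ 2"
    using r p by (intro mult_right_mono) (auto simp: q_def)
  finally show ?thesis
    unfolding card_affine_points[OF k(1)] by (simp add: n_def q_def mult.commute mult.left_commute)
qed

end

section \<open>Valuation rings from charts\<close>

locale ring_morphism =
  fixes h :: "'a::comm_ring_1 \<Rightarrow> 'b::comm_ring_1"
  assumes hom_add: "h (x + y) = h x + h y" and hom_mult: "h (x * y) = h x * h y" and hom_1: "h 1 = 1"
begin

lemma hom_0: "h 0 = 0" using hom_add[of 0 0] by (metis add.right_neutral add_left_cancel)
lemma hom_minus: "h (- x) = - h x" using hom_add[of x "- x"] hom_0 by (simp add: eq_neg_iff_add_eq_0 add.commute)
lemma hom_diff: "h (x - y) = h x - h y" using hom_add[of x "- y"] hom_minus by simp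
lemma hom_power: "h (x ^ n) = h x ^ n" by (induction n) (simp_all add: hom_1 hom_mult)
lemma hom_of_nat: "h (of_nat n) = of_nat n" by (induction n) (simp_all add: hom_0 hom_1 hom_add)
lemma hom_numeral: "h (numeral n) = numeral n" using hom_of_nat[of "numeral n"] by simp

lemmas hom_simps = hom_0 hom_1 hom_add hom_minus hom_diff hom_mult hom_power hom_numeral

lemma eval_pCons: "poly (map_poly h (pCons a P)) y = h a + y * poly (map_poly h P) y"
  by (simp add: map_poly_pCons hom_0)

lemma eval_add: "poly (map_poly h (P + Q)) y = poly (map_poly h P) y + poly (map_poly h Q) y"
  by (induction P Q rule: poly_induct2) (simp_all add: eval_pCons hom_add algebra_simps)

lemma eval_smult: "poly (map_poly h (smult a P)) y = h a * poly (map_poly h P) y"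
  by (simp add: map_poly_smult hom_0 hom_mult)

lemma eval_mult: "poly (map_poly h (P * Q)) y = poly (map_poly h P) y * poly (map_poly h Q) y"
  by (induction P) (simp_all add: eval_pCons eval_add eval_smult hom_0 algebra_simps)

lemma eval_sum: "poly (map_poly h P) y = (\<Sum>j\<le>degree P. h (coeff P j) * y ^ j)"
proof -
  let ?m = "map_poly h P"
  have "degree ?m \<le> degree P"
    by (rule degree_le) (simp add: coeff_map_poly hom_0 coeff_eq_0)
  then have "poly ?m y = (\<Sum>j\<le>degree P. coeff ?m j * y ^ j)"
    unfolding poly_altdef by (intro sum.mono_neutral_left) (auto simp: coeff_eq_0)
  then show ?thesis by (simp add: coeff_map_poly hom_0)
qed

lemma ring_morphism_eval: "ring_morphism (\<lambda>P. poly (map_poly h P) y)"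
  by standard (simp_all add: eval_add eval_mult hom_1)

end

text \<open>The map \<open>e\<close> evaluates polynomials at the generic point, \<open>f\<close> at
  the point in question. The polynomial ring is not factored by the relations, so equations are
  stated after \<open>e\<close>. The last assumption says that the maximal ideal of the local ring
  is generated by \<tau>, with the denominator \<open>S\<close> cleared.\<close>

locale local_chart = e: ring_morphism e + f: ring_morphism f
  for e :: "'b::comm_ring_1 \<Rightarrow> 'k::field" and f :: "'b \<Rightarrow> 'l::field" +
  fixes \<tau> :: 'b
  assumes kernel: "e P = 0 \<Longrightarrow> f P = 0"
    and e_tau: "e \<tau> \<noteq> 0" and f_tau: "f \<tau> = 0"
    and div_tau: "f P = 0 \<Longrightarrow> \<exists>S P'. f S \<noteq> 0 \<and> e (P * S) = e (\<tau> * P')"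
begin

lemma e_nz: "f S \<noteq> 0 \<Longrightarrow> e S \<noteq> 0" using kernel by blast

lemma f_cong: "e P = e Q \<Longrightarrow> f P = f Q"
  using kernel[of "P - Q"] by (simp add: e.hom_diff f.hom_diff)

text \<open>The function \<open>e P\<close> is a power of the parameter times a unit of the local
  ring, written without fractions.\<close>

definition has_order :: "'b \<Rightarrow> bool" where
  "has_order P \<longleftrightarrow> (\<exists>n S T. f S \<noteq> 0 \<and> f T \<noteq> 0 \<and> e (P * S) = e (\<tau> ^ n * T))"

lemma has_order_unit: "f P \<noteq> 0 \<Longrightarrow> has_order P"
  unfolding has_order_def by (rule exI[of _ 0], rule exI[of _ 1], rule exI[of _ P]) (simp add: f.hom_1)

lemma has_order_tau: "has_order \<tau>"
  unfolding has_order_def by (rule exI[of _ 1], rule exI[of _ 1], rule exI[of _ 1]) (simp add: f.hom_1)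

lemma has_order_mult: assumes "has_order P" "has_order Q" shows "has_order (P * Q)"
proof -
  obtain n S T where 1: "f S \<noteq> 0" "f T \<noteq> 0" "e (P * S) = e (\<tau> ^ n * T)"
    using assms(1) by (auto simp: has_order_def)
  obtain m S' T' where 2: "f S' \<noteq> 0" "f T' \<noteq> 0" "e (Q * S') = e (\<tau> ^ m * T')"
    using assms(2) by (auto simp: has_order_def)
  have "e ((P * Q) * (S * S')) = e (P * S) * e (Q * S')" by (simp add: e.hom_mult)
  also have "\<dots> = e (\<tau> ^ (n + m) * (T * T'))" unfolding 1 2 by (simp add: e.hom_mult power_add e.hom_power)
  finally show ?thesis
    unfolding has_order_def using 1 2 by (metis f.hom_mult mult_eq_0_iff)
qed

lemma has_order_power: "has_order P \<Longrightarrow> has_order (P ^ n)"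
  by (induction n) (auto intro: has_order_mult has_order_unit simp: f.hom_1)

lemma has_order_cong: "has_order P \<Longrightarrow> e Q = e P \<Longrightarrow> has_order Q"
  unfolding has_order_def e.hom_mult by simp

lemma has_order_step:
  assumes "has_order P'" "f S \<noteq> 0" "e (P * S) = e (\<tau> * P')" shows "has_order P"
proof -
  obtain n S' T where 1: "f S' \<noteq> 0" "f T \<noteq> 0" "e (P' * S') = e (\<tau> ^ n * T)"
    using assms(1) by (auto simp: has_order_def)
  have "e (P * (S * S')) = e (P * S) * e S'" by (simp add: e.hom_mult)
  also have "\<dots> = e \<tau> * e (P' * S')" unfolding assms(3) by (simp add: e.hom_mult)
  also have "\<dots> = e (\<tau> ^ Suc n * T)" unfolding 1 by (simp add: e.hom_mult e.hom_power)
  finally show ?thesis unfolding has_order_def using 1 assms(2) by (metis f.hom_mult mult_eq_0_iff)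
qed

text \<open>Induction on the order of the product: while \<open>P\<close> vanishes at the point, one
  factor \<tau> can be taken out of it, and this lowers the order of \<open>P * Q\<close>. Thus it
  suffices to find an order for some multiple of each function.\<close>

lemma has_order_factor: "has_order (P * Q) \<Longrightarrow> has_order P"
proof -
  have "f S \<noteq> 0 \<Longrightarrow> f T \<noteq> 0 \<Longrightarrow> e (P * Q * S) = e (\<tau> ^ n * T) \<Longrightarrow> has_order P" for n S T P
  proof (induction n arbitrary: P S T)
    case 0
    then have "f (P * Q * S) = f T" using f_cong[of "P * Q * S" T] by simp
    then show ?case using 0 by (intro has_order_unit) (auto simp: f.hom_mult)
  next
    case (Suc n)
    show ?case
    proof (cases "f P = 0")
      case True
      then obtain S' P' where S': "f S' \<noteq> 0" "e (P * S') = e (\<tau> * P')" using div_tau by blast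
      have "e \<tau> * e (P' * Q * S) = e (P * Q * S) * e S'"
        using S'(2) by (simp add: e.hom_mult)
      also have "\<dots> = e \<tau> * e (\<tau> ^ n * (T * S'))" unfolding Suc.prems(3) by (simp add: e.hom_mult e.hom_power)
      finally have "e (P' * Q * S) = e (\<tau> ^ n * (T * S'))" using e_tau by simp
      then have "has_order P'" using Suc.IH[of S "T * S'" P'] Suc.prems S' by (simp add: f.hom_mult)
      then show ?thesis using S' by (rule has_order_step)
    qed (rule has_order_unit)
  qed
  then show "has_order (P * Q) \<Longrightarrow> has_order P" unfolding has_order_def[of "P * Q"] by blast
qed

definition local_ring :: "'k set" where "local_ring = {e P / e S | P S. f S \<noteq> 0}"

definition residue :: "'k \<Rightarrow> 'l" where
  "residue z = (SOME w. \<exists>P S. f S \<noteq> 0 \<and> z = e P / e S \<and> w = f P / f S)"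

text \<open>Equal fractions have equal residues because, by \<open>kernel\<close>, \<open>f\<close>
  factors through \<open>e\<close>.\<close>

lemma residue_eq: assumes "f S \<noteq> 0" shows "residue (e P / e S) = f P / f S"
proof -
  have "\<exists>P' S'. f S' \<noteq> 0 \<and> e P / e S = e P' / e S' \<and> residue (e P / e S) = f P' / f S'"
    unfolding residue_def by (rule someI_ex) (use assms in blast)
  then obtain P' S' where 1: "f S' \<noteq> 0" "e P / e S = e P' / e S'" "residue (e P / e S) = f P' / f S'" by blast
  then have "e (P * S') = e (P' * S)" using e_nz[OF assms] e_nz[OF 1(1)] by (simp add: e.hom_mult field_simps)
  then have "f P * f S' = f P' * f S" using f_cong by (metis f.hom_mult)
  then have "f P' / f S' = f P / f S" using 1(1) assms by (simp add: frac_eq_eq)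
  then show ?thesis using 1(3) by simp
qed

lemma local_ringI: "f S \<noteq> 0 \<Longrightarrow> e P / e S \<in> local_ring" by (auto simp: local_ring_def)

lemma range_local_ring: "e P \<in> local_ring" using local_ringI[of 1 P] by (simp add: f.hom_1 e.hom_1)

lemma residue_e: "residue (e P) = f P" using residue_eq[of 1 P] by (simp add: f.hom_1 e.hom_1)

lemma local_ringE:
  assumes "z \<in> local_ring" obtains P S where "z = e P / e S" "f S \<noteq> 0" "residue z = f P / f S" "e S \<noteq> 0"
  using assms residue_eq e_nz by (auto simp: local_ring_def)

lemma local_ring_mult:
  assumes "a \<in> local_ring" "b \<in> local_ring"
  shows "a * b \<in> local_ring" "residue (a * b) = residue a * residue b"
proof -
  obtain P S P' S' where 1: "a = e P / e S" "f S \<noteq> 0" "residue a = f P / f S"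
    and 2: "b = e P' / e S'" "f S' \<noteq> 0" "residue b = f P' / f S'"
    using assms by (metis local_ringE)
  have ab: "a * b = e (P * P') / e (S * S')" using 1 2 by (simp add: e.hom_mult)
  then show "a * b \<in> local_ring" using 1 2 by (simp add: local_ringI f.hom_mult)
  show "residue (a * b) = residue a * residue b"
    unfolding ab using 1 2 residue_eq[of "S * S'" "P * P'"] by (simp add: f.hom_mult)
qed

lemma local_ring_add:
  assumes "a \<in> local_ring" "b \<in> local_ring"
  shows "a + b \<in> local_ring" "residue (a + b) = residue a + residue b"
proof -
  obtain P S P' S' where 1: "a = e P / e S" "f S \<noteq> 0" "residue a = f P / f S" "e S \<noteq> 0"
    and 2: "b = e P' / e S'" "f S' \<noteq> 0" "residue b = f P' / f S'" "e S' \<noteq> 0"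
    using assms by (metis local_ringE)
  have ab: "a + b = e (P * S' + P' * S) / e (S * S')" using 1 2 by (simp add: e.hom_mult e.hom_add field_simps)
  then show "a + b \<in> local_ring" using 1 2 by (simp add: local_ringI f.hom_mult)
  show "residue (a + b) = residue a + residue b"
    unfolding ab using 1(2) 2(2) residue_eq[of "S * S'" "P * S' + P' * S"]
    by (simp add: f.hom_mult f.hom_add 1(3) 2(3) add_frac_eq)
qed

lemma local_ring_minus: "a \<in> local_ring \<Longrightarrow> - a \<in> local_ring"
  using local_ring_mult(1)[of "e (- 1)" a] range_local_ring[of "- 1"] by (simp add: e.hom_minus e.hom_1)

lemma local_ring_diff: "a \<in> local_ring \<Longrightarrow> b \<in> local_ring \<Longrightarrow> a - b \<in> local_ring"
  using local_ring_add(1)[of a "- b"] local_ring_minus by simp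

lemma residue_eq_0_iff:
  assumes "a \<in> local_ring" shows "residue a = 0 \<longleftrightarrow> a = 0 \<or> inverse a \<notin> local_ring"
proof
  obtain P S where 1: "a = e P / e S" "f S \<noteq> 0" "residue a = f P / f S" "e S \<noteq> 0"
    using assms local_ringE by metis
  assume r: "residue a = 0"
  show "a = 0 \<or> inverse a \<notin> local_ring"
  proof (rule ccontr)
    assume "\<not> ?thesis"
    then have "residue (a * inverse a) = 0" "a * inverse a = e 1"
      using local_ring_mult(2)[OF assms, of "inverse a"] r by (simp_all add: e.hom_1)
    then show False by (simp add: residue_e f.hom_1)
  qed
next
  obtain P S where 1: "a = e P / e S" "f S \<noteq> 0" "residue a = f P / f S" "e S \<noteq> 0"
    using assms local_ringE by metis
  assume "a = 0 \<or> inverse a \<notin> local_ring"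
  then have "f P = 0" using 1 kernel[of P] local_ringI[of P S] by auto
  then show "residue a = 0" using 1 by simp
qed

end

text \<open>Divisibility by \<tau> alone does not exclude functions that can be divided forever; the
  extra assumption supplies the termination.\<close>

locale regular_chart = local_chart +
  assumes order: "e P \<noteq> 0 \<Longrightarrow> \<exists>Q. has_order (P * Q)"
begin

lemma fraction_order:
  assumes "e P \<noteq> 0" "e Q \<noteq> 0"
  obtains u n where "u \<in> local_ring" "inverse u \<in> local_ring" "u \<noteq> 0" "e P / e Q = u * e \<tau> ^ n \<or> e P / e Q = u / e \<tau> ^ n"
proof -
  have ho: "has_order P" "has_order Q" using order assms has_order_factor by blast+
  obtain n S T where 1: "f S \<noteq> 0" "f T \<noteq> 0" "e (P * S) = e (\<tau> ^ n * T)"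
    using ho(1) by (auto simp: has_order_def)
  obtain m S' T' where 2: "f S' \<noteq> 0" "f T' \<noteq> 0" "e (Q * S') = e (\<tau> ^ m * T')"
    using ho(2) by (auto simp: has_order_def)
  note nz = e_nz[OF 1(1)] e_nz[OF 1(2)] e_nz[OF 2(1)] e_nz[OF 2(2)]
  define u where "u = e (T * S') / e (S * T')"
  have iu: "inverse u = e (S * T') / e (T * S')" by (simp add: u_def)
  have u: "u \<in> local_ring" "inverse u \<in> local_ring" "u \<noteq> 0"
    unfolding iu using 1 2 nz unfolding u_def by (auto intro!: local_ringI simp: f.hom_mult) (auto simp: e.hom_mult)
  have P: "e P = e \<tau> ^ n * e T / e S" and Q: "e Q = e \<tau> ^ m * e T' / e S'"
    using 1(3) 2(3) nz by (simp_all add: e.hom_mult e.hom_power field_simps)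
  have PQ: "e P / e Q = u * (e \<tau> ^ n / e \<tau> ^ m)" unfolding P Q u_def using nz e_tau by (simp add: e.hom_mult field_simps)
  show thesis
  proof (cases "n \<ge> m")
    case True
    then have "e \<tau> ^ n / e \<tau> ^ m = e \<tau> ^ (n - m)" using e_tau by (simp add: power_diff)
    then show thesis using that[OF u, of "n - m"] PQ by simp
  next
    case False
    then have "e \<tau> ^ n / e \<tau> ^ m = 1 / e \<tau> ^ (m - n)" using e_tau by (simp add: power_diff)
    then show thesis using that[OF u, of "m - n"] PQ by simp
  qed
qed

lemma fraction_cases:
  assumes "e Q \<noteq> 0" shows "e P / e Q \<in> local_ring \<or> inverse (e P / e Q) \<in> local_ring"
proof (cases "e P = 0")
  case True
  then show ?thesis using range_local_ring[of 0] by (simp add: e.hom_0)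
next
  case False
  obtain u n where u: "u \<in> local_ring" "inverse u \<in> local_ring" "u \<noteq> 0"
    "e P / e Q = u * e \<tau> ^ n \<or> e P / e Q = u / e \<tau> ^ n"
    using fraction_order[OF False assms] .
  have t: "e \<tau> ^ n \<in> local_ring" using range_local_ring[of "\<tau> ^ n"] by (simp add: e.hom_power)
  from u(4) show ?thesis
  proof
    assume "e P / e Q = u * e \<tau> ^ n"
    then show ?thesis using local_ring_mult(1)[OF u(1) t] by simp
  next
    assume "e P / e Q = u / e \<tau> ^ n"
    then have "inverse (e P / e Q) = inverse u * e \<tau> ^ n" by (simp only:) (simp add: divide_inverse mult.commute)
    then show ?thesis using local_ring_mult(1)[OF u(2) t] by simp
  qed
qed

lemma inverse_tau_notin: "inverse (e \<tau>) \<notin> local_ring"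
  using residue_eq_0_iff[OF range_local_ring, of \<tau>] e_tau f_tau by (simp add: residue_e)

text \<open>If \<open>f S\<close> is nonzero then \<open>e S\<close> has nonzero residue and is a
  unit of \<open>A\<close>, so \<open>A\<close> contains \<open>local_ring\<close>. An element of
  \<open>A\<close> outside it would be \<open>u / e \<tau> ^ n\<close> with \<open>u\<close> a unit
  and \<open>n > 0\<close>; multiplying by \<open>inverse u * e \<tau> ^ (n - 1)\<close> would put
  the inverse of \<open>e \<tau>\<close> into \<open>A\<close>, although the residue of
  \<open>e \<tau>\<close> is 0.\<close>

lemma local_ring_unique:
  assumes A: "A \<subseteq> {e P / e S | P S. e S \<noteq> 0}" "range e \<subseteq> A"
    "\<And>a b. a \<in> A \<Longrightarrow> b \<in> A \<Longrightarrow> a * b \<in> A"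
    and mult: "\<And>a b. a \<in> A \<Longrightarrow> b \<in> A \<Longrightarrow> \<phi> (a * b) = \<phi> a * \<phi> b"
    and local: "\<And>a. a \<in> A \<Longrightarrow> \<phi> a = 0 \<longleftrightarrow> a = 0 \<or> inverse a \<notin> A"
    and e: "\<And>P. \<phi> (e P) = f P"
  shows "A = local_ring" "\<And>a. a \<in> A \<Longrightarrow> \<phi> a = residue a"
proof -
  have eA: "e P \<in> A" for P using A(2) by auto
  have inv: "inverse (e S) \<in> A" if "f S \<noteq> 0" for S
    using local[OF eA, of S] e[of S] that by auto
  have sub: "local_ring \<subseteq> A"
    using inv eA A(3) by (auto simp: local_ring_def divide_inverse)
  have notin: "inverse (e \<tau>) \<notin> A" using local[OF eA, of \<tau>] e[of \<tau>] e_tau f_tau by auto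
  have "z \<in> local_ring" if z: "z \<in> A" for z
  proof (cases "z = 0")
    case True
    then show ?thesis using range_local_ring[of 0] by (simp add: e.hom_0)
  next
    case False
    obtain P S where PS: "z = e P / e S" "e S \<noteq> 0" using A(1) z by blast
    then have "e P \<noteq> 0" using False by auto
    then obtain u n where u: "u \<in> local_ring" "inverse u \<in> local_ring" "u \<noteq> 0"
      "z = u * e \<tau> ^ n \<or> z = u / e \<tau> ^ n"
      using fraction_order[of P S] PS by metis
    have t: "e \<tau> ^ n \<in> local_ring" for n using range_local_ring[of "\<tau> ^ n"] by (simp add: e.hom_power)
    show ?thesis
    proof (cases n)
      case 0
      then show ?thesis using u by auto
    next
      case (Suc m)
      have "z \<noteq> u / e \<tau> ^ n"
      proof
        assume zn: "z = u / e \<tau> ^ n"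
        have "inverse (e \<tau>) = z * (inverse u * e \<tau> ^ m)"
          unfolding zn Suc using u(3) e_tau by (simp add: field_simps)
        moreover have "inverse u * e \<tau> ^ m \<in> A" using local_ring_mult(1)[OF u(2) t] sub by blast
        ultimately show False using notin A(3) z by metis
      qed
      then show ?thesis using u local_ring_mult(1)[OF u(1) t] by auto
    qed
  qed
  then show AO: "A = local_ring" using sub by blast
  show "\<phi> a = residue a" if "a \<in> A" for a
  proof -
    have "a \<in> local_ring" using that AO by simp
    then obtain P S where 1: "a = e P / e S" "f S \<noteq> 0" "residue a = f P / f S" "e S \<noteq> 0"
      using local_ringE by metis
    have "\<phi> a * \<phi> (e S) = \<phi> (e P)" using mult[OF that eA, of S] 1 by simp
    then have "\<phi> a * f S = f P" by (simp only: e)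
    then show ?thesis using 1(2,3) by (metis nonzero_mult_div_cancel_right)
  qed
qed

end

lemma field_ext_closed:
  fixes x y :: "'f::{field,finite} alg_closure"
  assumes "x \<in> field_ext k" "y \<in> field_ext k" shows "x / y \<in> field_ext k"
  using assms by (simp add: field_ext_def power_divide)

text \<open>Bridge from charts to the definition of points: the local ring of the chart with its
  residue map is a rational point, and by \<open>local_ring_unique\<close> no other one restricts to
  \<open>f\<close> on the image of \<open>e\<close>.\<close>

lemma ex1_rational_point:
  fixes e :: "'b::comm_ring_1 \<Rightarrow> 'f::{field,finite} ratfun_closure" and f :: "'b \<Rightarrow> 'f alg_closure"
  assumes chart: "regular_chart e f \<tau>"
    and K: "function_field R = {e P / e S | P S. e S \<noteq> 0}"
    and const: "\<And>c. e (\<iota> c) = embed_const c" "\<And>c. f (\<iota> c) = to_ac c"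
    and fk: "range f \<subseteq> field_ext k"
  shows "\<exists>!x. x \<in> rational_points R k \<and> range e \<subseteq> fst x \<and> (\<forall>P. snd x (e P) = f P)"
proof -
  interpret regular_chart e f \<tau> by (rule chart)
  define \<phi> where "\<phi> = restrict residue local_ring"
  have sub: "local_ring \<subseteq> function_field R" unfolding K local_ring_def using e_nz by blast
  have "inverse (e \<tau>) = e 1 / e \<tau>" by (simp add: e.hom_1 inverse_eq_divide)
  then have "inverse (e \<tau>) \<in> function_field R" unfolding K using e_tau by blast
  then have strict: "local_ring \<subset> function_field R" using sub inverse_tau_notin by blast
  have cA: "embed_const c \<in> local_ring" for c using range_local_ring[of "\<iota> c"] by (simp add: const)
  have "z \<in> local_ring \<or> inverse z \<in> local_ring" if "z \<in> function_field R" for z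
    using that fraction_cases unfolding K by blast
  then have comp: "local_ring \<in> compactification R"
    unfolding compactification_def using strict cA local_ring_diff local_ring_mult(1) by blast
  have fk': "f P \<in> field_ext k" for P using fk by blast
  have "residue a \<in> field_ext k" if "a \<in> local_ring" for a
    using that fk' by (auto elim!: local_ringE intro!: field_ext_closed)
  then have "\<phi> \<in> local_ring \<rightarrow>\<^sub>E field_ext k" by (auto simp: \<phi>_def)
  moreover have "\<phi> (embed_const c) = to_ac c" for c
    using cA[of c] residue_e[of "\<iota> c"] by (simp add: \<phi>_def const)
  ultimately have rp: "(local_ring, \<phi>) \<in> rational_points R k"
    unfolding rational_points_def
    using comp local_ring_add local_ring_mult residue_eq_0_iff by (auto simp: \<phi>_def)
  show ?thesis
  proof (rule ex1I[of _ "(local_ring, \<phi>)"])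
    show "(local_ring, \<phi>) \<in> rational_points R k \<and> range e \<subseteq> fst (local_ring, \<phi>) \<and> (\<forall>P. snd (local_ring, \<phi>) (e P) = f P)"
      using rp range_local_ring residue_e by (auto simp: \<phi>_def)
    fix x assume x: "x \<in> rational_points R k \<and> range e \<subseteq> fst x \<and> (\<forall>P. snd x (e P) = f P)"
    obtain A \<psi> where A: "x = (A, \<psi>)" by (cases x)
    have h: "A \<subseteq> {e P / e S | P S. e S \<noteq> 0}" "range e \<subseteq> A"
      "\<And>a b. a \<in> A \<Longrightarrow> b \<in> A \<Longrightarrow> a * b \<in> A"
      "\<And>a b. a \<in> A \<Longrightarrow> b \<in> A \<Longrightarrow> \<psi> (a * b) = \<psi> a * \<psi> b"
      "\<And>a. a \<in> A \<Longrightarrow> \<psi> a = 0 \<longleftrightarrow> a = 0 \<or> inverse a \<notin> A"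
      "\<And>P. \<psi> (e P) = f P" "\<psi> \<in> extensional A"
      using x unfolding A rational_points_def compactification_def K[symmetric] by (auto simp: PiE_def)
    have u: "A = local_ring" "\<And>a. a \<in> A \<Longrightarrow> \<psi> a = residue a"
      by (rule local_ring_unique[of A \<psi>]; use h in blast)+
    have "\<psi> = \<phi>" unfolding \<phi>_def
    proof (rule extensionalityI[of _ A])
      show "\<psi> \<in> extensional A" by (rule h(7))
      show "restrict residue local_ring \<in> extensional A" by (subst u(1)) (rule restrict_extensional)
      show "\<psi> a = restrict residue local_ring a" if "a \<in> A" for a
        using u(2)[OF that] that unfolding u(1) by simp
    qed
    then show "x = (local_ring, \<phi>)" using A u(1) by simp
  qed
qed

text \<open>Nested polynomials serve as polynomials in two variables; the inner variable is the
  coordinate \<open>x\<close>, the outer one \<open>y\<close>.\<close>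

definition bieval :: "('a::comm_ring_1 \<Rightarrow> 'b::comm_ring_1) \<Rightarrow> 'b \<Rightarrow> 'b \<Rightarrow> 'a poly poly \<Rightarrow> 'b" where
  "bieval h x y P = poly (map_poly (\<lambda>c. poly (map_poly h c) x) P) y"

context ring_morphism begin

lemma ring_morphism_bieval: "ring_morphism (bieval h x y)"
  unfolding bieval_def by (intro ring_morphism.ring_morphism_eval ring_morphism_eval)

lemma bieval_const: "bieval h x y [:c:] = poly (map_poly h c) x"
  and bieval_X: "bieval h x y [:[:0, 1:]:] = x"
  and bieval_Y: "bieval h x y [:0, 1:] = y"
  by (simp_all add: bieval_def map_poly_pCons hom_0 hom_1)

lemma bieval_const_const: "bieval h x y [:[:c:]:] = h c"
  by (simp add: bieval_def map_poly_pCons hom_0)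

lemma bieval_induct:
  assumes "\<And>c. Q [:[:c:]:]" "Q [:[:0, 1:]:]" "Q [:0, 1:]"
    and add: "\<And>P P'. Q P \<Longrightarrow> Q P' \<Longrightarrow> Q (P + P')" and mult: "\<And>P P'. Q P \<Longrightarrow> Q P' \<Longrightarrow> Q (P * P')"
  shows "Q P"
proof -
  have c: "Q [:c:]" for c
  proof (induction c)
    case 0
    then show ?case using assms(1)[of 0] by simp
  next
    case (pCons a c)
    have "[:pCons a c:] = [:[:a:]:] + [:[:0, 1:]:] * [:c:]" by simp
    then show ?case using add[OF assms(1) mult[OF assms(2) pCons(2)]] by metis
  qed
  show ?thesis
  proof (induction P)
    case 0
    then show ?case using assms(1)[of 0] by simp
  next
    case (pCons a P)
    have "pCons a P = [:a:] + [:0, 1:] * P" by simp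
    then show ?case using add[OF c mult[OF assms(3) pCons(2)]] by metis
  qed
qed

end

section \<open>The function field\<close>

lemma finite_field_power_CARD: "(x :: 'f::{field,finite}) ^ CARD('f) = x"
proof (cases "x = 0")
  case True
  then show ?thesis by (simp add: power_0_left)
next
  case False
  have "(\<Prod>y\<in>UNIV - {0}. x * y) = (\<Prod>y\<in>UNIV - {0 :: 'f}. y)"
    by (rule prod.reindex_bij_witness[of _ "\<lambda>y. y / x" "\<lambda>y. x * y"]) (use False in auto)
  then have "x ^ card (UNIV - {0 :: 'f}) * \<Prod>(UNIV - {0 :: 'f}) = \<Prod>(UNIV - {0 :: 'f})"
    by (simp add: prod.distrib)
  then have "x ^ card (UNIV - {0 :: 'f}) = 1" by simp
  moreover have "CARD('f) = Suc (card (UNIV - {0 :: 'f}))"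
    by (rule card.remove) auto
  ultimately show ?thesis by (simp only: power_Suc mult_1_right)
qed

text \<open>Nonzero terms of pairwise different degrees cannot cancel, so the term of largest degree
  survives.\<close>

lemma degree_sum_distinct_ge:
  fixes t :: "nat \<Rightarrow> 'a::comm_ring_1 poly"
  assumes "finite J" "j \<in> J" "t j \<noteq> 0"
    and distinct: "\<And>i j. i \<in> J \<Longrightarrow> j \<in> J \<Longrightarrow> t i \<noteq> 0 \<Longrightarrow> t j \<noteq> 0 \<Longrightarrow> degree (t i) = degree (t j) \<Longrightarrow> i = j"
  shows "degree (t j) \<le> degree (\<Sum>i\<in>J. t i)"
proof -
  define M where "M = {i \<in> J. t i \<noteq> 0}"
  have M: "finite M" "j \<in> M" using assms by (auto simp: M_def)
  let ?D = "(\<lambda>i. degree (t i)) ` M"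
  have "Max ?D \<in> ?D" using M by (intro Max_in) auto
  then obtain m where mM: "m \<in> M" "Max ?D = degree (t m)" by blast
  have m: "m \<in> M" "\<And>i. i \<in> M \<Longrightarrow> degree (t i) \<le> degree (t m)"
    unfolding mM(2)[symmetric] using M mM(1) by auto
  have "coeff (\<Sum>i\<in>J. t i) (degree (t m)) = (\<Sum>i\<in>J. coeff (t i) (degree (t m)))"
    by (rule coeff_sum)
  also have "\<dots> = (\<Sum>i\<in>{m}. coeff (t i) (degree (t m)))"
  proof (rule sum.mono_neutral_right)
    show "\<forall>i\<in>J - {m}. coeff (t i) (degree (t m)) = 0"
    proof
      fix i assume i: "i \<in> J - {m}"
      show "coeff (t i) (degree (t m)) = 0"
      proof (cases "t i = 0")
        case False
        then have "degree (t i) < degree (t m)" using i m distinct[of i m] unfolding M_def by fastforce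
        then show ?thesis by (rule coeff_eq_0)
      qed simp
    qed
  qed (use assms m in \<open>auto simp: M_def\<close>)
  also have "\<dots> \<noteq> 0" using m by (simp add: M_def)
  finally have "degree (t m) \<le> degree (\<Sum>i\<in>J. t i)" by (rule le_degree)
  then show ?thesis using m(2)[OF M(2)] by simp
qed

lemma embed_poly_simps [simp]:
  "embed_poly 0 = 0" "embed_poly 1 = 1" "embed_poly (a + b) = embed_poly a + embed_poly b"
  "embed_poly (a - b) = embed_poly a - embed_poly b" "embed_poly (- a) = - embed_poly a"
  "embed_poly (a * b) = embed_poly a * embed_poly b" "embed_poly a = 0 \<longleftrightarrow> a = 0"
  by (simp_all add: embed_poly_def)

lemma embed_poly_power [simp]: "embed_poly (a ^ n) = embed_poly a ^ n"
  by (induction n) simp_all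

interpretation embed_poly: ring_morphism embed_poly by standard simp_all

interpretation embed_const: ring_morphism embed_const
proof
  show "embed_const (x + y) = embed_const x + embed_const y" for x y :: 'a
    unfolding embed_const_def embed_poly_simps(3)[symmetric] by simp
  show "embed_const (x * y) = embed_const x * embed_const y" for x y :: 'a
    unfolding embed_const_def embed_poly_simps(6)[symmetric] by (simp add: mult.commute)
qed (simp add: embed_const_def flip: one_pCons)

interpretation to_ac: ring_morphism to_ac by standard simp_all

locale artin_schreier_curve =
  fixes R :: "'f::{field,finite} poly" and p :: nat
  assumes card_f: "CARD('f) = p" and p_CHAR: "\<exists>n>0. p = CHAR('f) ^ n" and prime_f: "prime CHAR('f)"
    and p_odd: "odd p" and R_def: "R = monom 2 p + monom 1 1"
begin

lemma CHAR_closures: "CHAR('f alg_closure) = CHAR('f)" "CHAR('f ratfun_closure) = CHAR('f)"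
proof -
  have "of_nat n = to_fract (of_nat n :: 'f poly)" for n
    by (induction n) simp_all
  then have "CHAR('f poly fract) = CHAR('f poly)"
    by (intro CHAR_eqI) (simp_all add: of_nat_eq_0_iff_char_dvd)
  then show "CHAR('f alg_closure) = CHAR('f)" "CHAR('f ratfun_closure) = CHAR('f)" by simp_all
qed

sublocale L: frobenius_field p "TYPE('f alg_closure)"
  unfolding frobenius_field_def CHAR_closures using p_CHAR prime_f p_odd by blast

sublocale K: frobenius_field p "TYPE('f ratfun_closure)"
  unfolding frobenius_field_def CHAR_closures using p_CHAR prime_f p_odd by blast

abbreviation gx :: "'f ratfun_closure" where "gx \<equiv> embed_poly [:0, 1:]"
abbreviation gy :: "'f ratfun_closure" where "gy \<equiv> generic_y R"

definition fX :: "'f poly" where "fX = monom 2 (p + 1) + monom 1 2"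

lemma fX: "[:0, 1:] * R = fX"
  by (simp add: R_def fX_def algebra_simps monom_Suc numeral_2_eq_2)

lemma poly_fX: "ring_morphism h \<Longrightarrow> poly (map_poly h fX) x = 2 * x ^ (p + 1) + x ^ 2"
  using ring_morphism.hom_numeral[of h]
  by (simp add: fX_def ring_morphism.eval_add map_poly_monom ring_morphism.hom_0 ring_morphism.hom_1 poly_monom)

lemma embed_poly_eval: "embed_poly c = poly (map_poly embed_const c) gx"
proof (induction c)
  case (pCons a c)
  have "embed_poly (pCons a c) = embed_poly ([:a:] + [:0, 1:] * c)" by simp
  then show ?case using pCons by (simp only: embed_poly.hom_simps embed_const.eval_pCons) (simp add: embed_const_def[symmetric])
qed simp

lemma embed_fX: "embed_poly fX = 2 * gx ^ (p + 1) + gx ^ 2"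
  unfolding embed_poly_eval[of fX] by (rule poly_fX[OF embed_const.ring_morphism_axioms])

lemma gy_eq: "gy ^ p - gy = 2 * gx ^ (p + 1) + gx ^ 2"
proof -
  let ?c = "embed_poly fX"
  let ?g = "monom 1 p + [:- ?c, -1:] :: 'f ratfun_closure poly"
  have "degree [:- ?c, -1:] < p" using L.p_gt_2 by simp
  then have "degree ?g = p" by (subst degree_add_eq_left) (simp_all add: degree_monom_eq)
  then obtain y where "poly ?g y = 0" using alg_closed_imp_poly_has_root[of ?g] L.p_gt_2 by auto
  then have "y ^ CARD('f) - y = embed_poly ([:0, 1:] * R)"
    unfolding fX card_f by (simp add: poly_monom algebra_simps)
  then have "gy ^ CARD('f) - gy = embed_poly ([:0, 1:] * R)" unfolding generic_y_def by (rule someI)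
  then show ?thesis unfolding fX card_f embed_fX .
qed

lemma gx_nz: "gx \<noteq> 0" by simp

definition ev :: "'f poly poly \<Rightarrow> 'f ratfun_closure" where "ev P = poly (map_poly embed_poly P) gy"

sublocale ev: ring_morphism ev
  unfolding ev_def by (rule embed_poly.ring_morphism_eval)

lemma ev_bieval: "ev P = bieval embed_const gx gy P"
proof -
  have "(\<lambda>c. poly (map_poly embed_const c) gx) = embed_poly"
    by (rule ext) (rule embed_poly_eval[symmetric])
  then show ?thesis unfolding ev_def bieval_def by simp
qed

lemma ev_const: "ev [:c:] = embed_poly c" by (simp add: ev_def map_poly_pCons)

lemma coordinate_ring_eq: "coordinate_ring R = range ev"
  by (simp add: coordinate_ring_def ev_def[abs_def])

section \<open>Irreducibility of the curve equation\<close>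

definition curve_poly :: "'f poly poly" where "curve_poly = monom 1 p + [:- fX, -1:]"

lemma degree_curve_poly: "degree curve_poly = p"
  unfolding curve_poly_def using L.p_gt_2 by (subst degree_add_eq_left) (simp_all add: degree_monom_eq)

lemma lead_coeff_curve_poly: "lead_coeff curve_poly = 1"
  unfolding degree_curve_poly using L.p_gt_2 by (simp add: curve_poly_def coeff_pCons split: nat.splits)

lemma curve_poly_nz: "curve_poly \<noteq> 0" using lead_coeff_curve_poly by auto

lemma eval_curve_poly:
  assumes "ring_morphism h"
  shows "poly (map_poly h curve_poly) y = y ^ p - y - h fX"
  using ring_morphism.hom_minus[OF assms]
  by (simp add: curve_poly_def ring_morphism.eval_add[OF assms] map_poly_monom map_poly_pCons
      ring_morphism.hom_0[OF assms] ring_morphism.hom_1[OF assms] poly_monom)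

lemma ev_curve_poly: "ev curve_poly = 0"
  unfolding ev_def using eval_curve_poly[OF embed_poly.ring_morphism_axioms] gy_eq embed_fX by simp

lemma bieval_curve_poly:
  "ring_morphism h \<Longrightarrow> bieval h a b curve_poly = b ^ p - b - (2 * a ^ (p + 1) + a ^ 2)"
  unfolding bieval_def using eval_curve_poly[OF ring_morphism.ring_morphism_eval] poly_fX by metis

text \<open>Giving \<open>x\<close> weight \<open>p\<close> and \<open>y\<close> weight \<open>p + 1\<close>, the substitution \<open>x = s\<^sup>p\<close>, \<open>y = 2 s\<^sup>p\<^sup>+\<^sup>1\<close>
  annihilates the leading form of the equation of the curve.\<close>

definition wsub :: "'f poly poly \<Rightarrow> 'f poly" where
  "wsub P = poly (map_poly (\<lambda>c. pcompose c (monom 1 p)) P) (monom 2 (p + 1))"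

interpretation pcompose: ring_morphism "\<lambda>c :: 'f poly. pcompose c (monom 1 p)"
  by standard (simp_all add: pcompose_add pcompose_mult pcompose_1)

interpretation wsub: ring_morphism wsub
  unfolding wsub_def by (rule pcompose.ring_morphism_eval)

lemma two_nz_f: "(2::'f) \<noteq> 0"
  using L.two_nz to_ac_eq_0_iff[of "2::'f"] by simp

text \<open>The coefficient of \<open>y ^ j\<close> contributes a term of degree
  \<open>p * degree (coeff G j) + (p + 1) * j\<close>, which is \<open>j\<close> modulo
  \<open>p\<close>. For \<open>j < p\<close> these degrees are distinct, so nothing cancels.\<close>

lemma degree_wsub_ge:
  assumes "G \<noteq> 0" "degree G < p"
  shows "p * degree (lead_coeff G) + (p + 1) * degree G \<le> degree (wsub G)" "wsub G \<noteq> 0"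
proof -
  define t where "t j = pcompose (coeff G j) (monom 1 p) * monom 2 (p + 1) ^ j" for j
  have sum: "wsub G = (\<Sum>j\<le>degree G. t j)"
    unfolding wsub_def t_def by (rule pcompose.eval_sum)
  have p0: "p > 0" using L.p_gt_2 by simp
  have nz: "t j \<noteq> 0 \<longleftrightarrow> coeff G j \<noteq> 0" for j
    using two_nz_f p0 by (auto simp: t_def pcompose_eq_0_iff degree_monom_eq)
  have deg: "degree (t j) = p * degree (coeff G j) + (p + 1) * j" if "coeff G j \<noteq> 0" for j
    using that two_nz_f p0 nz[of j] unfolding t_def
    by (subst degree_mult_eq) (auto simp: degree_pcompose degree_power_eq degree_monom_eq)
  have dist: "i = j" if "i \<in> {..degree G}" "j \<in> {..degree G}" "t i \<noteq> 0" "t j \<noteq> 0" "degree (t i) = degree (t j)" for i j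
  proof -
    have "p * degree (coeff G i) + (p + 1) * i = p * degree (coeff G j) + (p + 1) * j"
      using that deg nz by simp
    then have "(p * (degree (coeff G i) + i) + i) mod p = (p * (degree (coeff G j) + j) + j) mod p"
      by (simp add: algebra_simps)
    then show ?thesis using that assms by simp
  qed
  have "t (degree G) \<noteq> 0" using nz assms by simp
  then have le: "degree (t (degree G)) \<le> degree (wsub G)"
    unfolding sum using dist by (intro degree_sum_distinct_ge) auto
  then show *: "p * degree (lead_coeff G) + (p + 1) * degree G \<le> degree (wsub G)"
    using deg[of "degree G"] assms by simp
  show "wsub G \<noteq> 0"
  proof (cases "degree G = 0")
    case True
    then show ?thesis using \<open>t (degree G) \<noteq> 0\<close> unfolding sum by simp
  next
    case False
    then have "degree (wsub G) > 0" using * p0 by simp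
    then show ?thesis by auto
  qed
qed

text \<open>In the field with \<open>p\<close> elements \<open>2 ^ p = 2\<close>, so the images of
  \<open>y ^ p\<close> and \<open>2 * x ^ (p + 1)\<close> cancel; the rest comes from
  \<open>y\<close> and \<open>x ^ 2\<close>.\<close>

lemma degree_wsub_curve_poly: "degree (wsub curve_poly) \<le> 2 * p"
proof -
  have 2: "(2::'f) ^ p = 2" using finite_field_power_CARD[of "2::'f"] card_f by simp
  have "wsub curve_poly = monom 2 (p + 1) ^ p - monom 2 (p + 1) - pcompose fX (monom 1 p)"
    unfolding wsub_def by (rule eval_curve_poly) unfold_locales
  also have "pcompose fX (monom 1 p) = 2 * monom 1 p ^ (p + 1) + monom 1 p ^ 2"
    unfolding pcompose_altdef by (rule poly_fX) (standard, simp_all add: one_pCons)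
  also have "monom (2::'f) (p + 1) ^ p = 2 * monom 1 p ^ (p + 1)"
    by (simp add: monom_power 2 mult.commute numeral_poly smult_monom flip: monom_0 power_Suc) (simp add: mult_monom monom_power)
  finally have "wsub curve_poly = - monom 2 (p + 1) - monom 1 (2 * p)"
    by (simp add: monom_power mult.commute)
  also have "degree \<dots> \<le> 2 * p"
    using L.p_gt_2 by (intro degree_diff_le) (auto simp: degree_monom_eq two_nz_f)
  finally show ?thesis .
qed

text \<open>Pseudo-division by a relation \<open>H\<close> of least degree in \<open>y\<close> gives
  \<open>a * curve_poly = H * q\<close> for a polynomial \<open>a\<close> in \<open>x\<close>. Both
  factors have degree below \<open>p\<close> in \<open>y\<close>, so \<open>wsub\<close> of the
  product has degree at least \<open>p * degree a + (p + 1) * p\<close>. For the left side the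
  cancellation leaves at most \<open>p * degree a + 2 * p\<close>, which is smaller.\<close>

lemma ev_eq_0_low_degree:
  assumes "degree G < p" "ev G = 0" shows "G = 0"
proof (rule ccontr)
  assume "G \<noteq> 0"
  then obtain H where H: "H \<noteq> 0" "ev H = 0" "\<And>H'. H' \<noteq> 0 \<Longrightarrow> ev H' = 0 \<Longrightarrow> degree H \<le> degree H'"
    using ex_has_least_nat[of "\<lambda>H. H \<noteq> 0 \<and> ev H = 0" G degree] assms by blast
  have Hp: "degree H < p" using H(3)[OF \<open>G \<noteq> 0\<close> assms(2)] assms(1) by simp
  obtain a q where aq: "a \<noteq> 0" "smult a curve_poly = H * q + pseudo_mod curve_poly H"
    using pseudo_mod(1)[OF H(1)] by blast
  let ?r = "pseudo_mod curve_poly H"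
  have "ev (smult a curve_poly) = 0"
    using ev.hom_mult[of "[:a:]" curve_poly] ev_curve_poly by simp
  then have "ev ?r = 0" unfolding aq(2) using H(2) by (simp add: ev.hom_simps)
  then have "?r = 0" using pseudo_mod(2)[OF H(1)] H(3)[of ?r] by fastforce
  then have E: "smult a curve_poly = H * q" using aq(2) by simp
  have q: "q \<noteq> 0" using E aq(1) curve_poly_nz by auto
  have dHq: "degree H + degree q = p"
    using arg_cong[OF E, of degree] aq(1) H(1) q by (simp add: degree_mult_eq degree_curve_poly)
  have lHq: "lead_coeff H * lead_coeff q = a"
    using arg_cong[OF E, of lead_coeff] aq(1) lead_coeff_curve_poly lead_coeff_mult[of H q] by simp
  have H0: "degree H > 0"
  proof (rule ccontr)
    assume "\<not> degree H > 0"
    then obtain c where "H = [:c:]" using degree_eq_zeroE by blast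
    then show False using H(1,2) by (simp add: ev_const)
  qed
  have "degree (wsub H) + degree (wsub q) \<ge> p * degree (lead_coeff H) + p * degree (lead_coeff q) + (p + 1) * (degree H + degree q)"
  proof -
    have "degree q < p" using dHq H0 by simp
    then show ?thesis
      using degree_wsub_ge(1)[OF H(1) Hp] degree_wsub_ge(1)[OF q] unfolding add_mult_distrib2[of "p + 1"] by linarith
  qed
  also have "p * degree (lead_coeff H) + p * degree (lead_coeff q) = p * degree a"
    using lHq H(1) q degree_mult_eq[of "lead_coeff H" "lead_coeff q"] by (simp add: add_mult_distrib2)
  finally have ge: "p * degree a + (p + 1) * p \<le> degree (wsub H) + degree (wsub q)" using dHq by simp
  have "degree (wsub H) + degree (wsub q) = degree (wsub (smult a curve_poly))"
    unfolding E wsub.hom_mult using degree_wsub_ge(2)[OF H(1) Hp] degree_wsub_ge(2)[OF q] dHq H0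
    by (simp add: degree_mult_eq)
  also have "wsub (smult a curve_poly) = pcompose a (monom 1 p) * wsub curve_poly"
    unfolding wsub_def by (rule pcompose.eval_smult)
  also have "degree \<dots> \<le> p * degree a + 2 * p"
    using degree_mult_le[of "pcompose a (monom 1 p)" "wsub curve_poly"] degree_wsub_curve_poly
    by (simp add: degree_pcompose degree_monom_eq mult.commute)
  finally have "(p + 1) * p \<le> 2 * p" using ge by linarith
  then show False using L.p_gt_2 by simp
qed

lemma curve_division: "\<exists>q r. P = curve_poly * q + r \<and> degree r < p"
proof -
  obtain q r where qr: "pseudo_divmod P curve_poly = (q, r)" by fastforce
  show ?thesis
    using pseudo_divmod[OF curve_poly_nz qr] lead_coeff_curve_poly degree_curve_poly L.p_gt_2
    by (intro exI[of _ q] exI[of _ r]) auto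
qed

lemma ev_eq_0_dvd: "ev P = 0 \<Longrightarrow> \<exists>q. P = curve_poly * q"
proof -
  assume P: "ev P = 0"
  obtain q r where qr: "P = curve_poly * q + r" "degree r < p" using curve_division by blast
  then have "ev r = 0" using P ev_curve_poly by (simp add: ev.hom_simps)
  then have "r = 0" using ev_eq_0_low_degree qr(2) by blast
  then show ?thesis using qr by auto
qed

text \<open>A substitute for the norm to the polynomials in \<open>x\<close>. Take a nonzero
  multiple \<open>G\<close> of \<open>P\<close> of least degree in \<open>y\<close>. The
  pseudo-remainder of \<open>curve_poly\<close> by \<open>G\<close> is again a multiple of
  \<open>P\<close>, so by minimality it vanishes. If \<open>G\<close> involved \<open>y\<close>, its
  cofactor would be a nonzero relation of degree below \<open>p\<close>.\<close>

lemma ev_norm: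
  assumes "ev P \<noteq> 0" shows "\<exists>Q c. c \<noteq> 0 \<and> ev (P * Q) = ev [:c:]"
proof -
  let ?I = "\<lambda>G. ev G \<noteq> 0 \<and> (\<exists>Q. ev G = ev (P * Q))"
  have "?I P" using assms by (auto intro!: exI[of _ 1])
  then obtain G where G: "?I G" "\<And>G'. ?I G' \<Longrightarrow> degree G \<le> degree G'"
    using ex_has_least_nat[of ?I P degree] by blast
  then obtain Q where Q: "ev G = ev (P * Q)" by blast
  have G0: "G \<noteq> 0" using G(1) by (auto simp: ev.hom_0)
  have dG: "degree G < p"
  proof -
    obtain q r where qr: "G = curve_poly * q + r" "degree r < p" using curve_division by blast
    then have "ev r = ev G" using ev_curve_poly by (simp add: ev.hom_simps)
    then have "?I r" using G(1) by metis
    then have "degree G \<le> degree r" by (rule G(2))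
    then show ?thesis using qr(2) by simp
  qed
  have "degree G = 0"
  proof (rule ccontr)
    assume d0: "degree G \<noteq> 0"
    obtain a q where aq: "a \<noteq> 0" "smult a curve_poly = G * q + pseudo_mod curve_poly G"
      using pseudo_mod(1)[OF G0] by blast
    let ?r = "pseudo_mod curve_poly G"
    have dr: "?r = 0 \<or> degree ?r < degree G" by (rule pseudo_mod(2)[OF G0])
    have "ev (smult a curve_poly) = 0"
      using ev.hom_mult[of "[:a:]" curve_poly] ev_curve_poly by simp
    then have evr: "ev ?r = - (ev G * ev q)" unfolding aq(2) by (simp add: ev.hom_simps eq_neg_iff_add_eq_0 add.commute)
    also have "\<dots> = ev (P * (- Q * q))" unfolding Q by (simp add: ev.hom_simps)
    finally have "ev ?r = 0" using G(2)[of ?r] dr d0 by fastforce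
    then have "?r = 0" using ev_eq_0_low_degree dr dG by (metis order.strict_trans)
    then have E: "smult a curve_poly = G * q" using aq(2) by simp
    have q: "q \<noteq> 0" using E aq(1) curve_poly_nz by auto
    have "degree G + degree q = p"
      using arg_cong[OF E, of degree] aq(1) G0 q by (simp add: degree_mult_eq degree_curve_poly)
    then have "ev q \<noteq> 0" using ev_eq_0_low_degree[of q] q d0 by auto
    then show False using evr \<open>ev ?r = 0\<close> G(1) by simp
  qed
  then obtain c where "G = [:c:]" using degree_eq_zeroE by blast
  then show ?thesis using Q G0 by (metis pCons_0_0)
qed

end

context ring_morphism begin

lemma map_poly_hom_add: "map_poly h (P + Q) = map_poly h P + map_poly h Q"
  by (rule poly_eqI) (simp add: coeff_map_poly hom_0 hom_add)

lemma map_poly_hom_mult: "map_poly h (P * Q) = map_poly h P * map_poly h Q"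
  by (induction P)
     (simp_all add: map_poly_pCons hom_0 map_poly_hom_add map_poly_smult hom_mult)

lemma ring_morphism_map_poly: "ring_morphism (map_poly h)"
  by standard (simp_all add: map_poly_hom_add map_poly_hom_mult hom_1)

end

section \<open>Finite points\<close>

context artin_schreier_curve begin

lemma field_ext_eq: "field_ext k = L.fq k"
  by (simp add: field_ext_def L.fq_def card_f)

lemma function_field_eq: "function_field R = {ev P / ev S | P S. ev S \<noteq> 0}"
  unfolding function_field_def coordinate_ring_eq by blast

lemma poly_frob_add: "((x :: 'f poly) + y) ^ (p ^ i) = x ^ (p ^ i) + y ^ (p ^ i)"
proof -
  have "CHAR('f poly) = CHAR('f)" by simp
  moreover have "\<exists>n. p ^ i = CHAR('f) ^ n" using p_CHAR by (metis power_mult)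
  ultimately show ?thesis using freshmans_dream'[where ?'a = "'f poly"] prime_f by metis
qed

lemma const_frob: "(c::'f) ^ (p ^ i) = c"
  by (induction i) (simp_all add: power_mult finite_field_power_CARD flip: card_f)

lemma const_frob_p: "(c::'f) ^ p = c"
  using const_frob[of c 1] by simp

text \<open>One parameter for all affine points over \<open>fq k\<close>: its coefficients are in
  the base field, unlike those of \<open>x - a\<close> in general, and its roots are simple. A
  function of \<open>x\<close> can serve because the derivative of the equation in \<open>y\<close>
  is -1.\<close>

definition local_x :: "nat \<Rightarrow> 'f poly" where "local_x k = [:0, 1:] ^ (p ^ k) - [:0, 1:]"

text \<open>Constants are fixed by Frobenius, so \<open>c ^ (p ^ k)\<close> is \<open>c\<close> with
  \<open>x ^ (p ^ k)\<close> substituted for \<open>x\<close>; the induction is Horner's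
  scheme.\<close>

lemma local_x_dvd: "local_x k dvd c ^ (p ^ k) - c"
proof (induction c)
  case 0
  then show ?case using L.p_gt_2 by (simp add: power_0_left)
next
  case (pCons a c)
  let ?x = "[:0, 1:] :: 'f poly" and ?q = "p ^ k"
  have "pCons a c = [:a:] + ?x * c" by simp
  then have "pCons a c ^ ?q - pCons a c = ?x ^ ?q * (c ^ ?q - c) + local_x k * c"
    using const_frob[of a k] by (simp only: poly_frob_add power_mult_distrib poly_const_pow local_x_def) (simp add: algebra_simps)
  then show ?case using pCons by simp
qed

lemma local_x_dvd_iter: "local_x k dvd c ^ (p ^ (k * j)) - c"
proof (induction j)
  case (Suc j)
  have "c ^ (p ^ (k * Suc j)) - c = ((c ^ (p ^ (k * j))) ^ (p ^ k) - c ^ (p ^ (k * j))) + (c ^ (p ^ (k * j)) - c)"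
    by (simp add: power_add mult.commute flip: power_mult)
  then show ?case using dvd_add[OF local_x_dvd[of k "c ^ (p ^ (k * j))"] Suc] by metis
qed simp

context
  fixes k :: nat assumes k: "k > 0"
begin

definition tau_ideal :: "'f ratfun_closure set" where
  "tau_ideal = range (\<lambda>T. ev ([:local_x k:] * T))"

lemma tau_ideal_add: "x \<in> tau_ideal \<Longrightarrow> y \<in> tau_ideal \<Longrightarrow> x + y \<in> tau_ideal"
  unfolding tau_ideal_def image_iff by (metis distrib_left ev.hom_add UNIV_I)

lemma tau_ideal_mult: "x \<in> tau_ideal \<Longrightarrow> ev P * x \<in> tau_ideal"
proof -
  assume "x \<in> tau_ideal"
  then obtain T where "x = ev ([:local_x k:] * T)" by (auto simp: tau_ideal_def)
  then have "ev P * x = ev ([:local_x k:] * (P * T))" by (simp add: ev.hom_mult mult.left_commute del: mult_pCons_left)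
  then show ?thesis by (auto simp: tau_ideal_def)
qed

lemma tau_ideal_0: "0 \<in> tau_ideal"
  unfolding tau_ideal_def by (rule image_eqI[of _ _ 0]) (simp_all add: ev.hom_0)

lemma tau_ideal_ev: "x \<in> tau_ideal \<Longrightarrow> \<exists>P. x = ev P"
  by (auto simp: tau_ideal_def)

lemma tau_ideal_power: "x \<in> tau_ideal \<Longrightarrow> n > 0 \<Longrightarrow> x ^ n \<in> tau_ideal"
proof (induction n)
  case (Suc n)
  obtain P where "x = ev P" using tau_ideal_ev Suc by blast
  then show ?case using tau_ideal_mult[of x "P ^ n"] Suc by (simp add: ev.hom_power mult.commute)
qed simp

lemma tau_ideal_sum: "(\<And>i. i \<in> A \<Longrightarrow> g i \<in> tau_ideal) \<Longrightarrow> sum g A \<in> tau_ideal"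
  by (induction A rule: infinite_finite_induct) (auto simp: tau_ideal_0 tau_ideal_add)

lemma tau_ideal_dvd: "local_x k dvd c \<Longrightarrow> embed_poly c \<in> tau_ideal"
proof -
  assume "local_x k dvd c"
  then obtain d where "c = local_x k * d" by blast
  then have "embed_poly c = ev ([:local_x k:] * [:d:])" by (simp add: ev.hom_mult ev_const)
  then show ?thesis unfolding tau_ideal_def by blast
qed

text \<open>Iteration of \<open>y ^ p = y + F\<close>, where \<open>F\<close> is the right side of
  the equation of the curve.\<close>

lemma gy_frob: "gy ^ (p ^ m) = gy + K.tr m (embed_poly fX)"
proof (induction m)
  case (Suc m)
  let ?F = "embed_poly fX"
  have "gy ^ (p ^ Suc m) = (gy + K.tr m ?F) ^ p" by (simp add: Suc mult.commute flip: Suc power_mult)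
  also have "\<dots> = gy + (K.tr m (?F ^ p) + ?F)"
    using gy_eq embed_fX by (simp add: K.frob_add1 K.tr_power_p algebra_simps)
  also have "K.tr m (?F ^ p) + ?F = K.tr (Suc m) ?F"
    unfolding K.tr_frob_Suc by (simp add: K.tr_def)
  finally show ?case .
qed (simp add: K.tr_def)

text \<open>Modulo \<open>x ^ q - x\<close> the function \<open>F\<close> is fixed by the
  \<open>q\<close>-th power map, so each block of \<open>k\<close> summands gives the same value.
  For \<open>j = p\<close> the integer factor is 0, and \<open>y\<close> becomes fixed; hence the
  exponent \<open>k * p\<close> below.\<close>

lemma tr_fX_cong: "K.tr (k * j) (embed_poly fX) - of_nat j * K.tr k (embed_poly fX) \<in> tau_ideal"
proof (induction j)
  case 0
  then show ?case by (simp add: K.tr_def tau_ideal_0)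
next
  case (Suc j)
  let ?F = "embed_poly fX" let ?m = "k * j"
  have split: "K.tr (?m + i) ?F = K.tr ?m ?F + K.tr i (?F ^ (p ^ ?m))" for i
    by (induction i) (simp_all add: K.tr_def add.assoc power_add power_mult)
  have F: "?F ^ (p ^ ?m) - ?F \<in> tau_ideal"
    using tau_ideal_dvd[OF local_x_dvd_iter[of k fX j]] by simp
  have "K.tr k (?F ^ (p ^ ?m)) - K.tr k ?F = K.tr k (?F ^ (p ^ ?m) - ?F)"
    by (simp add: K.tr_diff)
  also have "\<dots> \<in> tau_ideal"
    unfolding K.tr_def using F L.p_gt_2 by (intro tau_ideal_sum tau_ideal_power) auto
  finally have "(K.tr ?m ?F - of_nat j * K.tr k ?F) + (K.tr k (?F ^ (p ^ ?m)) - K.tr k ?F) \<in> tau_ideal"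
    using Suc by (rule tau_ideal_add[rotated])
  moreover have "K.tr (k * Suc j) ?F - of_nat (Suc j) * K.tr k ?F
      = (K.tr ?m ?F - of_nat j * K.tr k ?F) + (K.tr k (?F ^ (p ^ ?m)) - K.tr k ?F)"
    using split[of k] by (simp add: algebra_simps)
  ultimately show ?case by simp
qed

text \<open>The residue ring modulo \<open>x\<^sup>q - x\<close> is generated by elements fixed by the \<open>q\<^sup>p\<close>-power map.\<close>
lemma ev_frob_cong: "ev P ^ (p ^ (k * p)) - ev P \<in> tau_ideal"
  unfolding ev_bieval
proof (induction P rule: embed_const.bieval_induct)
  case (1 c)
  have "bieval embed_const gx gy [:[:c:]:] = embed_poly [:c:]"
    unfolding ev_bieval[symmetric] by (rule ev_const)
  then show ?case using tau_ideal_dvd[OF local_x_dvd_iter[of k "[:c:]" p]] by simp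
next
  case 2
  then show ?case using tau_ideal_dvd[OF local_x_dvd_iter[of k "[:0, 1:]" p]] by (simp add: embed_const.bieval_X)
next
  case 3
  then show ?case using tr_fX_cong[of p] by (simp add: embed_const.bieval_Y gy_frob)
next
  case (4 P P')
  then show ?case
    unfolding ev_bieval[symmetric] ev.hom_add K.frob_add using tau_ideal_add[of "ev P ^ (p ^ (k * p)) - ev P" "ev P' ^ (p ^ (k * p)) - ev P'"]
    by (simp add: algebra_simps)
next
  case (5 P P')
  let ?N = "p ^ (k * p)"
  have "ev (P * P') ^ ?N - ev (P * P') = ev (P' ^ ?N) * (ev P ^ ?N - ev P) + ev P * (ev P' ^ ?N - ev P')"
    by (simp add: ev.hom_mult ev.hom_power power_mult_distrib algebra_simps)
  then show ?case
    using 5 unfolding ev_bieval[symmetric] by (simp add: tau_ideal_add tau_ideal_mult)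
qed

context
  fixes a b :: "'f alg_closure" assumes ab: "(a, b) \<in> L.affine_points k"
begin

interpretation fe: ring_morphism "bieval to_ac a b" by (rule to_ac.ring_morphism_bieval)

lemma ab_fq: "a \<in> L.fq k" "b \<in> L.fq k" "b ^ p - b = 2 * a ^ (p + 1) + a ^ 2"
  using ab by (auto simp: L.affine_points_def L.qform_def)

lemma local_x_at: "poly (map_poly to_ac (local_x k)) a = 0"
proof -
  interpret h: ring_morphism "\<lambda>c. poly (map_poly to_ac c) a" by (rule to_ac.ring_morphism_eval)
  show ?thesis using L.fq_frob[OF ab_fq(1)] by (simp add: local_x_def h.hom_simps map_poly_pCons)
qed

lemma local_x_nz: "local_x k \<noteq> 0"
proof
  assume "local_x k = 0"
  then have "degree ([:0, 1:] ^ (p ^ k) :: 'f poly) = degree [:0, 1 :: 'f:]" by (simp add: local_x_def)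
  then show False using L.pow_gt_1[OF k] L.p_gt_2 k by (simp add: degree_power_eq)
qed

lemma local_chart_affine: "local_chart ev (bieval to_ac a b) [:local_x k:]"
proof
  show "bieval to_ac a b P = 0" if "ev P = 0" for P
    using ev_eq_0_dvd[OF that] bieval_curve_poly[OF to_ac.ring_morphism_axioms, of a b] ab_fq(3)
    by (auto simp: fe.hom_mult)
  show "ev [:local_x k:] \<noteq> 0" using local_x_nz by (simp add: ev_const)
  show "bieval to_ac a b [:local_x k:] = 0" using local_x_at by (simp add: to_ac.bieval_const)
  fix P assume P: "bieval to_ac a b P = 0"
  let ?N = "p ^ (k * p)"
  have N: "?N > 1" using L.pow_gt_1[of "k * p"] k L.p_gt_2 by simp
  \<comment> \<open>At the point \<open>?S\<close> takes the value -1, while \<open>P * ?S\<close>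
    evaluates to \<open>ev P ^ ?N - ev P\<close>, a multiple of the parameter by
    \<open>ev_frob_cong\<close>.\<close>
  let ?S = "P ^ (?N - 1) - 1"
  have "bieval to_ac a b ?S \<noteq> 0" using P N by (simp add: fe.hom_simps power_0_left)
  moreover have "ev (P * ?S) = ev P ^ ?N - ev P"
  proof -
    have "ev P ^ ?N = ev P * ev P ^ (?N - 1)" using power_minus_mult[of ?N "ev P"] N L.p_gt_2 by (simp add: mult.commute)
    then show ?thesis by (simp add: ev.hom_simps algebra_simps)
  qed
  ultimately show "\<exists>S P'. bieval to_ac a b S \<noteq> 0 \<and> ev (P * S) = ev ([:local_x k:] * P')"
    using ev_frob_cong[of P] unfolding tau_ideal_def by (metis imageE)
qed

text \<open>By \<open>ev_norm\<close> only polynomials \<open>d\<close> in \<open>x\<close> need an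
  order. If \<open>d\<close> vanishes at \<open>a\<close>, then
  \<open>d * S = local_x k * d1\<close> with \<open>S\<close> nonzero at \<open>a\<close>. Since
  \<open>local_x k\<close> has a simple root there, \<open>d1\<close> vanishes to one order
  less.\<close>

lemma regular_chart_affine: "regular_chart ev (bieval to_ac a b) [:local_x k:]"
proof -
  interpret c: local_chart ev "bieval to_ac a b" "[:local_x k:]" by (rule local_chart_affine)
  interpret m: ring_morphism "map_poly to_ac :: 'f poly \<Rightarrow> _" by (rule to_ac.ring_morphism_map_poly)
  have m0: "map_poly to_ac d = 0 \<longleftrightarrow> d = 0" for d :: "'f poly" by (simp add: map_poly_eq_0_iff)
  have fc: "bieval to_ac a b [:d:] = poly (map_poly to_ac d) a" for d by (rule to_ac.bieval_const)
  have ox: "order a (map_poly to_ac (local_x k)) = 1"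
  proof -
    have "map_poly to_ac (local_x k) = [:0, 1:] ^ (p ^ k) - [:0, 1 :: 'f alg_closure:]"
      by (simp add: local_x_def m.hom_simps map_poly_pCons)
    then have "poly (pderiv (map_poly to_ac (local_x k))) a = - 1"
      using k by (simp add: pderiv_diff pderiv_power pderiv_pCons power_0_left)
    then have "order a (map_poly to_ac (local_x k)) \<le> 1" by (intro order_le_1) simp
    then show ?thesis using local_x_at local_x_nz m0 order_root[of "map_poly to_ac (local_x k)" a] by fastforce
  qed
  have ho: "c.has_order [:d:]" if "d \<noteq> 0" for d
    using that
  proof (induction "order a (map_poly to_ac d)" arbitrary: d rule: less_induct)
    case less
    show ?case
    proof (cases "poly (map_poly to_ac d) a = 0")
      case True
      let ?q = "p ^ k" let ?S = "d ^ (?q - 1) - 1"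
      have q: "?q > 1" using L.pow_gt_1[OF k] .
      obtain d1 where d1: "d ^ ?q - d = local_x k * d1" using local_x_dvd by blast
      have dS: "d * ?S = local_x k * d1"
        using q power_minus_mult[of ?q d] L.p_gt_2 unfolding d1[symmetric] by (simp add: algebra_simps)
      have S: "poly (map_poly to_ac ?S) a \<noteq> 0"
        using True q by (simp add: m.hom_simps power_0_left)
      then have "?S \<noteq> 0" by auto
      then have d10: "d1 \<noteq> 0" using dS less.prems by auto
      have "order a (map_poly to_ac d * map_poly to_ac ?S) = order a (map_poly to_ac (local_x k) * map_poly to_ac d1)"
        using dS by (simp flip: m.hom_mult)
      then have "order a (map_poly to_ac d) = 1 + order a (map_poly to_ac d1)"
        using less.prems \<open>?S \<noteq> 0\<close> d10 local_x_nz S ox order_0I[OF S]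
        by (subst (asm) order_mult; (subst (asm) order_mult)?) (auto simp: m0)
      then have o: "c.has_order [:d1:]" using less.hyps[of d1] d10 by simp
      have e: "ev ([:d:] * [:?S:]) = ev ([:local_x k:] * [:d1:])" using dS by (simp add: mult.commute)
      have "bieval to_ac a b [:?S:] \<noteq> 0" using S unfolding fc .
      then show ?thesis by (rule c.has_order_step[OF o _ e])
    qed (use c.has_order_unit fc in auto)
  qed
  show ?thesis
  proof
    show "\<exists>Q. c.has_order (P * Q)" if P: "ev P \<noteq> 0" for P
      using ev_norm[OF P] ho c.has_order_cong by metis
  qed
qed

lemma ex1_affine_rational_point:
  "\<exists>!x. x \<in> rational_points R k \<and> range ev \<subseteq> fst x \<and> (\<forall>P. snd x (ev P) = bieval to_ac a b P)"
proof (rule ex1_rational_point[OF regular_chart_affine function_field_eq])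
  show "ev [:[:c:]:] = embed_const c" "bieval to_ac a b [:[:c:]:] = to_ac c" for c
    by (simp_all add: ev_const embed_const_def to_ac.bieval_const_const)
  have c: "to_ac c \<in> L.fq k" for c using const_frob[of c k] by (simp add: L.fq_def flip: to_ac_power)
  have "bieval to_ac a b P \<in> L.fq k" for P
    by (induction P rule: to_ac.bieval_induct)
       (simp_all add: to_ac.bieval_const_const to_ac.bieval_X to_ac.bieval_Y c ab_fq fe.hom_simps L.fq_add L.fq_mult)
  then show "range (bieval to_ac a b) \<subseteq> field_ext k" unfolding field_ext_eq by blast
qed

end
end
end

section \<open>The point at infinity\<close>

lemma coeff_mult_degree_bounds:
  assumes "degree A \<le> m" "degree B \<le> n"
  shows "coeff (A * B) (m + n) = coeff A m * coeff B n"
proof -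
  have "coeff (A * B) (m + n) = (\<Sum>i\<le>m + n. coeff A i * coeff B (m + n - i))" by (rule coeff_mult)
  also have "\<dots> = (\<Sum>i\<in>{m}. coeff A i * coeff B (m + n - i))"
  proof (rule sum.mono_neutral_right)
    show "\<forall>i\<in>{..m + n} - {m}. coeff A i * coeff B (m + n - i) = 0"
    proof
      fix i assume "i \<in> {..m + n} - {m}"
      then have "m < i \<or> n < m + n - i" by auto
      then show "coeff A i * coeff B (m + n - i) = 0"
        using assms coeff_eq_0[of A i] coeff_eq_0[of B "m + n - i"] by auto
    qed
  qed auto
  finally show ?thesis by simp
qed

context artin_schreier_curve begin

text \<open>From \<open>y ^ p\<close> being close to \<open>2 * x ^ (p + 1)\<close>, the poles of
  \<open>x\<close> and \<open>y\<close> at infinity have orders \<open>p\<close> and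
  \<open>p + 1\<close>. Hence \<open>xi\<close> has a zero of order \<open>p\<close> and
  \<open>sv\<close> a simple one, and the point at infinity is the origin of this chart.\<close>

definition xi :: "'f ratfun_closure" where "xi = inverse gx"
definition sv :: "'f ratfun_closure" where "sv = gx / gy"
definition ei :: "'f poly poly \<Rightarrow> 'f ratfun_closure" where "ei = bieval embed_const xi sv"

abbreviation xB :: "'f poly poly" where "xB \<equiv> [:[:0, 1:]:]"
abbreviation yB :: "'f poly poly" where "yB \<equiv> [:0, 1:]"

lemma ring_morphism_ei: "ring_morphism ei"
  unfolding ei_def by (rule embed_const.ring_morphism_bieval)

sublocale ei: ring_morphism ei by (rule ring_morphism_ei)

lemma ei_xB: "ei xB = xi" and ei_yB: "ei yB = sv"
  by (simp_all add: ei_def embed_const.bieval_X embed_const.bieval_Y)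

lemma ev_xB: "ev xB = gx" and ev_yB: "ev yB = gy"
  by (simp_all add: ev_bieval embed_const.bieval_X embed_const.bieval_Y)

lemma gy_nz: "gy \<noteq> 0"
proof
  assume "gy = 0"
  then have "embed_poly fX = 0" using gy_eq L.p_gt_2 by (simp add: embed_fX power_0_left)
  then have "coeff fX 2 = 0" by simp
  then show False using L.p_gt_2 by (simp add: fX_def)
qed

lemma xi_nz: "xi \<noteq> 0" and sv_nz: "sv \<noteq> 0"
  using gx_nz gy_nz by (simp_all add: xi_def sv_def)

text \<open>The equation of the curve divided by \<open>x * y ^ p\<close>, with
  \<open>1 / y = xi * sv\<close>. The brackets take the nonzero values 1 and 2 at the origin, so
  \<open>xi\<close> is a unit times \<open>sv ^ p\<close>.\<close>

lemma relation_infinity: "xi * (1 - xi ^ (p - 1) * sv ^ (p - 1)) = sv ^ p * (2 + xi ^ (p - 1))"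
proof -
  obtain m where m: "p = Suc m" using L.p_gt_2 by (cases p) auto
  have "x \<noteq> 0 \<Longrightarrow> y \<noteq> 0 \<Longrightarrow> y ^ Suc m - y = 2 * x ^ Suc (Suc m) + x ^ 2 \<Longrightarrow>
     inverse x * (1 - inverse x ^ m * (x / y) ^ m) = (x / y) ^ Suc m * (2 + inverse x ^ m)" for x y :: "'f ratfun_closure"
  proof -
    assume xy: "x \<noteq> 0" "y \<noteq> 0" and e: "y ^ Suc m - y = 2 * x ^ Suc (Suc m) + x ^ 2"
    have 1: "inverse x ^ m * (x / y) ^ m = 1 / y ^ m"
      using xy by (simp add: power_divide power_inverse field_simps)
    have "inverse x * (1 - 1 / y ^ m) = (y ^ Suc m - y) / (x * y ^ Suc m)"
      using xy by (simp add: field_simps)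
    also have "\<dots> = (2 * x ^ Suc m + x) / y ^ Suc m"
      unfolding e using xy by (simp add: field_simps power2_eq_square)
    also have "2 * x ^ Suc m + x = x ^ Suc m * (2 + inverse x ^ m)"
      using xy by (simp add: power_inverse distrib_left)
    also have "x ^ Suc m * (2 + inverse x ^ m) / y ^ Suc m = (x / y) ^ Suc m * (2 + inverse x ^ m)"
      by (simp only: power_divide times_divide_eq_left)
    finally show ?thesis unfolding 1 .
  qed
  from this[OF gx_nz gy_nz] show ?thesis using gy_eq by (simp add: m xi_def sv_def)
qed

text \<open>Now \<open>y = \<lambda> s\<^sup>p\<^sup>+\<^sup>1\<close> with an indeterminate \<open>\<lambda>\<close>: the leading form of the curve becomes
  \<open>\<lambda>\<^sup>p - 2\<close>, which cannot divide a monomial.\<close>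
definition lsub :: "'f poly poly \<Rightarrow> 'f poly poly" where
  "lsub = bieval (\<lambda>c. [:[:c:]:]) (monom 1 p) (monom [:0, 1:] (p + 1))"

lemma ring_morphism_const_const: "ring_morphism (\<lambda>c :: 'f. [:[:c:]:])"
  by standard (simp_all add: one_pCons)

interpretation cc: ring_morphism "\<lambda>c :: 'f. [:[:c:]:]" by (rule ring_morphism_const_const)

interpretation lsub: ring_morphism lsub
  unfolding lsub_def by (rule cc.ring_morphism_bieval)

lemma lsub_xB: "lsub xB = monom 1 p" and lsub_yB: "lsub yB = monom [:0, 1:] (p + 1)"
  and lsub_const: "lsub [:[:c:]:] = [:[:c:]:]"
  by (simp_all add: lsub_def cc.bieval_X cc.bieval_Y cc.bieval_const_const)

text \<open>Only \<open>y ^ p\<close> and \<open>2 * x ^ (p + 1)\<close> reach the weight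
  \<open>(p + 1) * p\<close>; \<open>y\<close> and \<open>x ^ 2\<close> have the smaller weights
  \<open>p + 1\<close> and \<open>2 * p\<close>. The result is nonzero because its constant term is
  -2.\<close>

lemma lsub_curve_poly:
  "lead_coeff (lsub curve_poly) = [:0, 1:] ^ p - 2"
proof -
  let ?n = "(p + 1) * p"
  have eq: "lsub curve_poly = monom ([:0, 1:] ^ p) ?n - monom [:0, 1:] (p + 1) - (2 * monom 1 ?n + monom 1 (2 * p))"
    unfolding lsub_def using bieval_curve_poly[OF ring_morphism_const_const]
    by (simp add: monom_power mult.commute mult_monom)
  have "3 * p \<le> p * p" using L.p_gt_2 by simp
  then have p: "?n > p + 1" "?n > 2 * p" using L.p_gt_2 unfolding add_mult_distrib mult_1 by linarith+
  have two: "coeff (2 * A) i = 2 * coeff A i" for A :: "'f poly poly" and i by (simp add: numeral_poly)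
  have c: "coeff (lsub curve_poly) ?n = [:0, 1:] ^ p - 2"
    unfolding eq using p by (simp add: two)
  have nz: "[:0, 1:] ^ p - 2 \<noteq> (0 :: 'f poly)"
  proof
    assume "[:0, 1:] ^ p - 2 = (0 :: 'f poly)"
    then have "poly ([:0, 1:] ^ p - 2) (0::'f) = 0" by simp
    then show False using L.p_gt_2 two_nz_f by (simp add: power_0_left)
  qed
  have "degree (lsub curve_poly) \<le> ?n"
    unfolding eq
  proof (intro degree_diff_le degree_add_le)
    show "degree (2 * monom 1 ?n :: 'f poly poly) \<le> ?n"
      by (rule degree_le) (auto simp: two)
    show "degree (monom 1 (2 * p) :: 'f poly poly) \<le> ?n" using p by (simp add: degree_monom_eq)
    show "degree (monom [:0, 1:] (p + 1) :: 'f poly poly) \<le> ?n"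
      using degree_monom_le[of "[:0, 1:] :: 'f poly" "p + 1"] p by linarith
  qed (rule degree_monom_le)
  then have "degree (lsub curve_poly) = ?n" using c nz le_degree[of "lsub curve_poly" ?n] by simp
  then show ?thesis using c by simp
qed

text \<open>A function \<open>P(1/x, x/y)\<close> is \<open>G(x, y) / (x y)\<^sup>N\<close>, and the constant term of \<open>P\<close> is read off the
  part of \<open>G\<close> of weight \<open>(2 p + 1) N\<close>. So a nonzero constant term prevents the curve from dividing \<open>G\<close>.\<close>

definition adm :: "'f poly poly \<Rightarrow> nat \<Rightarrow> 'f poly poly \<Rightarrow> bool" where
  "adm P N G \<longleftrightarrow> ev G = (gx * gy) ^ N * ei P \<and> degree (lsub G) \<le> (2 * p + 1) * N \<and>
     coeff (lsub G) ((2 * p + 1) * N) = smult (coeff (coeff P 0) 0) ([:0, 1:] ^ N)"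

lemma adm_mult:
  assumes "adm P N G" "adm P' N' G'" shows "adm (P * P') (N + N') (G * G')"
proof -
  have d: "degree (lsub G) \<le> (2 * p + 1) * N" "degree (lsub G') \<le> (2 * p + 1) * N'"
    using assms by (auto simp: adm_def)
  have "degree (lsub (G * G')) \<le> (2 * p + 1) * (N + N')"
    using degree_mult_le[of "lsub G" "lsub G'"] d unfolding lsub.hom_mult add_mult_distrib2[of "2 * p + 1"] by linarith
  moreover have "coeff (lsub (G * G')) ((2 * p + 1) * (N + N')) = smult (coeff (coeff (P * P') 0) 0) ([:0, 1:] ^ (N + N'))"
    using coeff_mult_degree_bounds[OF d] assms
    unfolding lsub.hom_mult add_mult_distrib2[of "2 * p + 1"] by (simp add: adm_def coeff_mult_0 power_add mult.commute[of "coeff (coeff P 0) 0"])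
  ultimately show ?thesis using assms by (simp add: adm_def ev.hom_mult ei.hom_mult power_add)
qed

lemma adm_add:
  assumes "adm P N G" "adm P' N G'" shows "adm (P + P') N (G + G')"
  using assms by (auto simp: adm_def lsub.hom_add ev.hom_add ei.hom_add smult_add_left algebra_simps intro: degree_add_le)

lemma adm_const: "adm [:[:c:]:] 0 [:[:c:]:]"
  by (simp add: adm_def lsub_const ev_const ei_def embed_const.bieval_const_const embed_const_def)

lemma adm_one_1: "adm 1 1 (xB * yB)"
proof -
  have "lsub (xB * yB) = monom [:0, 1:] (2 * p + 1)"
    unfolding lsub.hom_mult lsub_xB lsub_yB mult_monom by (simp add: mult_2)
  then show ?thesis
    by (simp only: adm_def ev.hom_mult ev_xB ev_yB ei.hom_1) (simp add: degree_monom_le)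
qed

lemma adm_one: "adm 1 N ((xB * yB) ^ N)"
proof (induction N)
  case 0
  show ?case using adm_const[of 1] by (simp flip: one_pCons)
next
  case (Suc N)
  then show ?case using adm_mult[OF adm_one_1 Suc] by simp
qed

lemma adm_exists: "\<exists>N G. adm P N G"
proof (induction P rule: embed_const.bieval_induct)
  case (1 c)
  then show ?case using adm_const by blast
next
  case 2
  \<comment> \<open>Here \<open>1 / x = y / (x y)\<close>, and in the next case
    \<open>x / y = x ^ 2 / (x y)\<close>. The numerators have weights \<open>p + 1\<close> and
    \<open>2 * p\<close>, both below \<open>2 * p + 1\<close>, in accordance with the zero constant
    terms.\<close>
  have "gx * gy * xi = gy" using gx_nz by (simp add: xi_def)
  then have "adm xB 1 yB"
    using L.p_gt_2 degree_monom_le[of "[:0, 1:] :: 'f poly" "p + 1"]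
    by (auto simp add: adm_def lsub_yB ev_yB ei_xB)
  then show ?case by blast
next
  case 3
  have "ev (xB ^ 2) = gx * gy * sv" using gy_nz
    unfolding ev.hom_power ev_xB by (simp add: sv_def power2_eq_square)
  moreover have "lsub (xB ^ 2) = monom 1 (2 * p)" unfolding lsub.hom_power lsub_xB monom_power by (simp add: mult.commute)
  ultimately have "adm yB 1 (xB ^ 2)" by (simp only: adm_def ei_yB) (simp add: degree_monom_eq)
  then show ?case by blast
next
  case (4 P P')
  then obtain N G N' G' where "adm P N G" "adm P' N' G'" by blast
  \<comment> \<open>Multiplication by 1, represented with exponents \<open>N'\<close> and
    \<open>N\<close>, brings both summands to the common exponent \<open>N + N'\<close>.\<close>
  then have "adm (P * 1 + 1 * P') (N + N') (G * (xB * yB) ^ N' + (xB * yB) ^ N * G')"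
    using adm_mult[of P N G 1 N'] adm_mult[of 1 N _ P' N' G'] adm_one by (intro adm_add) blast+
  then show ?case by (metis mult_1_left mult_1_right)
next
  case (5 P P')
  then show ?case using adm_mult by blast
qed

lemma fi_eq: "bieval to_ac 0 0 P = to_ac (coeff (coeff P 0) 0)"
  by (simp add: bieval_def poly_0_coeff_0 coeff_map_poly)

interpretation fi: ring_morphism "bieval to_ac 0 0" by (rule to_ac.ring_morphism_bieval)

lemma kernel_infinity:
  assumes "ei P = 0" shows "bieval to_ac 0 0 P = (0 :: 'f alg_closure)"
proof -
  obtain N G where G: "adm P N G" using adm_exists by blast
  then have "ev G = 0" using assms by (simp add: adm_def)
  then obtain q where q: "G = curve_poly * q" using ev_eq_0_dvd by blast
  let ?c = "coeff (coeff P 0) 0"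
  have "?c = 0"
  proof (rule ccontr)
    assume c: "?c \<noteq> 0"
    have nz: "coeff (lsub G) ((2 * p + 1) * N) \<noteq> 0" using G c by (simp add: adm_def)
    have "degree (lsub G) = (2 * p + 1) * N" using G nz le_degree[OF nz] by (simp add: adm_def)
    then have "lead_coeff (lsub G) = smult ?c ([:0, 1:] ^ N)" using G by (simp add: adm_def)
    moreover have "lead_coeff (lsub G) = ([:0, 1:] ^ p - 2) * lead_coeff (lsub q)"
      unfolding q lsub.hom_mult lead_coeff_mult lsub_curve_poly ..
    \<comment> \<open>The value 2 is a root of \<lambda>\<open>^p - 2\<close> in the base field,
      since \<open>2 ^ p = 2\<close> there, but it is not a root of a nonzero monomial.\<close>
    ultimately have "poly (smult ?c ([:0, 1:] ^ N)) 2 = poly (([:0, 1:] ^ p - 2) * lead_coeff (lsub q)) 2"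
      by simp
    then have "?c * 2 ^ N = 0" using const_frob_p[of 2] by simp
    then show False using c two_nz_f by simp
  qed
  then show ?thesis by (simp add: fi_eq)
qed

text \<open>The relation at infinity solved for \<open>xi\<close>: every term on the other side
  contains \<open>sv\<close>. So the maximal ideal at the origin, generated by \<open>xi\<close> and
  \<open>sv\<close>, is generated by \<open>sv\<close> alone.\<close>

lemma xi_divisible:
  "xi = ei (yB * (yB ^ (p - 1) * (2 + xB ^ (p - 1)) + xB ^ p * yB ^ (p - 2)))"
proof -
  obtain m where m: "p = Suc (Suc m)" using L.p_gt_2 by (metis Suc_diff_Suc less_imp_Suc_add numeral_2_eq_2 zero_less_Suc add_Suc)
  have "xi = sv ^ p * (2 + xi ^ (p - 1)) + xi * (xi ^ (p - 1) * sv ^ (p - 1))"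
    using relation_infinity by (simp add: algebra_simps)
  then show ?thesis
    unfolding ei.hom_mult ei.hom_add ei.hom_power ei.hom_numeral ei_xB ei_yB
    by (simp add: m algebra_simps)
qed

lemma local_chart_infinity: "local_chart ei (bieval to_ac 0 0 :: _ \<Rightarrow> 'f alg_closure) yB"
proof
  show "ei yB \<noteq> 0" using sv_nz by (simp add: ei_yB)
  show "bieval to_ac 0 0 yB = (0 :: 'f alg_closure)" by (rule to_ac.bieval_Y)
  show "ei P = 0 \<Longrightarrow> bieval to_ac 0 0 P = (0 :: 'f alg_closure)" for P by (rule kernel_infinity)
  fix P assume "bieval to_ac 0 0 P = (0 :: 'f alg_closure)"
  then have c0: "coeff (coeff P 0) 0 = 0" by (simp add: fi_eq)
  obtain c P' where P: "P = pCons c P'" by (rule pCons_cases)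
  obtain a c' where c: "c = pCons a c'" by (rule pCons_cases)
  have "a = 0" using c0 P c by simp
  then have "P = xB * [:c':] + yB * P'" using P c by simp
  then have "ei P = xi * ei [:c':] + ei (yB * P')" by (simp only: ei.hom_add ei.hom_mult ei_xB)
  also have "\<dots> = ei (yB * ((yB ^ (p - 1) * (2 + xB ^ (p - 1)) + xB ^ p * yB ^ (p - 2)) * [:c':] + P'))"
    by (subst xi_divisible) (simp only: ei.hom_add ei.hom_mult ring_distribs mult.assoc)
  finally have "ei (P * 1) = ei (yB * ((yB ^ (p - 1) * (2 + xB ^ (p - 1)) + xB ^ p * yB ^ (p - 2)) * [:c':] + P'))"
    by (simp only: mult_1_right)
  moreover have "bieval to_ac 0 0 1 \<noteq> (0 :: 'f alg_closure)" by (simp add: fi.hom_1)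
  ultimately show "\<exists>S P'. bieval to_ac 0 0 S \<noteq> (0 :: 'f alg_closure) \<and> ei (P * S) = ei (yB * P')" by blast
qed

text \<open>Since \<open>xi * sv = 1 / y\<close>, one factor turns \<open>y\<close> into 1 and
  \<open>x\<close> into \<open>sv\<close>.\<close>

lemma clear_denominators: "\<exists>M Q. ev G * (xi * sv) ^ M = ei Q"
  unfolding ev_bieval
proof (induction G rule: embed_const.bieval_induct)
  case (1 c)
  have "bieval embed_const gx gy [:[:c:]:] * (xi * sv) ^ 0 = ei [:[:c:]:]"
    by (simp add: embed_const.bieval_const_const ei_def)
  then show ?case by blast
next
  case 2
  have "bieval embed_const gx gy xB * (xi * sv) ^ 1 = ei yB"
    using gx_nz unfolding embed_const.bieval_X ei_yB by (simp add: xi_def)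
  then show ?case by blast
next
  case 3
  have "bieval embed_const gx gy yB * (xi * sv) ^ 1 = ei 1"
    using gx_nz gy_nz unfolding embed_const.bieval_Y by (simp add: xi_def sv_def ei.hom_1)
  then show ?case by blast
next
  case (4 P P')
  then obtain M Q M' Q' where h: "ev P * (xi * sv) ^ M = ei Q" "ev P' * (xi * sv) ^ M' = ei Q'"
    unfolding ev_bieval by blast
  have "ev (P + P') * (xi * sv) ^ (M + M')
      = (ev P * (xi * sv) ^ M) * (xi * sv) ^ M' + (xi * sv) ^ M * (ev P' * (xi * sv) ^ M')"
    by (simp add: ev.hom_add power_add algebra_simps)
  also have "\<dots> = ei (Q * (xB * yB) ^ M' + (xB * yB) ^ M * Q')"
    unfolding h ei.hom_add ei.hom_mult ei.hom_power ei_xB ei_yB ..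
  finally show ?case unfolding ev_bieval by blast
next
  case (5 P P')
  then obtain M Q M' Q' where h: "ev P * (xi * sv) ^ M = ei Q" "ev P' * (xi * sv) ^ M' = ei Q'"
    unfolding ev_bieval by blast
  have "ev (P * P') * (xi * sv) ^ (M + M') = (ev P * (xi * sv) ^ M) * (ev P' * (xi * sv) ^ M')"
    by (simp add: ev.hom_mult power_add algebra_simps)
  also have "\<dots> = ei (Q * Q')" unfolding h ei.hom_mult ..
  finally show ?case unfolding ev_bieval by blast
qed

lemma embed_const_eq_0: "embed_const (c::'f) = 0 \<longleftrightarrow> c = 0"
  by (simp add: embed_const_def)

text \<open>The reflected polynomial has the leading coefficient of \<open>c\<close> as constant
  term, so a nonzero polynomial in \<open>x\<close> is a power of \<open>x\<close> times a unit at
  infinity.\<close>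

lemma ei_reflect: "ei [:reflect_poly c:] = xi ^ degree c * embed_poly c"
proof -
  let ?C = "map_poly embed_const c"
  have d: "degree ?C = degree c" by (rule degree_map_poly) (simp add: embed_const_eq_0)
  have "map_poly embed_const (reflect_poly c) = reflect_poly ?C"
    by (rule poly_eqI) (simp add: coeff_map_poly coeff_reflect_poly d embed_const.hom_0)
  then have "ei [:reflect_poly c:] = poly (reflect_poly ?C) xi"
    by (simp add: ei_def embed_const.bieval_const)
  also have "\<dots> = xi ^ degree c * poly ?C gx"
    using poly_reflect_poly_nz[OF xi_nz, of ?C] by (simp add: d) (simp add: xi_def)
  finally show ?thesis using embed_poly_eval[of c] by simp
qed

text \<open>Through \<open>ev_norm\<close>, some multiple of \<open>P\<close> becomes a polynomial
  in \<open>x\<close> up to powers of \<open>xi\<close> and \<open>sv\<close>. By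
  \<open>ei_reflect\<close> it is then a unit times such powers; \<open>sv\<close> is the parameter,
  and \<open>xi\<close> has an order by the relation at infinity.\<close>

lemma regular_chart_infinity: "regular_chart ei (bieval to_ac 0 0 :: _ \<Rightarrow> 'f alg_closure) yB"
proof -
  let ?f = "bieval to_ac 0 0 :: _ \<Rightarrow> 'f alg_closure"
  interpret c: local_chart ei ?f yB by (rule local_chart_infinity)
  have fx: "?f xB = 0" and fy: "?f yB = 0" by (rule to_ac.bieval_X, rule to_ac.bieval_Y)
  have hx: "c.has_order xB"
    unfolding c.has_order_def
  proof (intro exI conjI)
    show "?f (1 - xB ^ (p - 1) * yB ^ (p - 1)) \<noteq> 0" "?f (2 + xB ^ (p - 1)) \<noteq> 0"
      using L.p_gt_2 L.two_nz unfolding fi.hom_simps fx fy by (simp_all add: power_0_left)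
    show "ei (xB * (1 - xB ^ (p - 1) * yB ^ (p - 1))) = ei (yB ^ p * (2 + xB ^ (p - 1)))"
      using relation_infinity unfolding ei.hom_simps ei_xB ei_yB .
  qed
  have hy: "c.has_order yB" by (rule c.has_order_tau)
  show ?thesis
  proof
    fix P assume P: "ei P \<noteq> 0"
    obtain N G where G: "adm P N G" using adm_exists by blast
    have evG: "ev G = (gx * gy) ^ N * ei P" using G by (simp add: adm_def)
    then have "ev G \<noteq> 0" using P gx_nz gy_nz by simp
    then obtain Q c where Q: "c \<noteq> 0" "ev (G * Q) = ev [:c:]" using ev_norm by blast
    obtain M Q' where M: "ev Q * (xi * sv) ^ M = ei Q'" using clear_denominators by blast
    let ?d = "degree c"
    have one: "(gx * gy) * (xi ^ 2 * sv) = 1"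
      using gx_nz gy_nz by (simp add: xi_def sv_def power2_eq_square field_simps)
    have "ei P = ei P * ((gx * gy) * (xi ^ 2 * sv)) ^ N" unfolding one by simp
    also have "\<dots> = ev G * (xi ^ 2 * sv) ^ N" unfolding evG power_mult_distrib by (simp add: mult_ac)
    finally have eiP: "ei P = ev G * (xi ^ 2 * sv) ^ N" .
    have "ei (P * (Q' * xB ^ ?d)) = ev G * (xi ^ 2 * sv) ^ N * (ev Q * (xi * sv) ^ M * xi ^ ?d)"
      unfolding M ei.hom_mult ei.hom_power ei_xB eiP ..
    also have "\<dots> = ev (G * Q) * xi ^ ?d * ((xi ^ 2 * sv) ^ N * (xi * sv) ^ M)"
      unfolding ev.hom_mult by (simp only: mult_ac)
    also have "\<dots> = ei ([:reflect_poly c:] * ((xB ^ 2 * yB) ^ N * (xB * yB) ^ M))"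
      unfolding Q(2) ev_const ei.hom_mult ei_reflect ei.hom_power ei_xB ei_yB by (simp only: mult_ac)
    finally have e: "ei (P * (Q' * xB ^ ?d)) = ei ([:reflect_poly c:] * ((xB ^ 2 * yB) ^ N * (xB * yB) ^ M))" .
    have fc: "?f [:reflect_poly c:] \<noteq> 0" using Q(1) by (simp add: fi_eq)
    have "c.has_order ([:reflect_poly c:] * ((xB ^ 2 * yB) ^ N * (xB * yB) ^ M))"
      by (rule c.has_order_mult[OF c.has_order_unit[OF fc]]) (intro c.has_order_mult c.has_order_power hx hy)
    then show "\<exists>Q. c.has_order (P * Q)" using e c.has_order_cong by blast
  qed
qed

lemma function_field_eq_infinity: "function_field R = {ei P / ei S | P S. ei S \<noteq> 0}"
proof (intro equalityI subsetI)
  fix z assume "z \<in> function_field R"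
  then obtain P S where z: "z = ev P / ev S" "ev S \<noteq> 0" unfolding function_field_eq by blast
  obtain M Q M' Q' where h: "ev P * (xi * sv) ^ M = ei Q" "ev S * (xi * sv) ^ M' = ei Q'"
    using clear_denominators by blast
  have nz: "xi * sv \<noteq> 0" using xi_nz sv_nz by simp
  have P: "ei (Q * (xB * yB) ^ M') = ev P * (xi * sv) ^ (M + M')"
    and S: "ei (Q' * (xB * yB) ^ M) = ev S * (xi * sv) ^ (M + M')"
    unfolding ei.hom_mult ei.hom_power ei_xB ei_yB h[symmetric] power_add by (simp_all only: mult_ac)
  have "z = ei (Q * (xB * yB) ^ M') / ei (Q' * (xB * yB) ^ M)"
    unfolding P S z using nz by (simp del: mult_eq_0_iff)
  moreover have "ei (Q' * (xB * yB) ^ M) \<noteq> 0" unfolding S using nz z(2) by simp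
  ultimately show "z \<in> {ei P / ei S | P S. ei S \<noteq> 0}" by blast
next
  fix z assume "z \<in> {ei P / ei S | P S. ei S \<noteq> 0}"
  then obtain P S where z: "z = ei P / ei S" "ei S \<noteq> 0" by blast
  obtain N G N' G' where "adm P N G" "adm S N' G'" using adm_exists by blast
  then have h: "ev G = (gx * gy) ^ N * ei P" "ev G' = (gx * gy) ^ N' * ei S" by (auto simp: adm_def)
  have nz: "gx * gy \<noteq> 0" using gx_nz gy_nz by simp
  have P: "ev (G * (xB * yB) ^ N') = ei P * (gx * gy) ^ (N + N')"
    and S: "ev (G' * (xB * yB) ^ N) = ei S * (gx * gy) ^ (N + N')"
    unfolding ev.hom_mult ev.hom_power ev_xB ev_yB h power_add by (simp_all only: mult_ac)
  have "z = ev (G * (xB * yB) ^ N') / ev (G' * (xB * yB) ^ N)"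
    unfolding P S z using nz by (simp del: mult_eq_0_iff)
  moreover have "ev (G' * (xB * yB) ^ N) \<noteq> 0" unfolding S using nz z(2) by simp
  ultimately show "z \<in> function_field R" unfolding function_field_eq by blast
qed

lemma ex1_infinite_rational_point:
  "\<exists>!x. x \<in> rational_points R k \<and> range ei \<subseteq> fst x \<and> (\<forall>P. snd x (ei P) = bieval to_ac 0 0 P)"
proof (rule ex1_rational_point[OF regular_chart_infinity function_field_eq_infinity])
  show "ei [:[:c:]:] = embed_const c" "bieval to_ac 0 0 [:[:c:]:] = to_ac c" for c
    by (simp_all add: ei_def embed_const.bieval_const_const to_ac.bieval_const_const)
  have "to_ac c \<in> L.fq k" for c using const_frob[of c k] by (simp add: L.fq_def flip: to_ac_power)
  then show "range (bieval to_ac 0 0 :: _ \<Rightarrow> 'f alg_closure) \<subseteq> field_ext k"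
    unfolding field_ext_eq by (auto simp: fi_eq)
qed

end

section \<open>Counting rational points\<close>

context artin_schreier_curve begin

lemma rational_point_facts:
  assumes x: "x \<in> rational_points R k"
  defines "A \<equiv> fst x" and "\<phi> \<equiv> snd x"
  shows "embed_const c \<in> A" "A \<subset> function_field R"
    "u \<in> A \<Longrightarrow> v \<in> A \<Longrightarrow> u - v \<in> A" "u \<in> A \<Longrightarrow> v \<in> A \<Longrightarrow> u * v \<in> A" "u \<in> A \<Longrightarrow> v \<in> A \<Longrightarrow> u + v \<in> A"
    "z \<in> function_field R \<Longrightarrow> z \<in> A \<or> inverse z \<in> A"
    "u \<in> A \<Longrightarrow> \<phi> u \<in> L.fq k" "\<phi> (embed_const c) = to_ac c"
    "u \<in> A \<Longrightarrow> v \<in> A \<Longrightarrow> \<phi> (u + v) = \<phi> u + \<phi> v" "u \<in> A \<Longrightarrow> v \<in> A \<Longrightarrow> \<phi> (u * v) = \<phi> u * \<phi> v"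
    "u \<in> A \<Longrightarrow> \<phi> u = 0 \<longleftrightarrow> u = 0 \<or> inverse u \<notin> A"
proof -
  have A: "A \<in> compactification R" "\<phi> \<in> A \<rightarrow>\<^sub>E field_ext k" "\<And>c. \<phi> (embed_const c) = to_ac c"
    "\<forall>a\<in>A. \<forall>b\<in>A. \<phi> (a + b) = \<phi> a + \<phi> b \<and> \<phi> (a * b) = \<phi> a * \<phi> b"
    "\<forall>a\<in>A. \<phi> a = 0 \<longleftrightarrow> a = 0 \<or> inverse a \<notin> A"
    using x unfolding rational_points_def A_def \<phi>_def by (auto simp: case_prod_beta)
  have B: "range embed_const \<subseteq> A" "A \<subset> function_field R"
     "\<And>a b. a \<in> A \<Longrightarrow> b \<in> A \<Longrightarrow> a - b \<in> A" "\<And>a b. a \<in> A \<Longrightarrow> b \<in> A \<Longrightarrow> a * b \<in> A"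
     "\<And>z. z \<in> function_field R \<Longrightarrow> z \<in> A \<or> inverse z \<in> A"
    using A(1) unfolding compactification_def by blast+
  show c: "embed_const c \<in> A" for c using B(1) by blast
  show "u \<in> A \<Longrightarrow> v \<in> A \<Longrightarrow> u + v \<in> A"
  proof -
    assume uv: "u \<in> A" "v \<in> A"
    have "0 - v \<in> A" using B(3)[OF c[of 0] uv(2)] by (simp add: embed_const.hom_0)
    then show "u + v \<in> A" using B(3)[OF uv(1), of "0 - v"] by simp
  qed
  show "u \<in> A \<Longrightarrow> \<phi> u \<in> L.fq k" using A(2) by (auto simp: field_ext_eq)
  show "A \<subset> function_field R" by (rule B(2))
  show "u \<in> A \<Longrightarrow> v \<in> A \<Longrightarrow> u - v \<in> A" "u \<in> A \<Longrightarrow> v \<in> A \<Longrightarrow> u * v \<in> A"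
    "z \<in> function_field R \<Longrightarrow> z \<in> A \<or> inverse z \<in> A"
    by (rule B; assumption)+
  show "\<phi> (embed_const c) = to_ac c" by (rule A(3))
  show "u \<in> A \<Longrightarrow> v \<in> A \<Longrightarrow> \<phi> (u + v) = \<phi> u + \<phi> v" "u \<in> A \<Longrightarrow> v \<in> A \<Longrightarrow> \<phi> (u * v) = \<phi> u * \<phi> v"
    using A(4) by blast+
  show "u \<in> A \<Longrightarrow> \<phi> u = 0 \<longleftrightarrow> u = 0 \<or> inverse u \<notin> A" using A(5) by blast
qed

lemma rational_point_bieval:
  assumes x: "x \<in> rational_points R k" and uv: "u \<in> fst x" "v \<in> fst x"
  shows "bieval embed_const u v P \<in> fst x \<and> snd x (bieval embed_const u v P) = bieval to_ac (snd x u) (snd x v) P"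
proof (induction P rule: embed_const.bieval_induct)
  case (1 c)
  show ?case using rational_point_facts(1,8)[OF x] by (simp add: embed_const.bieval_const_const to_ac.bieval_const_const)
next
  case 2
  show ?case using uv by (simp add: embed_const.bieval_X to_ac.bieval_X)
next
  case 3
  show ?case using uv by (simp add: embed_const.bieval_Y to_ac.bieval_Y)
next
  case (4 P P')
  then show ?case
    using rational_point_facts(5,9)[OF x]
    by (simp add: ring_morphism.hom_add[OF embed_const.ring_morphism_bieval] ring_morphism.hom_add[OF to_ac.ring_morphism_bieval])
next
  case (5 P P')
  then show ?case
    using rational_point_facts(4,10)[OF x]
    by (simp add: ring_morphism.hom_mult[OF embed_const.ring_morphism_bieval] ring_morphism.hom_mult[OF to_ac.ring_morphism_bieval])
qed

lemma gen_in_function_field: "gx \<in> function_field R" "gy \<in> function_field R" "sv \<in> function_field R"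
proof -
  have 1: "ev 1 \<noteq> 0" "ev yB \<noteq> 0" using gy_nz by (simp_all add: ev_yB ev.hom_1)
  have "gx = ev xB / ev 1" "gy = ev yB / ev 1" "sv = ev xB / ev yB"
    unfolding ev_xB ev_yB ev.hom_1 by (simp_all add: sv_def)
  then show "gx \<in> function_field R" "gy \<in> function_field R" "sv \<in> function_field R"
    unfolding function_field_eq using 1 by blast+
qed

text \<open>Integrality of \<open>y\<close> over the polynomials in \<open>x\<close>: with
  \<open>F\<close> the right side of the equation,
  \<open>y = F * (1 / y) ^ (p - 1) + (1 / y) ^ (p - 2)\<close>. So if the valuation ring contained
  \<open>1 / y\<close> but not \<open>y\<close>, it would contain \<open>y\<close> after
  all.\<close>

lemma gy_integral:
  assumes x: "x \<in> rational_points R k" and gx: "gx \<in> fst x"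
  shows "gy \<in> fst x"
proof (rule ccontr)
  note facts = rational_point_facts[OF x]
  assume n: "gy \<notin> fst x"
  then have i: "inverse gy \<in> fst x" using facts(6)[OF gen_in_function_field(2)] by blast
  obtain m where m: "p = Suc (Suc m)" using L.p_gt_2 by (metis Suc_diff_Suc less_imp_Suc_add numeral_2_eq_2 zero_less_Suc add_Suc)
  let ?P = "[:fX:] * yB ^ Suc m + yB ^ m"
  interpret b: ring_morphism "bieval embed_const gx (inverse gy)" by (rule embed_const.ring_morphism_bieval)
  have "bieval embed_const gx (inverse gy) ?P = embed_poly fX * inverse gy ^ Suc m + inverse gy ^ m"
    unfolding b.hom_add b.hom_mult b.hom_power embed_const.bieval_Y embed_const.bieval_const
    by (simp add: embed_poly_eval[of fX])
  also have "embed_poly fX = gy ^ Suc (Suc m) - gy" unfolding embed_fX using gy_eq m by simp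
  also have "(gy ^ Suc (Suc m) - gy) * inverse gy ^ Suc m + inverse gy ^ m = gy"
  proof -
    have "(u ^ Suc (Suc m) - u) * w ^ Suc m + w ^ m = u" if "u * w = 1" for u w :: "'f ratfun_closure"
    proof -
      have "u ^ m * w ^ m = 1" using that by (simp flip: power_mult_distrib)
      moreover have "(u ^ Suc (Suc m) - u) * w ^ Suc m + w ^ m = u * (u * w) * (u ^ m * w ^ m) - (u * w) * w ^ m + w ^ m"
        by (simp add: algebra_simps)
      ultimately show ?thesis using that by simp
    qed
    then show ?thesis using gy_nz by simp
  qed
  finally show False using rational_point_bieval[OF x gx i, of ?P] n by simp
qed

lemma affine_iff:
  assumes x: "x \<in> rational_points R k"
  shows "gx \<in> fst x \<and> snd x gx = a \<and> snd x gy = b \<longleftrightarrow> range ev \<subseteq> fst x \<and> (\<forall>P. snd x (ev P) = bieval to_ac a b P)"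
proof
  assume h: "gx \<in> fst x \<and> snd x gx = a \<and> snd x gy = b"
  then have "gy \<in> fst x" using gy_integral[OF x] by blast
  then show "range ev \<subseteq> fst x \<and> (\<forall>P. snd x (ev P) = bieval to_ac a b P)"
    using rational_point_bieval[OF x, of gx gy] h by (auto simp: ev_bieval)
next
  assume h: "range ev \<subseteq> fst x \<and> (\<forall>P. snd x (ev P) = bieval to_ac a b P)"
  then have "ev xB \<in> fst x" "snd x (ev xB) = a" "snd x (ev yB) = b"
    by (auto simp: to_ac.bieval_X to_ac.bieval_Y)
  then show "gx \<in> fst x \<and> snd x gx = a \<and> snd x gy = b" unfolding ev_xB ev_yB by blast
qed

lemma affine_rational_point_coordinates:
  assumes x: "x \<in> rational_points R k" and gx: "gx \<in> fst x"
  shows "(snd x gx, snd x gy) \<in> L.affine_points k"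
proof -
  note facts = rational_point_facts[OF x]
  have gy: "gy \<in> fst x" by (rule gy_integral[OF x gx])
  have "bieval to_ac (snd x gx) (snd x gy) curve_poly = snd x (ev curve_poly)"
    using rational_point_bieval[OF x gx gy, of curve_poly] by (simp add: ev_bieval)
  also have "\<dots> = 0" using facts(8)[of 0] ev_curve_poly by (simp add: embed_const.hom_0)
  finally show ?thesis
    using facts(7)[OF gx] facts(7)[OF gy] unfolding bieval_curve_poly[OF to_ac.ring_morphism_axioms]
    by (simp add: L.affine_points_def L.qform_def)
qed

text \<open>If \<open>x\<close> is not regular, \<open>xi\<close> has residue 0. The relation at
  infinity then forces \<open>sv\<close> to be regular with residue 0, so the point is the origin of
  the second chart.\<close>

lemma infinite_iff:
  assumes x: "x \<in> rational_points R k"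
  shows "gx \<notin> fst x \<longleftrightarrow> range ei \<subseteq> fst x \<and> (\<forall>P. snd x (ei P) = bieval to_ac 0 0 P)"
proof
  note facts = rational_point_facts[OF x]
  interpret t: ring_morphism "bieval to_ac u v :: _ \<Rightarrow> 'f alg_closure" for u v
    by (rule to_ac.ring_morphism_bieval)
  interpret e: ring_morphism "bieval embed_const u v :: _ \<Rightarrow> 'f ratfun_closure" for u v
    by (rule embed_const.ring_morphism_bieval)
  have z: "snd x 0 = 0" using facts(8)[of 0] by (simp add: embed_const.hom_0)
  assume n: "gx \<notin> fst x"
  have xi: "xi \<in> fst x" unfolding xi_def using n facts(6)[OF gen_in_function_field(1)] by blast
  have xi0: "snd x xi = 0" using facts(11)[OF xi] n by (simp add: xi_def)
  have sv: "sv \<in> fst x"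
  proof (rule ccontr)
    assume ns: "sv \<notin> fst x"
    let ?t = "inverse sv"
    have t: "?t \<in> fst x" using ns facts(6)[OF gen_in_function_field(3)] by blast
    have t0: "snd x ?t = 0" using facts(11)[OF t] ns by simp
    \<comment> \<open>The relation at infinity divided by \<open>sv ^ p\<close>, as a polynomial in
      \<open>xi\<close> and \<open>1 / sv\<close>. If both had residue 0, its value would be -2
      instead of 0.\<close>
    let ?P = "xB * (yB ^ p - xB ^ (p - 1) * yB) - (2 + xB ^ (p - 1))"
    have 1: "?t ^ p * sv ^ (p - 1) = ?t" "?t ^ p * sv ^ p = 1"
    proof -
      obtain m where m: "p = Suc m" using L.p_gt_2 by (cases p) auto
      have "?t ^ n * sv ^ n = 1" for n using sv_nz by (simp flip: power_mult_distrib)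
      from this[of m] this[of p] show "?t ^ p * sv ^ (p - 1) = ?t" "?t ^ p * sv ^ p = 1"
        by (simp_all add: m mult.assoc)
    qed
    have "?t ^ p * (xi * (1 - xi ^ (p - 1) * sv ^ (p - 1))) = ?t ^ p * (sv ^ p * (2 + xi ^ (p - 1)))"
      unfolding relation_infinity ..
    then have "xi * (?t ^ p - xi ^ (p - 1) * (?t ^ p * sv ^ (p - 1))) = (?t ^ p * sv ^ p) * (2 + xi ^ (p - 1))"
      by (simp add: algebra_simps)
    then have "bieval embed_const xi ?t ?P = 0"
      unfolding e.hom_simps embed_const.bieval_X embed_const.bieval_Y 1 by simp
    then have "bieval to_ac 0 0 ?P = (0 :: 'f alg_closure)"
      using rational_point_bieval[OF x xi t, of ?P] xi0 t0 z by simp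
    moreover have "bieval to_ac 0 0 ?P = (- 2 :: 'f alg_closure)"
      unfolding t.hom_simps to_ac.bieval_X to_ac.bieval_Y using L.p_gt_2 by (simp add: power_0_left)
    ultimately show False using L.two_nz by simp
  qed
  \<comment> \<open>With residue 0 for \<open>xi\<close>, the relation leaves
    \<open>2 * sv ^ p = 0\<close> for the residue of \<open>sv\<close>.\<close>
  let ?P = "xB * (1 - xB ^ (p - 1) * yB ^ (p - 1)) - yB ^ p * (2 + xB ^ (p - 1))"
  have "ei ?P = 0"
    unfolding ei.hom_simps ei_xB ei_yB relation_infinity by simp
  then have "bieval to_ac 0 (snd x sv) ?P = (0 :: 'f alg_closure)"
    using rational_point_bieval[OF x xi sv, of ?P] xi0 z by (simp add: ei_def)
  then have "snd x sv ^ p * 2 = 0"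
    unfolding t.hom_simps to_ac.bieval_X to_ac.bieval_Y using L.p_gt_2 by (simp add: power_0_left)
  then have "snd x sv = 0" using L.two_nz by simp
  then show "range ei \<subseteq> fst x \<and> (\<forall>P. snd x (ei P) = bieval to_ac 0 0 P)"
    using rational_point_bieval[OF x xi sv] xi0 by (auto simp: ei_def)
next
  note facts = rational_point_facts[OF x]
  assume h: "range ei \<subseteq> fst x \<and> (\<forall>P. snd x (ei P) = bieval to_ac 0 0 P)"
  then have "ei xB \<in> fst x" "snd x (ei xB) = bieval to_ac 0 0 xB" by blast+
  then have "xi \<in> fst x" "snd x xi = 0" unfolding ei_xB to_ac.bieval_X .
  then show "gx \<notin> fst x" using facts(11)[of xi] xi_nz by (simp add: xi_def)
qed

text \<open>Points are separated according to whether \<open>x\<close> is regular. The residues of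
  \<open>x\<close> and \<open>y\<close> match the regular case with the affine solutions, and the
  remaining case has exactly one point.\<close>

theorem card_rational_points:
  assumes k: "k > 0" shows "card (rational_points R k) = 1 + card (L.affine_points k)"
proof -
  let ?A = "{x \<in> rational_points R k. gx \<in> fst x}" and ?I = "{x \<in> rational_points R k. gx \<notin> fst x}"
  have bij: "bij_betw (\<lambda>x. (snd x gx, snd x gy)) ?A (L.affine_points k)"
  proof (rule bij_betw_imageI)
    show "inj_on (\<lambda>x. (snd x gx, snd x gy)) ?A"
    proof (rule inj_onI)
      fix x y assume xy: "x \<in> ?A" "y \<in> ?A" "(snd x gx, snd x gy) = (snd y gx, snd y gy)"
      then have ab: "(snd x gx, snd x gy) \<in> L.affine_points k" using affine_rational_point_coordinates by blast
      show "x = y"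
        using ex1_affine_rational_point[OF k ab] affine_iff[of x k "snd x gx" "snd x gy"] affine_iff[of y k "snd x gx" "snd x gy"] xy
        by auto
    qed
    show "(\<lambda>x. (snd x gx, snd x gy)) ` ?A = L.affine_points k"
    proof
      show "(\<lambda>x. (snd x gx, snd x gy)) ` ?A \<subseteq> L.affine_points k"
        using affine_rational_point_coordinates by auto
      show "L.affine_points k \<subseteq> (\<lambda>x. (snd x gx, snd x gy)) ` ?A"
      proof
        fix ab assume "ab \<in> L.affine_points k"
        then obtain a b where ab: "ab = (a, b)" "(a, b) \<in> L.affine_points k" by (cases ab) auto
        obtain x where x: "x \<in> rational_points R k" "range ev \<subseteq> fst x \<and> (\<forall>P. snd x (ev P) = bieval to_ac a b P)"
          using ex1_affine_rational_point[OF k ab(2)] by blast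
        have c: "gx \<in> fst x \<and> snd x gx = a \<and> snd x gy = b"
          using affine_iff[OF x(1), of a b] x(2) by blast
        show "ab \<in> (\<lambda>x. (snd x gx, snd x gy)) ` ?A"
          by (rule image_eqI[of _ _ x]) (use c ab(1) x(1) in simp_all)
      qed
    qed
  qed
  obtain x where "?I = {x}"
  proof -
    have "x \<in> ?I \<longleftrightarrow> x \<in> rational_points R k \<and> range ei \<subseteq> fst x \<and> (\<forall>P. snd x (ei P) = bieval to_ac 0 0 P)" for x
      using infinite_iff[of x k] by blast
    then have "\<exists>!x. x \<in> ?I" using ex1_infinite_rational_point[of k] by simp
    then show thesis using that by blast
  qed
  then have I: "card ?I = 1" "finite ?I" by simp_all
  have A: "card ?A = card (L.affine_points k)" "finite ?A"
    using bij_betw_same_card[OF bij] bij_betw_finite[OF bij] L.finite_affine_points[OF k] by simp_all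
  have "rational_points R k = ?I \<union> ?A" by auto
  then have "card (rational_points R k) = card (?I \<union> ?A)" by (rule arg_cong)
  also have "\<dots> = card ?I + card ?A" using I A by (intro card_Un_disjoint) auto
  finally show ?thesis using I A by simp
qed

end

text \<open>Translation by 1 permutes the field; comparing the sums over all elements shows that the
  order of the field is 0 in it.\<close>

lemma finite_field_CHAR:
  assumes "prime p0" "CARD('f::{field,finite}) = p0 ^ n"
  shows "CHAR('f) = p0"
proof -
  have "(\<Sum>x\<in>UNIV. x + 1) = (\<Sum>x\<in>UNIV. x :: 'f)"
    by (rule sum.reindex_bij_witness[of _ "\<lambda>x. x - 1" "\<lambda>x. x + 1"]) auto
  then have "of_nat (CARD('f)) = (0 :: 'f)" by (simp add: sum.distrib)
  then have d: "CHAR('f) dvd p0 ^ n" using assms(2) of_nat_eq_0_iff_char_dvd by metis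
  then have "CHAR('f) > 0" using assms(1) by (metis dvd_0_left gr0I not_prime_0 power_not_zero)
  then have "prime CHAR('f)" using prime_CHAR_semidom[where ?'a = 'f] by blast
  then show ?thesis using d assms(1) by (metis prime_dvd_power primes_dvd_imp_eq)
qed

lemma power_mod_4:
  "p mod 4 = 1 \<Longrightarrow> p ^ h mod 4 = (1::nat)"
  "p mod 4 = 3 \<Longrightarrow> p ^ h mod 4 = (if even h then 1 else 3 :: nat)"
proof -
  show "p mod 4 = 1 \<Longrightarrow> p ^ h mod 4 = (1::nat)"
    by (metis One_nat_def mod_less numeral_eq_Suc power_mod power_one zero_less_Suc Suc_less_eq pred_numeral_simps(2))
  assume p: "p mod 4 = 3"
  show "p ^ h mod 4 = (if even h then 1 else 3 :: nat)"
  proof (induction h)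
    case (Suc h)
    have "p ^ Suc h mod 4 = ((p mod 4) * (p ^ h mod 4)) mod 4" by (simp add: mod_mult_eq)
    then show ?case using Suc p by auto
  qed simp
qed

theorem theorem7p9:
  fixes R :: "'f::{field,finite} poly" and p0 n p g k :: nat
  assumes "prime p0" and "odd p0" and "n \<ge> 1" and "p = p0 ^ n"
    and "CARD('f) = p"
    and "R = monom 2 p + monom 1 1"
    and "g = p * (p - 1) div 2"
    and "k \<ge> 1"
  shows "([p = 1] (mod 4) \<and> [k = 0] (mod 6) \<longrightarrow> minimal_over g R k) \<and>
         ([p = 3] (mod 4) \<longrightarrow>
           (maximal_over g R k \<longleftrightarrow> [k = 0] (mod 6) \<and> odd (k div 6)))"
proof -
  have CHAR: "CHAR('f) = p0" using finite_field_CHAR[OF assms(1)] assms(4,5) by metis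
  interpret artin_schreier_curve R p
  proof
    show "\<exists>n>0. p = CHAR('f) ^ n" using assms(3,4) CHAR by (intro exI[of _ n]) auto
    show "odd p" using assms(2,4) by simp
  qed (use assms CHAR in auto)
  have k: "k > 0" using assms(8) by simp
  have p2: "p > 2" by (rule L.p_gt_2)
  define N where "N = card (L.affine_points k)"
  define D where "D = real p * (real p - 1) * sqrt (real p ^ k)"
  have card: "real (card (rational_points R k)) = 1 + real N"
    using card_rational_points[OF k] by (simp add: N_def)
  have "even (p * (p - 1))" using p_odd by simp
  then have "2 * g = p * (p - 1)" unfolding assms(7) by (rule dvd_mult_div_cancel)
  then have "real (2 * g) = real (p * (p - 1))" by (rule arg_cong)
  then have g2: "2 * real g = real p * (real p - 1)" using p2 by (simp add: of_nat_diff)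
  have max: "maximal_over g R k \<longleftrightarrow> real N = real p ^ k + D"
    and min: "minimal_over g R k \<longleftrightarrow> real N = real p ^ k - D"
    unfolding maximal_over_def minimal_over_def Let_def card assms(5) g2 D_def by auto
  have D0: "D > 0" using p2 by (simp add: D_def)
  have six: "real N = (if p ^ (k div 2) mod 4 = 1 then real p ^ k - D else real p ^ k + D)"
    if "6 dvd k" and mod: "p ^ (k div 2) mod 4 = 1 \<or> p ^ (k div 2) mod 4 = 3"
  proof -
    define h where "h = k div 2"
    have h: "k = 2 * h" "h > 0" "3 dvd h" unfolding h_def using that(1) k by presburger+
    have "sqrt (real p ^ k) = real p ^ h" by (simp add: h(1) power_even_eq)
    then show ?thesis
      using L.card_affine_points_6[OF h(2,3)] mod unfolding h_def[symmetric] N_def D_def h(1) by auto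
  qed
  show ?thesis
  proof (intro conjI impI)
    assume a: "[p = 1] (mod 4) \<and> [k = 0] (mod 6)"
    then have "p ^ (k div 2) mod 4 = 1" by (intro power_mod_4(1)) (simp add: cong_def)
    moreover have "6 dvd k" using a by (simp add: cong_0_iff)
    ultimately show "minimal_over g R k" unfolding min using six by simp
  next
    assume "[p = 3] (mod 4)"
    then have p3: "p mod 4 = 3" by (simp add: cong_def)
    note pm = power_mod_4(2)[OF p3]
    \<comment> \<open>For 6 dividing \<open>k\<close>, \<open>k div 2\<close> is three times
      \<open>k div 6\<close>, so the two have the same parity, and this parity decides
      \<open>p ^ (k div 2)\<close> modulo 4.\<close>
    have six_dvd: "real N = (if even (k div 6) then real p ^ k - D else real p ^ k + D)" if "6 dvd k"
    proof -
      have "even (k div 2) \<longleftrightarrow> even (k div 6)" using that by presburger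
      then show ?thesis using six[OF that] pm[of "k div 2"] by simp
    qed
    have "6 dvd k" if m: "maximal_over g R k"
    proof (rule ccontr)
      assume "\<not> 6 dvd k"
      then have "\<not> 3 dvd k \<or> odd k" by presburger
      then show False
      proof
        assume "\<not> 3 dvd k"
        \<comment> \<open>Maximality makes the squared deviation equal to \<open>D ^ 2\<close>,
          which is \<open>p\<close> times the bound obtained for this case.\<close>
        then have "D ^ 2 \<le> real p * (real p - 1) ^ 2 * real p ^ k"
          using L.card_affine_points_deviation[OF k] m unfolding max N_def[symmetric] by simp
        moreover have "D ^ 2 = real p * (real p * (real p - 1) ^ 2 * real p ^ k)"
          by (simp add: D_def power_mult_distrib power2_eq_square)
        moreover have "real p * (real p - 1) ^ 2 * real p ^ k > 0" using p2 by simp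
        ultimately show False using p2 by simp
      next
        assume "odd k"
        \<comment> \<open>Maximality would give \<open>N - p ^ k = d * sqrt (p ^ k)\<close>.
          Squaring over the integers shows that \<open>d\<close> divides the left side, so
          \<open>p ^ k\<close> would be a perfect square, whereas it is 3 modulo 4.\<close>
        define d where "d = p * (p - 1)"
        have d: "real d = real p * (real p - 1)" using p2 by (simp add: d_def of_nat_diff)
        have le: "p ^ k \<le> N" using m D0 unfolding max by (metis less_eq_real_def less_add_same_cancel1 of_nat_le_iff of_nat_power)
        have "real (N - p ^ k) = D" using m le unfolding max by (simp add: of_nat_diff)
        then have "real ((N - p ^ k) ^ 2) = real (d ^ 2 * p ^ k)"
          unfolding of_nat_power of_nat_mult d by (simp add: D_def power_mult_distrib)
        then have sq: "(N - p ^ k) ^ 2 = d ^ 2 * p ^ k" by (simp only: of_nat_eq_iff)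
        then have "d ^ 2 dvd (N - p ^ k) ^ 2" by simp
        then have "d dvd N - p ^ k" by (simp add: pow_divides_pow_iff)
        then obtain e where "N - p ^ k = d * e" by blast
        then have "d ^ 2 * e ^ 2 = d ^ 2 * p ^ k" using sq by (simp add: power_mult_distrib)
        then have "e ^ 2 = p ^ k" using p2 by (simp add: d_def)
        then have "(e mod 4) ^ 2 mod 4 = 3" using pm[of k] \<open>odd k\<close> by (simp add: power_mod)
        moreover have "e mod 4 \<in> {0, 1, 2, 3}" by auto
        ultimately show False by auto
      qed
    qed
    then show "maximal_over g R k \<longleftrightarrow> [k = 0] (mod 6) \<and> odd (k div 6)"
      using six_dvd D0 unfolding max cong_0_iff by auto
  qed
qed

end
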